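(* Let $G$ be a signed digraph with $n$ vertices which is homogenous and has no positive cycles, no sources and no initial cycles. Then every and-or-net on $G$ has a synchronizing word of length at most $10(\sqrt{5}+1)^n$.
   Context: A signed digraph on $V$ is $(V,E)$ with $E\subseteq V\times V\times\{-1,1\}$ (arc from $j$ to $i$ of sign $s$; loops allowed). Paths and cycles have no repeated vertices (a loop is a cycle); the sign of a path/cycle is the product of its arc signs. A strong component is a maximal strongly connected induced subgraph; it is initial if no arc enters it from outside. An initial cycle is an initial strong component that is a cycle. A source is a vertex of in-degree zero. A path is forward if it has at least one arc and the two end vertices of its last arc lie in distinct strong components. $G$ is $i$-homogenous if every strong component of $G$ contains a vertex $j$ such that all forward paths from $j$ to $i$ have the same sign (vacuously if there are none); $G$ is homogenous if it is $i$-homogenous for every vertex $i$. A Boolean network (BN) is $f:\{0,1\}^V\to\{0,1\}^V$; its signed interaction digraph has a positive (negative) arc from $j$ to $i$ iff for some $x$ with $x_j=0$, $f_i(x+e_j)-f_i(x)$ is positive (negative). An and-or-net on $G$ is a BN whose signed interaction digraph is $G$ and each $f_i$ is a conjunction ($f_i(x)=1$ iff $x_j=1$ for all positive and $x_j=0$ for all negative in-neighbors $j$ of $i$) or a disjunction ($f_i(x)=0$ iff $x_j=0$ for all positive and $x_j=1$ for all negative in-neighbors). $f^i(x)$ is $x$ with $x_i$ replaced by $f_i(x)$; $f^{i_1\cdots i_\ell}=f^{i_\ell}\circ\cdots\circ f^{i_1}$; $w$ is synchronizing if $f^w$ is constant. *)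

theory Defs
  imports Complex_Main
begin

(* A signed digraph on the vertex type 'v: a set of arcs (j, i, s), an arc from j to i of sign s. *)
type_synonym 'v sdigraph = "('v \<times> 'v \<times> int) set"

definition signed_digraph :: "'v sdigraph \<Rightarrow> bool" where
  "signed_digraph E \<longleftrightarrow> (\<forall>(j,i,s)\<in>E. s \<in> {-1, 1})"

fun arc_src :: "'v \<times> 'v \<times> int \<Rightarrow> 'v" where "arc_src (j,i,s) = j"
fun arc_tgt :: "'v \<times> 'v \<times> int \<Rightarrow> 'v" where "arc_tgt (j,i,s) = i"
fun arc_sign :: "'v \<times> 'v \<times> int \<Rightarrow> int" where "arc_sign (j,i,s) = s"

(* consecutive arcs are chained *)
fun chained :: "('v \<times> 'v \<times> int) list \<Rightarrow> bool" where
  "chained [] = True"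
| "chained [a] = True"
| "chained (a # b # es) = (arc_tgt a = arc_src b \<and> chained (b # es))"

(* the sign of a path / cycle: product of its arc signs *)
definition walk_sign :: "('v \<times> 'v \<times> int) list \<Rightarrow> int" where
  "walk_sign es = prod_list (map arc_sign es)"

(* a path from u to w given by its list of arcs; no repeated vertices *)
definition is_path :: "'v sdigraph \<Rightarrow> 'v \<Rightarrow> 'v \<Rightarrow> ('v \<times> 'v \<times> int) list \<Rightarrow> bool" where
  "is_path E u w es \<longleftrightarrow>
     (if es = [] then u = w
      else set es \<subseteq> E \<and> chained es \<and> arc_src (hd es) = u \<and> arc_tgt (last es) = w
           \<and> distinct (map arc_src es @ [arc_tgt (last es)]))"

(* a cycle: closed chained arc list with no repeated vertex (a loop is a cycle) *)
definition is_cycle :: "'v sdigraph \<Rightarrow> ('v \<times> 'v \<times> int) list \<Rightarrow> bool" where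
  "is_cycle E es \<longleftrightarrow> es \<noteq> [] \<and> set es \<subseteq> E \<and> chained es
     \<and> arc_tgt (last es) = arc_src (hd es) \<and> distinct (map arc_src es)"

definition has_positive_cycle :: "'v sdigraph \<Rightarrow> bool" where
  "has_positive_cycle E \<longleftrightarrow> (\<exists>es. is_cycle E es \<and> walk_sign es = 1)"

(* unsigned arc relation and reachability *)
definition arc_rel :: "'v sdigraph \<Rightarrow> ('v \<times> 'v) set" where
  "arc_rel E = {(j,i). \<exists>s. (j,i,s) \<in> E}"

(* strong components: maximal sets of mutually reachable vertices *)
definition strong_component :: "'v sdigraph \<Rightarrow> 'v set \<Rightarrow> bool" where
  "strong_component E C \<longleftrightarrow> C \<noteq> {}
     \<and> (\<forall>a\<in>C. \<forall>b\<in>C. (a,b) \<in> (arc_rel E)\<^sup>*)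
     \<and> (\<forall>a\<in>C. \<forall>b. (a,b) \<in> (arc_rel E)\<^sup>* \<and> (b,a) \<in> (arc_rel E)\<^sup>* \<longrightarrow> b \<in> C)"

definition same_component :: "'v sdigraph \<Rightarrow> 'v \<Rightarrow> 'v \<Rightarrow> bool" where
  "same_component E a b \<longleftrightarrow> (a,b) \<in> (arc_rel E)\<^sup>* \<and> (b,a) \<in> (arc_rel E)\<^sup>*"

definition initial_component :: "'v sdigraph \<Rightarrow> 'v set \<Rightarrow> bool" where
  "initial_component E C \<longleftrightarrow> strong_component E C
     \<and> \<not> (\<exists>j i s. (j,i,s) \<in> E \<and> j \<notin> C \<and> i \<in> C)"

(* an initial strong component whose induced subgraph is a cycle *)
definition has_initial_cycle :: "'v sdigraph \<Rightarrow> bool" where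
  "has_initial_cycle E \<longleftrightarrow> (\<exists>C es. initial_component E C \<and> is_cycle E es
     \<and> set (map arc_src es) = C
     \<and> {e \<in> E. arc_src e \<in> C \<and> arc_tgt e \<in> C} = set es)"

definition is_source :: "'v sdigraph \<Rightarrow> 'v \<Rightarrow> bool" where
  "is_source E i \<longleftrightarrow> \<not> (\<exists>j s. (j,i,s) \<in> E)"

(* forward path: at least one arc, last arc between distinct strong components *)
definition forward_path :: "'v sdigraph \<Rightarrow> 'v \<Rightarrow> 'v \<Rightarrow> ('v \<times> 'v \<times> int) list \<Rightarrow> bool" where
  "forward_path E u w es \<longleftrightarrow> is_path E u w es \<and> es \<noteq> []
     \<and> \<not> same_component E (arc_src (last es)) (arc_tgt (last es))"

definition i_homogenous :: "'v sdigraph \<Rightarrow> 'v \<Rightarrow> bool" where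
  "i_homogenous E i \<longleftrightarrow> (\<forall>C. strong_component E C \<longrightarrow>
     (\<exists>j\<in>C. \<forall>p q. forward_path E j i p \<and> forward_path E j i q \<longrightarrow> walk_sign p = walk_sign q))"

definition homogenous :: "'v sdigraph \<Rightarrow> bool" where
  "homogenous E \<longleftrightarrow> (\<forall>i. i_homogenous E i)"

(* Boolean networks on vertex type 'v, states 'v \<Rightarrow> bool *)
type_synonym 'v BN = "('v \<Rightarrow> bool) \<Rightarrow> ('v \<Rightarrow> bool)"

definition interaction_digraph :: "'v BN \<Rightarrow> 'v sdigraph" where
  "interaction_digraph f =
     {(j,i,1) | j i. \<exists>x. \<not> x j \<and> \<not> f x i \<and> f (x(j := True)) i}
   \<union> {(j,i,-1) | j i. \<exists>x. \<not> x j \<and> f x i \<and> \<not> f (x(j := True)) i}"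

definition is_conj :: "'v sdigraph \<Rightarrow> 'v BN \<Rightarrow> 'v \<Rightarrow> bool" where
  "is_conj E f i \<longleftrightarrow> (\<forall>x. f x i \<longleftrightarrow>
     (\<forall>j. ((j,i,1) \<in> E \<longrightarrow> x j) \<and> ((j,i,-1) \<in> E \<longrightarrow> \<not> x j)))"

definition is_disj :: "'v sdigraph \<Rightarrow> 'v BN \<Rightarrow> 'v \<Rightarrow> bool" where
  "is_disj E f i \<longleftrightarrow> (\<forall>x. \<not> f x i \<longleftrightarrow>
     (\<forall>j. ((j,i,1) \<in> E \<longrightarrow> \<not> x j) \<and> ((j,i,-1) \<in> E \<longrightarrow> x j)))"

definition and_or_net :: "'v sdigraph \<Rightarrow> 'v BN \<Rightarrow> bool" where
  "and_or_net E f \<longleftrightarrow> interaction_digraph f = E \<and> (\<forall>i. is_conj E f i \<or> is_disj E f i)"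

(* f^w = f^{i_l} o ... o f^{i_1} for w = i_1 ... i_l *)
definition update_word :: "'v BN \<Rightarrow> 'v list \<Rightarrow> ('v \<Rightarrow> bool) \<Rightarrow> ('v \<Rightarrow> bool)" where
  "update_word f w x = foldl (\<lambda>y i. y(i := f y i)) x w"

definition synchronizing :: "'v BN \<Rightarrow> 'v list \<Rightarrow> bool" where
  "synchronizing f w \<longleftrightarrow> (\<exists>c. \<forall>x. update_word f w x = c)"

end

theory Submission
  imports Defs
begin

text \<open>Complementing the disjunctive vertices turns the network into an and-net. In an and-net a single
  false literal forces a vertex to 0, so a path from a fixed vertex to a target determines the value
  that its start must take for the target to receive a prescribed literal. In a strong part, vertices are
  set one at a time by recursively driving the rest of the part, with a Fibonacci recurrence for the
  cost; negative cycles make the constraints consistent.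

  Two states are merged on a strong component that is not a cycle as follows. Some vertex \<open>v\<close> with two
  parents dominates a region such that \<open>v = 0\<close> makes all literals leaving the region true. Driving one
  state and then the other sets \<open>v\<close> to 0 in both. What remains behaves like a network with
  homogenous inputs again, and its components are merged in topological order: an already merged part
  either acts as a controller of the next component or vetoes the entry of a cycle. Isolated cycles of
  the remainder are the only obstruction and are reset beforehand through their entries. At the top level
  the same scheme applies to all states at once, and each component costs fewer than \<open>2\<^sup>c\<close> pair merges.\<close>

subsection \<open>Signed paths and closed sets\<close>

text \<open>The obstacle is that one word acts on both states: a drive computed for one of them
  gives no control of the other. The way out is a root with two parents. If the second state
  resists, changing one parent there leaves the false literal of the other parent intact in the
  first state. On a cycle every vertex has one parent and two states can circulate out of phase,
  hence the separate treatment of cycles. An and-net is asymmetric: one false literal lowers a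
  vertex, while raising it takes all literals. So only the raises of a drive pay for setting the
  outside, and these are counted separately. Homogeneity is used only between the strong components
  of the whole graph. Inside a component its analogue follows from negative cycles: any two paths
  with common ends that can be closed by the same return path have equal signs. The base is
  \<open>2 * phi = sqrt 5 + 1\<close> with \<open>phi\<close> the golden ratio: \<open>phi\<close>
  per vertex from the Fibonacci cost of a pair merge, 2 per vertex from the number of states on a
  component. The constant \<open>5 + sqrt 5\<close> of a pair merge is forced by its recursion, and
  10 leaves room for three quarters of \<open>(5 + sqrt 5) * phi\<close>.\<close>

text \<open>The sign \<open>True\<close> is positive, so signs multiply by \<open>=\<close>; the literal of an arc \<open>(j,i,b)\<close> is \<open>x j = b\<close>.\<close>
type_synonym 'v bdigraph = "('v \<times> 'v \<times> bool) set"

definition net :: "'v bdigraph \<Rightarrow> ('v \<Rightarrow> bool) \<Rightarrow> 'v \<Rightarrow> bool" where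
  "net E x i \<longleftrightarrow> (\<forall>j b. (j,i,b) \<in> E \<longrightarrow> x j = b)"

definition upd :: "'v bdigraph \<Rightarrow> 'v \<Rightarrow> ('v \<Rightarrow> bool) \<Rightarrow> 'v \<Rightarrow> bool" where
  "upd E i x = x(i := net E x i)"

primrec run :: "'v bdigraph \<Rightarrow> 'v list \<Rightarrow> ('v \<Rightarrow> bool) \<Rightarrow> 'v \<Rightarrow> bool" where
  "run E [] x = x"
| "run E (a # w) x = run E w (upd E a x)"

text \<open>Only the interior is constrained to \<open>M\<close>: with \<open>u = v \<notin> M\<close> this is a cycle.\<close>
inductive pth :: "'v bdigraph \<Rightarrow> 'v set \<Rightarrow> 'v \<Rightarrow> 'v \<Rightarrow> bool \<Rightarrow> bool" for E where
  arc: "(u,v,s) \<in> E \<Longrightarrow> pth E M u v s"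
| step: "(u,w,b) \<in> E \<Longrightarrow> w \<in> M \<Longrightarrow> pth E (M - {w}) w v s \<Longrightarrow> pth E M u v (b = s)"

definition negcyc :: "'v bdigraph \<Rightarrow> bool" where
  "negcyc E \<longleftrightarrow> (\<forall>i s. pth E (UNIV - {i}) i i s \<longrightarrow> \<not> s)"

text \<open>Dropping the arcs from outside \<open>S\<close> amounts to treating their literals as
  true. Targets are not restricted, so the literals that a vertex outside \<open>S\<close> reads
  from \<open>S\<close> remain visible.\<close>

definition restr :: "'v bdigraph \<Rightarrow> 'v set \<Rightarrow> 'v bdigraph" where
  "restr E S = {(j,i,b) \<in> E. j \<in> S}"

text \<open>Closure under predecessors relative to \<open>M\<close>; vertices outside
  \<open>M\<close> count as frozen.\<close>

definition closed_in :: "'v bdigraph \<Rightarrow> 'v set \<Rightarrow> 'v set \<Rightarrow> bool" where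
  "closed_in E M A \<longleftrightarrow> (\<forall>j k b. (j,k,b) \<in> E \<longrightarrow> k \<in> A \<longrightarrow> j \<in> M \<longrightarrow> j \<in> A)"

text \<open>These are the initial strong components of the subgraph induced on \<open>M\<close>, a
  single vertex without a loop included.\<close>

definition minclo :: "'v bdigraph \<Rightarrow> 'v set \<Rightarrow> 'v set \<Rightarrow> bool" where
  "minclo E M C \<longleftrightarrow> C \<noteq> {} \<and> C \<subseteq> M \<and> closed_in E M C \<and> (\<forall>A. A \<subseteq> C \<longrightarrow> A \<noteq> {} \<longrightarrow> closed_in E M A \<longrightarrow> A = C)"

abbreviation merges :: "'v bdigraph \<Rightarrow> 'v list \<Rightarrow> ('v \<Rightarrow> bool) set \<Rightarrow> 'v set \<Rightarrow> bool" where
  "merges E w X C \<equiv> \<forall>x\<in>X. \<forall>y\<in>X. \<forall>a\<in>C. run E w x a = run E w y a"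

lemma run_append [simp]: "run E (v @ w) x = run E w (run E v x)"
  by (induction v arbitrary: x) auto

lemma upd_other [simp]: "j \<noteq> i \<Longrightarrow> upd E i x j = x j"
  by (simp add: upd_def)

lemma upd_same [simp]: "upd E i x i = net E x i"
  by (simp add: upd_def)

lemma run_other: "j \<notin> set w \<Longrightarrow> run E w x j = x j"
  by (induction w arbitrary: x) auto

lemma in_restr [simp]: "(j,i,b) \<in> restr E S \<longleftrightarrow> (j,i,b) \<in> E \<and> j \<in> S"
  by (auto simp: restr_def)

lemma net_False: "(j,i,b) \<in> E \<Longrightarrow> x j \<noteq> b \<Longrightarrow> \<not> net E x i"
  by (auto simp: net_def)

lemma pth_mono: "pth E M u v s \<Longrightarrow> M \<subseteq> M' \<Longrightarrow> pth E M' u v s"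
proof (induction arbitrary: M' rule: pth.induct)
  case (step u w b M v s)
  have "pth E (M' - {w}) w v s" using step.IH[of "M' - {w}"] step.prems by blast
  then show ?case using step by (blast intro: pth.step)
qed (rule pth.arc)

lemma pth_mono_arcs: "pth E M u v s \<Longrightarrow> E \<subseteq> E' \<Longrightarrow> pth E' M u v s"
  by (induction rule: pth.induct) (auto intro: pth.intros)

lemma pth_first: "pth E M u v s \<Longrightarrow> \<exists>w b. (u,w,b) \<in> E"
  by (induction rule: pth.induct) auto

lemma pth_restr: "pth (restr E S) M u v s \<Longrightarrow> u \<in> S"
  using pth_first[of "restr E S"] by fastforce

lemma restr_sub: "restr E S \<subseteq> E"
  by (auto simp: restr_def)

lemma pth_suffix:
  "pth E M u v s \<Longrightarrow> pth E (M - {w}) u v s \<or> (\<exists>s'. pth E (M - {w}) w v s')"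
proof (induction rule: pth.induct)
  case (step u w' b M v s)
  show ?case
  proof (cases "w' = w")
    case True then show ?thesis using step by blast
  next
    case False
    from step.IH show ?thesis
    proof
      assume "pth E (M - {w'} - {w}) w' v s"
      then have "pth E (M - {w} - {w'}) w' v s" by (rule pth_mono) blast
      then show ?thesis using pth.step[of u w' b E "M - {w}" v s] step False by blast
    next
      assume "\<exists>s'. pth E (M - {w'} - {w}) w v s'"
      then obtain s' where "pth E (M - {w'} - {w}) w v s'" ..
      then have "pth E (M - {w}) w v s'" by (rule pth_mono) blast
      then show ?thesis by blast
    qed
  qed
qed (blast intro: pth.arc)

lemma pth_concat:
  "pth E M1 u w s1 \<Longrightarrow> pth E M2 w v s2 \<Longrightarrow> M1 \<inter> M2 = {} \<Longrightarrow> w \<notin> M1 \<Longrightarrow> w \<notin> M2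
   \<Longrightarrow> pth E (insert w (M1 \<union> M2)) u v (s1 = s2)"
proof (induction rule: pth.induct)
  case (arc u w s M)
  have "pth E (insert w (M \<union> M2) - {w}) w v s2"
    by (rule pth_mono[OF arc(2)]) (use arc in blast)
  then show ?case using pth.step[of u w s E "insert w (M \<union> M2)" v s2] arc by simp
next
  case (step u w' b M w s)
  have "pth E (insert w (M - {w'} \<union> M2)) w' v (s = s2)"
    by (rule step.IH) (use step in auto)
  then have "pth E (insert w (M \<union> M2) - {w'}) w' v (s = s2)"
    by (rule pth_mono) (use step in auto)
  then have "pth E (insert w (M \<union> M2)) u v (b = (s = s2))"
    using pth.step[of u w' b E "insert w (M \<union> M2)" v] step by simp
  moreover have "(b = (s = s2)) = ((b = s) = s2)" by blast
  ultimately show ?case by simp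
qed

text \<open>Shortcuts a walk to a path by cutting at the last return to the start.\<close>
lemma pth_reach:
  assumes "(u,w) \<in> {(j,i). \<exists>b. (j,i,b) \<in> F \<and> i \<in> W}\<^sup>*" and arc: "(w,v,b) \<in> F"
  shows "\<exists>s. pth F (W - {u,v}) u v s"
  using assms(1)
proof (induction rule: converse_rtrancl_induct)
  case base
  then show ?case using arc by (blast intro: pth.arc)
next
  case (step u w')
  then obtain b' s where b': "(u,w',b') \<in> F" "w' \<in> W" and s: "pth F (W - {w',v}) w' v s"
    by blast
  show ?case
  proof (cases "w' = u \<or> w' = v")
    case True
    then show ?thesis using b' s by (blast intro: pth.arc)
  next
    case False
    from pth_suffix[OF s, of u] show ?thesis
    proof
      assume "pth F (W - {w',v} - {u}) w' v s"
      then have "pth F (W - {u,v} - {w'}) w' v s" by (rule pth_mono) blast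
      then show ?thesis using pth.step[of u w' b' F "W - {u,v}"] b' False by blast
    next
      assume "\<exists>s'. pth F (W - {w',v} - {u}) u v s'"
      then obtain s' where "pth F (W - {w',v} - {u}) u v s'" ..
      then have "pth F (W - {u,v}) u v s'" by (rule pth_mono) blast
      then show ?thesis by blast
    qed
  qed
qed

lemma pth_consistent:
  "pth F M u v s \<Longrightarrow> (\<And>j i b. (j,i,b) \<in> F \<Longrightarrow> z i = (z j = b)) \<Longrightarrow> z v = (z u = s)"
proof (induction rule: pth.induct)
  case (step u w b M v s)
  then have "z w = (z u = b)" "z v = (z w = s)" by blast+
  then show ?case by blast
qed blast

lemma negcyc_mono: "negcyc E \<Longrightarrow> F \<subseteq> E \<Longrightarrow> negcyc F"
  unfolding negcyc_def by (meson pth_mono_arcs)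

lemma negcyc_pth: "negcyc E \<Longrightarrow> pth E M i i s \<Longrightarrow> i \<notin> M \<Longrightarrow> \<not> s"
  unfolding negcyc_def using pth_mono[of E M i i s "UNIV - {i}"] by blast

lemma closed_in_self: "closed_in E M M" unfolding closed_in_def by blast

lemma minclo_ex:
  fixes E :: "('v::finite) bdigraph"
  assumes "A \<noteq> {}" "A \<subseteq> M" "closed_in E M A"
  obtains C where "minclo E M C" "C \<subseteq> A"
proof -
  let ?P = "\<lambda>C. C \<noteq> {} \<and> C \<subseteq> A \<and> closed_in E M C"
  obtain C where C: "?P C" and mi: "\<And>D. ?P D \<Longrightarrow> card C \<le> card D"
    using ex_has_least_nat[of ?P A card] assms by blast
  have "minclo E M C"
    unfolding minclo_def
  proof (intro conjI allI impI)
    fix D assume "D \<subseteq> C" "D \<noteq> {}" "closed_in E M D"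
    then show "D = C" using mi[of D] C by (meson card_seteq finite subset_trans)
  qed (use C assms in auto)
  then show thesis using that C by blast
qed

lemma minclo_strong:
  assumes "minclo E M C" "A \<subseteq> C" "A \<noteq> {}" "A \<noteq> C"
  obtains j k b where "(j,k,b) \<in> E" "k \<in> A" "j \<in> C - A"
proof -
  have "\<not> closed_in E M A" using assms unfolding minclo_def by blast
  then obtain j k b where *: "(j,k,b) \<in> E" "k \<in> A" "j \<in> M" "j \<notin> A" unfolding closed_in_def by blast
  moreover have "closed_in E M C" using assms(1) unfolding minclo_def by blast
  ultimately have "j \<in> C" using assms(2) unfolding closed_in_def by blast
  then show thesis using that * by blast
qed

subsection \<open>Driving a state\<close>

text \<open>Copying literals along any path through \<open>M\<close> produces a literal of value \<open>t\<close> at \<open>i\<close>.\<close>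
definition aligned :: "'v bdigraph \<Rightarrow> 'v set \<Rightarrow> 'v \<Rightarrow> bool \<Rightarrow> ('v \<Rightarrow> bool) \<Rightarrow> bool" where
  "aligned E M i t x \<longleftrightarrow> (\<forall>v s. v \<notin> M \<longrightarrow> pth E M v i s \<longrightarrow> (x v = s) = t)"

text \<open>The parent inside \<open>C\<close> makes it possible to lower \<open>k\<close> from
  within: a literal at \<open>k\<close> can be driven to false.\<close>

abbreviation uniform_exit :: "'v bdigraph \<Rightarrow> 'v set \<Rightarrow> 'v \<Rightarrow> 'v set \<Rightarrow> bool" where
  "uniform_exit E M i C \<equiv> \<exists>k\<in>C. (\<exists>j\<in>C. \<exists>b. (j,k,b) \<in> E) \<and> (\<exists>t. \<forall>s. pth E (M - {k}) k i s \<longrightarrow> s = t)"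

text \<open>Only sets without any entering arc are constrained. A set that is entered has a vertex
  that can copy a literal from outside, which replaces the uniform sign.\<close>

definition hom_in :: "'v bdigraph \<Rightarrow> 'v set \<Rightarrow> 'v \<Rightarrow> bool" where
  "hom_in E M i \<longleftrightarrow> (\<forall>C. C \<noteq> {} \<longrightarrow> C \<subseteq> M \<longrightarrow> closed_in E UNIV C \<longrightarrow>
     (uniform_exit E M i C))"

text \<open>\<open>drive_len n + 2\<close> is the Fibonacci number with index \<open>n + 3\<close>.
  The summand 2 pays for one letter that flips a vertex and one that freezes another.\<close>

fun drive_len :: "nat \<Rightarrow> nat" where
  "drive_len 0 = 0" | "drive_len (Suc 0) = 1" | "drive_len (Suc (Suc n)) = drive_len (Suc n) + drive_len n + 2"

lemma drive_len_super: "drive_len a + drive_len b \<le> drive_len (a + b)"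
proof (induction a rule: drive_len.induct)
  case 2
  then show ?case by (cases b rule: drive_len.cases) auto
qed auto

text \<open>This covers a rest that is not strong: its two nonempty parts together cost at most one
  letter more than a drive with one vertex fewer.\<close>

lemma drive_len_merge: "drive_len (Suc a) + drive_len (Suc b) \<le> Suc (drive_len (Suc (a + b)))"
proof (induction a rule: drive_len.induct)
  case 2
  then show ?case by (cases b rule: drive_len.cases) auto
next
  case (3 n)
  then show ?case using drive_len_super[of "Suc n" b] by simp
qed auto

lemma aligned_cong: "aligned E M i t x \<Longrightarrow> (\<And>v. v \<notin> M \<Longrightarrow> y v = x v) \<Longrightarrow> aligned E M i t y"
  unfolding aligned_def by simp

text \<open>A vertex that repeats the value of a literal from outside may be treated as outside.\<close>
lemma aligned_freeze:
  assumes al: "aligned E M i t x" and f: "(f,k,b) \<in> E" "f \<notin> M" and k: "k \<in> M" and eq: "(x f = b) = x k"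
  shows "aligned E (M - {k}) i t x"
  unfolding aligned_def
proof (intro allI impI)
  fix v s assume v: "v \<notin> M - {k}" and p: "pth E (M - {k}) v i s"
  show "(x v = s) = t"
  proof (cases "v = k")
    case True
    then have "pth E M f i (b = s)" using pth.step[OF f(1) k] p by simp
    then have "(x f = (b = s)) = t" using al f(2) by (simp add: aligned_def)
    then show ?thesis using eq True by blast
  next
    case False
    then show ?thesis using al v pth_mono[OF p, of M] unfolding aligned_def by blast
  qed
qed

text \<open>If the literal of \<open>f\<close> already equals \<open>k\<close>, nothing has to be
  done. If it differs and is false, it forces \<open>k\<close> to 0 regardless of the other inputs,
  and then equals it.\<close>

lemma veto_freeze:
  assumes al: "aligned E M i t x" and f: "(f,k,b) \<in> E" "f \<notin> M" and k: "k \<in> M"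
    and c: "(x f = b) = x k \<or> x f \<noteq> b"
  obtains w where "set w \<subseteq> {k}" "length w \<le> 1" "aligned E (M - {k}) i t (run E w x)"
proof (cases "(x f = b) = x k")
  case True
  then show thesis using that[of "[]"] aligned_freeze[OF al f k] by simp
next
  case False
  with c have n: "\<not> net E x k" using f(1) by (auto dest: net_False)
  have "f \<noteq> k" using f k by blast
  then have "aligned E (M - {k}) i t (upd E k x)"
    using n c False by (intro aligned_freeze[OF _ f k] aligned_cong[OF al]) (use k in \<open>auto simp: upd_def\<close>)
  then show thesis using that[of "[k]"] by simp
qed

lemma hom_in_mono: "hom_in E M i \<Longrightarrow> M' \<subseteq> M \<Longrightarrow> hom_in E M' i"
  unfolding hom_in_def
proof (intro allI impI)
  fix C
  assume *: "\<forall>C. C \<noteq> {} \<longrightarrow> C \<subseteq> M \<longrightarrow> closed_in E UNIV C \<longrightarrow>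
     (uniform_exit E M i C)"
    and M: "M' \<subseteq> M" and C: "C \<noteq> {}" "C \<subseteq> M'" "closed_in E UNIV C"
  have "C \<subseteq> M" using C(2) M by simp
  with *[THEN spec, of C] C have "uniform_exit E M i C" by simp
  then obtain k t where k: "k \<in> C" "\<exists>j\<in>C. \<exists>b. (j,k,b) \<in> E"
    "\<forall>s. pth E (M - {k}) k i s \<longrightarrow> s = t" by blast
  have "\<forall>s. pth E (M' - {k}) k i s \<longrightarrow> s = t"
    using k(3) pth_mono[of E "M' - {k}" k i _ "M - {k}"] M by blast
  then show "uniform_exit E M' i C"
    using k by blast
qed

lemma run_restr:
  assumes "\<And>j k b. (j,k,b) \<in> E \<Longrightarrow> k \<in> C \<Longrightarrow> j \<notin> C \<Longrightarrow> x j = b" and "set w \<subseteq> C"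
  shows "run E w x = run (restr E C) w x"
  using assms
proof (induction w arbitrary: x)
  case (Cons a w)
  have "a \<in> C" using Cons.prems(2) by simp
  then have "net E x a = net (restr E C) x a" using Cons.prems(1) unfolding net_def by (metis in_restr)
  then have "upd E a x = upd (restr E C) a x" by (simp add: upd_def)
  moreover have "run E w (upd E a x) = run (restr E C) w (upd E a x)"
    using Cons.prems by (intro Cons.IH) (auto simp: upd_def)
  ultimately show ?case by simp
qed simp

text \<open>The condition holds vacuously: by minimality every nonempty proper part of
  \<open>C\<close> is entered from the rest of \<open>C\<close>.\<close>

lemma minclo_hom_in:
  assumes C: "minclo E M C" "M' \<subset> C"
  shows "hom_in (restr E C) M' i"
  unfolding hom_in_def
proof (intro allI impI)
  fix D assume D: "D \<noteq> {}" "D \<subseteq> M'" "closed_in (restr E C) UNIV D"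
  have "D \<subseteq> C" "D \<noteq> C" using D C by auto
  from minclo_strong[OF C(1) this(1) D(1) this(2)] obtain j k b
    where "(j,k,b) \<in> E" "k \<in> D" "j \<in> C - D" .
  then show "uniform_exit (restr E C) M' i D"
    using D(3) unfolding closed_in_def by (metis DiffD1 DiffD2 UNIV_I in_restr)
qed

text \<open>The only start outside \<open>M\<close> is \<open>k\<close> itself, and its paths back
  to \<open>k\<close> are negative cycles. A drive of the rest towards \<open>k\<close> thus
  delivers the opposite of the present value, so an update of \<open>k\<close> flips it.\<close>

lemma cycle_aligned:
  assumes "negcyc E" "C = insert k M" "k \<notin> M"
  shows "aligned (restr E C) M k (\<not> x k) x"
  unfolding aligned_def
proof (intro allI impI)
  fix v s assume v: "v \<notin> M" "pth (restr E C) M v k s"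
  then have "v \<in> C" by (blast dest: pth_restr)
  then have "v = k" using assms v by blast
  moreover have "negcyc (restr E C)" using assms(1) restr_sub by (rule negcyc_mono)
  ultimately have "\<not> s" using v assms(3) negcyc_pth[of "restr E C" M k s] by blast
  then show "(x v = s) = (\<not> x k)" using \<open>v = k\<close> by simp
qed

text \<open>Freezing \<open>k\<close> adds only paths that start at \<open>k\<close>; all others
  already ran through \<open>M\<close>.\<close>

lemma aligned_freeze_flip:
  assumes al: "aligned E M i t x" and t: "\<And>s. pth E (M - {k}) k i s \<Longrightarrow> (x k = s) = t"
  shows "aligned E (M - {k}) i t x"
  using assms unfolding aligned_def
  by (metis Diff_iff Diff_subset pth_mono singletonD)

text \<open>In a strong part a vertex \<open>k\<close> is flipped by first driving the rest (target \<open>k\<close>), and the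
  rest is then driven towards \<open>i\<close>. One of the two drives is one Fibonacci level cheaper: either the
  rest is not strong, or an arc from \<open>k\<close> into it has a false literal in one of them.\<close>
theorem drive_pure:
  fixes E :: "('v::finite) bdigraph"
  assumes "negcyc E" "M0 \<subseteq> M" "closed_in E M M0" "i \<notin> M" "aligned E M i t x" "hom_in E M i"
  shows "\<exists>w. set w \<subseteq> M0 \<and> length w \<le> drive_len (card M0) \<and> aligned E (M - M0) i t (run E w x)"
  using assms
proof (induction "card M0" arbitrary: E M0 M i t x rule: less_induct)
  case less
  note nc = less.prems(1) and sub = less.prems(2) and cl = less.prems(3) and iM = less.prems(4)
    and al = less.prems(5) and hom = less.prems(6)
  have IH: "\<exists>w. set w \<subseteq> A \<and> length w \<le> drive_len (card A) \<and> aligned F (M' - A) i' t' (run F w x')"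
    if "A \<subset> M0" "negcyc F" "A \<subseteq> M'" "closed_in F M' A" "i' \<notin> M'" "aligned F M' i' t' x'" "hom_in F M' i'"
    for A F M' i' t' x'
    using less.hyps[OF psubset_card_mono[OF _ that(1)] that(2-)] by simp
  show ?case
  proof (cases "M0 = {}")
    case True then show ?thesis using al by (intro exI[of _ "[]"]) simp
  next
    case ne: False
    obtain C where C: "minclo E M C" "C \<subseteq> M0" using minclo_ex[OF ne sub cl] .
    have C': "C \<noteq> {}" "C \<subseteq> M" "closed_in E M C" using C by (auto simp: minclo_def)
    have compose: "\<exists>w. set w \<subseteq> B \<and> length w \<le> drive_len (card A) + drive_len (card (B - A)) \<and>
        aligned F (M' - B) i' t' (run F w x')"
      if "A \<subseteq> B" "B \<subseteq> M0" "A \<noteq> {}" "A \<noteq> M0" "B \<subseteq> M'" "closed_in F M' A" "closed_in F M' B" "negcyc F" "i' \<notin> M'"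
        "aligned F M' i' t' x'" "hom_in F M' i'" for A B F M' i' t' x'
    proof -
      have "A \<subset> M0" "A \<subseteq> M'" using that by auto
      from IH[OF this(1) that(8) this(2) that(6,9,10,11)] obtain w1 where
        w1: "set w1 \<subseteq> A" "length w1 \<le> drive_len (card A)" "aligned F (M' - A) i' t' (run F w1 x')" by blast
      have "\<exists>w. set w \<subseteq> B - A \<and> length w \<le> drive_len (card (B - A)) \<and>
          aligned F (M' - A - (B - A)) i' t' (run F w (run F w1 x'))"
        by (rule IH) (use that w1 hom_in_mono[OF that(11), of "M' - A"] in \<open>auto simp: closed_in_def\<close>)
      then obtain w2 where w2: "set w2 \<subseteq> B - A" "length w2 \<le> drive_len (card (B - A))"
          "aligned F (M' - A - (B - A)) i' t' (run F w2 (run F w1 x'))" by blast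
      moreover have "M' - A - (B - A) = M' - B" using that by blast
      ultimately show ?thesis using w1 that(1) by (intro exI[of _ "w1 @ w2"]) auto
    qed
    show ?thesis
    proof (cases "C = M0")
      case False
      from compose[OF C(2) _ C'(1) False sub C'(3) cl nc iM al hom]
      obtain w where "set w \<subseteq> M0" "length w \<le> drive_len (card C) + drive_len (card (M0 - C))"
        "aligned E (M - M0) i t (run E w x)" by blast
      moreover have "card C + card (M0 - C) = card M0"
        using C(2) by (metis card_Diff_subset card_mono finite le_add_diff_inverse)
      ultimately show ?thesis using drive_len_super[of "card C" "card (M0 - C)"] by fastforce
    next
      case CM: True
      have stC: "minclo E M M0" using C CM by simp
      have rest: "\<exists>w. set w \<subseteq> M0 - {k} \<and> length w \<le> drive_len (card M0 - 1) \<and>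
          aligned E (M - M0) i t (run E w y)" if "k \<in> M0" "aligned E (M - {k}) i t y" for k y
      proof -
        have "\<exists>w. set w \<subseteq> M0 - {k} \<and> length w \<le> drive_len (card (M0 - {k})) \<and>
            aligned E (M - {k} - (M0 - {k})) i t (run E w y)"
          by (rule IH) (use that sub cl nc iM hom_in_mono[OF hom, of "M - {k}"] in \<open>auto simp: closed_in_def\<close>)
        moreover have "M - {k} - (M0 - {k}) = M - M0" using that by blast
        ultimately show ?thesis using that(1) by simp
      qed
      have ell1: "Suc (drive_len (card M0 - 1)) \<le> drive_len (card M0)"
        using ne by (cases "card M0" rule: drive_len.cases) auto
      show ?thesis
      \<comment> \<open>At most one letter freezes such a \<open>k\<close>. In the other case every
        literal entering \<open>M0\<close> is true while its target is 0, so words inside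
        \<open>M0\<close> that do not touch those sources can be computed in the restricted
        net.\<close>
      proof (cases "\<exists>f k b. (f,k,b) \<in> E \<and> f \<notin> M \<and> k \<in> M0 \<and> ((x f = b) = x k \<or> x f \<noteq> b)")
        case True
        then obtain f k b where f: "(f,k,b) \<in> E" "f \<notin> M" "k \<in> M0" "(x f = b) = x k \<or> x f \<noteq> b" by blast
        from veto_freeze[OF al f(1,2) _ f(4)] obtain w1 where
          w1: "set w1 \<subseteq> {k}" "length w1 \<le> 1" "aligned E (M - {k}) i t (run E w1 x)" using f sub by blast
        obtain w2 where "set w2 \<subseteq> M0 - {k}" "length w2 \<le> drive_len (card M0 - 1)"
            "aligned E (M - M0) i t (run E w2 (run E w1 x))" using rest[OF f(3) w1(3)] by blast
        then show ?thesis using w1 ell1 f(3) by (intro exI[of _ "w1 @ w2"]) auto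
      next
        case noveto: False
        have good: "\<exists>w. set w \<subseteq> M0 \<and> length w \<le> drive_len (card M0) \<and> aligned E (M - M0) i t (run E w x)"
          if "k \<in> M0" "aligned E (M - {k}) i t x" for k
          using rest[OF that] ell1 by (meson Diff_subset Suc_leD order_trans)
        have ext: "x f = b \<and> \<not> x k" if "(f,k,b) \<in> E" "f \<notin> M0" "k \<in> M0" for f k b
        proof -
          have "f \<notin> M" using cl that unfolding closed_in_def by blast
          then show ?thesis using noveto that by blast
        qed
        have flip: "\<exists>w. set w \<subseteq> M0 \<and> length w \<le> drive_len (card M0) \<and> aligned E (M - M0) i t (run E w x)"
          if k: "k \<in> M0"
            and fz: "aligned E (M - {k}) i t (x(k := \<not> x k))"
            and par: "x k \<Longrightarrow> \<exists>j b. (j,k,b) \<in> E \<and> j \<in> M0" for k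
        proof -
          define F where "F = restr E M0"
          define A where "A = M0 - {k}"
          have ncF: "negcyc F" unfolding F_def using nc restr_sub by (rule negcyc_mono)
          have AF: "A \<subset> M0" "k \<notin> A" "A \<subseteq> A" using k by (auto simp: A_def)
          have homF: "hom_in F A k" unfolding F_def by (rule minclo_hom_in[OF stC AF(1)])
          have alF: "aligned F A k (\<not> x k) x" unfolding F_def
            by (rule cycle_aligned[OF nc]) (use k in \<open>auto simp: A_def\<close>)
          have cA: "card A = card M0 - 1" using k by (simp add: A_def)
          have final: ?thesis if w1: "set w1 \<subseteq> A" "aligned F {} k (\<not> x k) (run F w1 x)"
            and w2: "set w2 \<subseteq> M0" "aligned E (M - M0) i t (run E w2 (upd E k (run F w1 x)))"
            and len: "length w1 + 1 + length w2 \<le> drive_len (card M0)" for w1 w2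
          proof -
            have "run E w1 x = run F w1 x" unfolding F_def
              by (rule run_restr) (use ext w1 AF in auto)
            then show ?thesis using that AF(1) k by (intro exI[of _ "w1 @ k # w2"]) auto
          qed
          have flipped: "upd E k (run F w1 x) = (run F w1 x)(k := \<not> x k)"
            if w1: "set w1 \<subseteq> A" "aligned F {} k (\<not> x k) (run F w1 x)" for w1
          proof -
            let ?y = "run F w1 x"
            have lits: "(?y j = b) = (\<not> x k)" if "(j,k,b) \<in> E" "j \<in> M0" for j b
              using w1(2) that pth.arc[of j k b F "{}"] by (auto simp: aligned_def F_def)
            have outs: "?y j = b" if "(j,k,b) \<in> E" "j \<notin> M0" for j b
              using ext[OF that k] run_other[of j w1 F x] w1(1) AF that by auto
            \<comment> \<open>Lowering \<open>k\<close> needs one false literal, found at the parent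
              from \<open>par\<close>; raising it needs all of them, and those from outside are true
              by \<open>ext\<close>.\<close>
            have "net E ?y k = (\<not> x k)"
            proof (cases "x k")
              case True
              with par obtain j b where "(j,k,b) \<in> E" "j \<in> M0" by blast
              then show ?thesis using lits[of j b] True net_False[of j k b E ?y] by blast
            next
              case False
              then show ?thesis using lits outs unfolding net_def by blast
            qed
            then show ?thesis by (simp add: upd_def)
          qed
          have al2: "aligned E (M - {k}) i t (upd E k (run F w1 x))"
            if w1: "set w1 \<subseteq> A" "aligned F {} k (\<not> x k) (run F w1 x)" for w1
            unfolding flipped[OF w1]
            by (rule aligned_cong[OF fz]) (use w1 sub AF run_other[of _ w1 F x] in \<open>auto simp: A_def\<close>)
          show ?thesis
          proof (cases "A = {}")
            case True
            then have M0: "M0 = {k}" using k by (auto simp: A_def)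
            have "aligned F {} k (\<not> x k) (run F [] x)" using alF True by simp
            from final[OF _ this, of "[]"] al2[OF _ this] show ?thesis using M0 by simp
          next
            case Ane: False
            obtain n where n: "card M0 = Suc (Suc n)"
              using Ane cA k by (metis One_nat_def Suc_pred card_gt_0_iff finite card_Diff_singleton A_def ne)
            have AA: "closed_in E (M - {k}) A" using cl by (auto simp: closed_in_def A_def)
            obtain D where D: "minclo F A D" using minclo_ex[OF Ane subset_refl closed_in_self] .
            have D': "D \<noteq> {}" "D \<subseteq> A" "closed_in F A D" using D by (auto simp: minclo_def)
            have sub_full: "\<exists>w. set w \<subseteq> A \<and> length w \<le> drive_len (Suc n) \<and> aligned F {} k (\<not> x k) (run F w x)"
              using IH[OF AF(1) ncF AF(3) closed_in_self AF(2) alF homF] cA n by simp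
            have rest_n: "\<exists>w. set w \<subseteq> M0 \<and> length w \<le> drive_len (Suc n) \<and> aligned E (M - M0) i t (run E w y)"
              if "aligned E (M - {k}) i t y" for y
              using rest[OF k that] n by (metis Diff_subset diff_Suc_1 subset_trans)
            show ?thesis
            proof (cases "D = A")
              case False
              from compose[OF D'(2) _ D'(1) _ AF(3) D'(3) closed_in_self ncF AF(2) alF homF] AF D'
              obtain w1 where w1: "set w1 \<subseteq> A" "length w1 \<le> drive_len (card D) + drive_len (card (A - D))"
                "aligned F {} k (\<not> x k) (run F w1 x)" by auto
              have "card D + card (A - D) = card A"
                using D' by (metis card_Diff_subset card_mono finite le_add_diff_inverse)
              moreover have "card D \<noteq> 0" "card (A - D) \<noteq> 0" using D' False by auto
              ultimately obtain a c where "card D = Suc a" "card (A - D) = Suc c" "Suc (a + c) = n"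
                using cA n by (metis add_Suc add_Suc_right diff_Suc_1 nat.inject not0_implies_Suc)
              then have l1: "length w1 \<le> Suc (drive_len n)" using w1(2) drive_len_merge[of a c] by simp
              obtain w2 where "set w2 \<subseteq> M0" "length w2 \<le> drive_len (Suc n)"
                "aligned E (M - M0) i t (run E w2 (upd E k (run F w1 x)))"
                using rest_n[OF al2[OF w1(1,3)]] by blast
              with final[OF w1(1,3) this(1,3)] l1 n show ?thesis by simp
            next
              case True
              have "{k} \<subseteq> M0" "A \<noteq> {}" "A \<subseteq> M0" "A \<noteq> M0" using k Ane AF by auto
              from minclo_strong[OF stC this(3,2,4)] obtain j k' b where
                "(j,k',b) \<in> E" "k' \<in> A" "j \<in> M0 - A" .
              then have k': "(k,k',b) \<in> E" "k' \<in> A" by (auto simp: A_def)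
              have k'F: "(k,k',b) \<in> F" using k' k by (simp add: F_def)
              have cA': "card (A - {k'}) = n" using k' cA n by simp
              show ?thesis
              proof (cases "(x k = b) = x k' \<or> x k \<noteq> b")
                case True
                from veto_freeze[OF alF k'F AF(2) k'(2) True] obtain w0 where
                  w0: "set w0 \<subseteq> {k'}" "length w0 \<le> 1" "aligned F (A - {k'}) k (\<not> x k) (run F w0 x)" .
                have "\<exists>w. set w \<subseteq> A - {k'} \<and> length w \<le> drive_len (card (A - {k'})) \<and>
                    aligned F (A - {k'} - (A - {k'})) k (\<not> x k) (run F w (run F w0 x))"
                  by (rule IH) (use AF ncF w0 closed_in_self hom_in_mono[OF homF, of "A - {k'}"] in auto)
                then obtain w1 where "set w1 \<subseteq> A - {k'}" "length w1 \<le> drive_len n"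
                  "aligned F {} k (\<not> x k) (run F w1 (run F w0 x))" using cA' by auto
                then have w01: "set (w0 @ w1) \<subseteq> A" "length (w0 @ w1) \<le> Suc (drive_len n)"
                  "aligned F {} k (\<not> x k) (run F (w0 @ w1) x)" using w0 k' by auto
                obtain w2 where "set w2 \<subseteq> M0" "length w2 \<le> drive_len (Suc n)"
                  "aligned E (M - M0) i t (run E w2 (upd E k (run F (w0 @ w1) x)))"
                  using rest_n[OF al2[OF w01(1,3)]] by blast
                with final[OF w01(1,3) this(1,3)] w01(2) n show ?thesis by simp
              next
                \<comment> \<open>Now the literal of the arc from \<open>k\<close> to
                  \<open>k'\<close> is true. It becomes false when \<open>k\<close> is flipped, so
                  the saving occurs in the second drive instead of the first.\<close>
                case False
                from sub_full obtain w1 where w1: "set w1 \<subseteq> A" "length w1 \<le> drive_len (Suc n)"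
                  "aligned F {} k (\<not> x k) (run F w1 x)" by blast
                let ?y = "upd E k (run F w1 x)"
                have yk: "?y k \<noteq> b" using flipped[OF w1(1,3)] False by simp
                have k'M: "k' \<in> M - {k}" "k \<notin> M - {k}" using k' sub by (auto simp: A_def)
                from veto_freeze[OF al2[OF w1(1,3)] k'(1) k'M(2,1)] yk obtain w2 where
                  w2: "set w2 \<subseteq> {k'}" "length w2 \<le> 1" "aligned E (M - {k} - {k'}) i t (run E w2 ?y)" by blast
                have "\<exists>w. set w \<subseteq> A - {k'} \<and> length w \<le> drive_len (card (A - {k'})) \<and>
                    aligned E (M - {k} - {k'} - (A - {k'})) i t (run E w (run E w2 ?y))"
                  by (rule IH) (use AF nc w2 AA sub iM hom_in_mono[OF hom, of "M - {k} - {k'}"] in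
                      \<open>auto simp: closed_in_def A_def\<close>)
                moreover have "M - {k} - {k'} - (A - {k'}) = M - M0" using k k' by (auto simp: A_def)
                ultimately obtain w3 where "set w3 \<subseteq> A - {k'}" "length w3 \<le> drive_len n"
                  "aligned E (M - M0) i t (run E w3 (run E w2 ?y))" using cA' by auto
                then have "set (w2 @ w3) \<subseteq> M0" "length (w2 @ w3) \<le> Suc (drive_len n)"
                  "aligned E (M - M0) i t (run E (w2 @ w3) ?y)" using w2 k' by (auto simp: A_def)
                with final[OF w1(1,3) this(1,3)] w1(2) n show ?thesis by simp
              qed
            qed
          qed
        qed
        show ?thesis
        \<comment> \<open>The choice of \<open>k\<close>: the target of an entering arc is 0 and its
          literal is true, so flipping the target makes it a copy. Without entering arcs
          \<open>hom\<close> supplies \<open>k\<close>, and one of its two values is the right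
          one.\<close>
        proof (cases "\<exists>f k b. (f,k,b) \<in> E \<and> f \<notin> M0 \<and> k \<in> M0")
          case True
          then obtain f k b where f: "(f,k,b) \<in> E" "f \<notin> M0" "k \<in> M0" by blast
          have xs: "x f = b" "\<not> x k" using ext[OF f] by auto
          have fM: "f \<notin> M" using cl f unfolding closed_in_def by blast
          have "aligned E (M - {k}) i t (x(k := \<not> x k))"
            by (rule aligned_freeze[OF aligned_cong[OF al] f(1) fM]) (use f sub xs in auto)
          from flip[OF f(3) this] show ?thesis using xs by blast
        next
          case False
          then have "closed_in E UNIV M0" unfolding closed_in_def by blast
          with hom ne sub obtain k t' where k: "k \<in> M0" "\<exists>j\<in>M0. \<exists>b. (j,k,b) \<in> E"
            "\<And>s. pth E (M - {k}) k i s \<Longrightarrow> s = t'" unfolding hom_in_def by metis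
          show ?thesis
          proof (cases "(x k = t') = t")
            case True
            have "aligned E (M - {k}) i t x"
              by (rule aligned_freeze_flip[OF al]) (use k True in blast)
            then show ?thesis by (rule good[OF k(1)])
          next
            case False
            have "aligned E (M - {k}) i t (x(k := \<not> x k))"
              by (rule aligned_freeze_flip[OF aligned_cong[OF al]]) (use k(1) k(3) False sub in auto)
            from flip[OF k(1) this] show ?thesis using k(2) by blast
          qed
        qed
      qed
    qed
  qed
qed

subsection \<open>Executing a drive inside a context\<close>

primrec effective :: "'v bdigraph \<Rightarrow> 'v list \<Rightarrow> ('v \<Rightarrow> bool) \<Rightarrow> bool" where
  "effective E [] x \<longleftrightarrow> True"
| "effective E (a # w) x \<longleftrightarrow> net E x a \<noteq> x a \<and> effective E w (upd E a x)"

primrec ups :: "'v bdigraph \<Rightarrow> 'v list \<Rightarrow> ('v \<Rightarrow> bool) \<Rightarrow> nat" where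
  "ups E [] x = 0"
| "ups E (a # w) x = (if x a then 0 else 1) + ups E w (upd E a x)"

fun raise_len :: "nat \<Rightarrow> nat" where
  "raise_len 0 = 0" | "raise_len (Suc 0) = 1" | "raise_len (Suc (Suc n)) = raise_len (Suc n) + raise_len n + 1"

text \<open>\<open>raise_len\<close> bounds the letters that raise a vertex. Each of them is
  preceded by a word of length at most \<open>m\<close> that makes the outer literals true;
  lowerings need no preparation.\<close>

definition cost :: "nat \<Rightarrow> nat \<Rightarrow> nat" where
  "cost m z = drive_len z + m * raise_len z"

definition phi :: real where "phi = (1 + sqrt 5) / 2"

text \<open>A closed form above \<open>cost m z\<close>, arranged so that \<open>m\<close> and the
  constant part share the factor \<open>m + phi\<close>; note
  \<open>sqrt 5 - 1 = 2 / phi\<close>.\<close>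

definition drive_bound :: "nat \<Rightarrow> nat \<Rightarrow> real" where
  "drive_bound m z = (m + phi) * ((sqrt 5 - 1) * phi ^ z - 1)"

lemma upd_eq_self: "net E x a = x a \<Longrightarrow> upd E a x = x"
  by (auto simp: upd_def)

lemma effective_ex: "\<exists>w'. set w' \<subseteq> set w \<and> length w' \<le> length w \<and> effective E w' x \<and> run E w' x = run E w x"
proof (induction w arbitrary: x)
  case (Cons a w)
  from Cons[of "upd E a x"] obtain w' where w': "set w' \<subseteq> set w" "length w' \<le> length w"
    "effective E w' (upd E a x)" "run E w' (upd E a x) = run E w (upd E a x)" by blast
  show ?case
  proof (cases "net E x a = x a")
    case True
    then show ?thesis using w' by (intro exI[of _ w']) (auto simp: upd_eq_self)
  next
    case False
    then show ?thesis using w' by (intro exI[of _ "a # w'"]) auto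
  qed
qed simp

lemma effective_append: "effective E (v @ w) x \<longleftrightarrow> effective E v x \<and> effective E w (run E v x)"
  by (induction v arbitrary: x) auto

lemma ups_append: "ups E (v @ w) x = ups E v x + ups E w (run E v x)"
  by (induction v arbitrary: x) auto

text \<open>Each letter changes its vertex, so raises minus lowerings is the growth of the number of
  ones, which stays at most \<open>card S\<close>; raises plus lowerings is the length.\<close>

lemma effective_ups:
  assumes "finite S"
  shows "effective E w x \<Longrightarrow> set w \<subseteq> S \<Longrightarrow> 2 * ups E w x + card {a \<in> S. x a} \<le> length w + card S"
proof (induction w arbitrary: x)
  case Nil
  then show ?case using assms by (auto intro: card_mono)
next
  case (Cons a w)
  let ?y = "upd E a x"
  have IH: "2 * ups E w ?y + card {b \<in> S. ?y b} \<le> length w + card S" using Cons by simp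
  have aS: "a \<in> S" using Cons.prems by simp
  show ?case
  proof (cases "x a")
    case True
    have "{b \<in> S. x b} = insert a {b \<in> S. ?y b}" using True aS by (auto simp: upd_def)
    moreover have "a \<notin> {b \<in> S. ?y b}" using True Cons.prems by simp
    ultimately have "card {b \<in> S. x b} = Suc (card {b \<in> S. ?y b})" using assms by simp
    then show ?thesis using IH True by simp
  next
    case False
    have "{b \<in> S. ?y b} = insert a {b \<in> S. x b}" using False aS Cons.prems by (auto simp: upd_def)
    moreover have "a \<notin> {b \<in> S. x b}" using False by simp
    ultimately have "card {b \<in> S. ?y b} = Suc (card {b \<in> S. x b})" using assms by simp
    then show ?thesis using IH False by simp
  qed
qed

text \<open>Together with \<open>effective_ups\<close> this gives
  \<open>2 * ups <= 2 * raise_len + 1\<close>, and the odd 1 disappears over the naturals.\<close>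

lemma drive_len_raise_len: "drive_len z + z \<le> 2 * raise_len z + 1"
proof (induction z rule: drive_len.induct)
  case (3 n)
  then show ?case by (cases n rule: drive_len.cases) auto
qed auto

section \<open>Golden ratio estimates for the lengths\<close>

lemma phi_sq: "phi * phi = phi + 1"
  by (simp add: phi_def field_simps)

lemma phi_step: "phi ^ Suc (Suc n) = phi ^ Suc n + phi ^ n"
  using phi_sq by (simp add: algebra_simps flip: mult.assoc)

lemma phi_bounds: "3/2 < phi" "phi < 17/10" "sqrt 5 - 1 = 2 * phi - 2" "(sqrt 5 - 1) * phi = 2"
proof -
  have "2 < sqrt 5" by (rule real_less_rsqrt) simp
  moreover have "sqrt 5 < 12/5" by (rule real_less_lsqrt) (auto simp: power2_eq_square)
  ultimately show "3/2 < phi" "phi < 17/10" by (auto simp: phi_def)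
  show "sqrt 5 - 1 = 2 * phi - 2" "(sqrt 5 - 1) * phi = 2" by (simp_all add: phi_def algebra_simps)
qed

lemma drive_len_le: "real (drive_len z) \<le> 2 * phi ^ z - 2"
proof (induction z rule: drive_len.induct)
  case (3 n)
  then show ?case using phi_step[of n] by simp
qed (use phi_bounds in auto)

lemma raise_len_le: "real (raise_len z) \<le> (sqrt 5 - 1) * phi ^ z - 1"
proof (induction z rule: drive_len.induct)
  case (3 n)
  have "(sqrt 5 - 1) * phi ^ Suc (Suc n) = (sqrt 5 - 1) * phi ^ Suc n + (sqrt 5 - 1) * phi ^ n"
    unfolding phi_step by (simp add: algebra_simps)
  with 3 show ?case by simp
qed (use phi_bounds in auto)

lemma cost_le: "real (cost m z) \<le> drive_bound m z"
proof -
  have "real m * real (raise_len z) \<le> real m * ((sqrt 5 - 1) * phi ^ z - 1)"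
    by (rule mult_left_mono[OF raise_len_le]) simp
  moreover have "phi * ((sqrt 5 - 1) * phi ^ z - 1) = 2 * phi ^ z - phi"
    using arg_cong[OF phi_bounds(4), of "\<lambda>c. c * phi ^ z"] by (simp add: algebra_simps)
  ultimately show ?thesis using drive_len_le[of z] phi_bounds(2)
    by (simp add: cost_def drive_bound_def distrib_right)
qed

text \<open>When \<open>z\<close> merged vertices start to serve as controllers, the budget
  \<open>m\<close> grows to \<open>m + cost m z\<close>. In terms of \<open>m + phi\<close> this is
  multiplication by at most \<open>(sqrt 5 - 1) * phi ^ z\<close>, thanks to the \<open>- 1\<close>
  in \<open>drive_bound\<close>.\<close>

lemma cost_shift: "real (m + cost m z) + phi \<le> (m + phi) * (sqrt 5 - 1) * phi ^ z"
  using cost_le[of m z] by (simp add: drive_bound_def algebra_simps)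

text \<open>\<open>I\<close> relates the two states being merged; \<open>m\<close> bounds the cost of setting, with letters
  outside \<open>C\<close>, all literals that enter a vertex of \<open>C\<close> from outside \<open>C\<close> to true.\<close>
definition ctx :: "'v bdigraph \<Rightarrow> 'v set \<Rightarrow> 'v set \<Rightarrow> (('v \<Rightarrow> bool) \<times> ('v \<Rightarrow> bool)) set \<Rightarrow> nat \<Rightarrow> bool" where
  "ctx E C L I m \<longleftrightarrow> C \<subseteq> L \<and> (\<forall>x y. (x,y) \<in> I \<longrightarrow> (y,x) \<in> I \<and> (x,x) \<in> I)
    \<and> (\<forall>x y i. (x,y) \<in> I \<longrightarrow> i \<in> L \<longrightarrow> (upd E i x, upd E i y) \<in> I)
    \<and> (\<forall>x y j a b. (x,y) \<in> I \<longrightarrow> (j,a,b) \<in> E \<longrightarrow> a \<in> C \<longrightarrow> j \<notin> C \<longrightarrow> x j = y j)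
    \<and> (\<forall>x a. (x,x) \<in> I \<longrightarrow> a \<in> C \<longrightarrow> (\<exists>u. set u \<subseteq> L - C \<and> length u \<le> m \<and>
         (\<forall>j b. (j,a,b) \<in> E \<longrightarrow> j \<notin> C \<longrightarrow> run E u x j = b)))"

lemma ctx_sub: "ctx E C L I m \<Longrightarrow> C \<subseteq> L" by (simp add: ctx_def)
lemma ctx_sym: "ctx E C L I m \<Longrightarrow> (x,y) \<in> I \<Longrightarrow> (y,x) \<in> I" by (simp add: ctx_def)
lemma ctx_refl: "ctx E C L I m \<Longrightarrow> (x,y) \<in> I \<Longrightarrow> (x,x) \<in> I" by (simp add: ctx_def)
lemma ctx_refl2: "ctx E C L I m \<Longrightarrow> (x,y) \<in> I \<Longrightarrow> (y,y) \<in> I" by (meson ctx_sym ctx_refl)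
lemma ctx_ext: "ctx E C L I m \<Longrightarrow> (x,y) \<in> I \<Longrightarrow> (j,a,b) \<in> E \<Longrightarrow> a \<in> C \<Longrightarrow> j \<notin> C \<Longrightarrow> x j = y j"
  unfolding ctx_def by blast
lemma ctx_upd: "ctx E C L I m \<Longrightarrow> (x,y) \<in> I \<Longrightarrow> i \<in> L \<Longrightarrow> (upd E i x, upd E i y) \<in> I"
  by (simp add: ctx_def)
lemma ctx_control:
  assumes "ctx E C L I m" "(x,x) \<in> I" "a \<in> C"
  obtains u where "set u \<subseteq> L - C" "length u \<le> m" "\<And>j b. (j,a,b) \<in> E \<Longrightarrow> j \<notin> C \<Longrightarrow> run E u x j = b"
proof -
  from assms have "\<exists>u. set u \<subseteq> L - C \<and> length u \<le> m \<and> (\<forall>j b. (j,a,b) \<in> E \<longrightarrow> j \<notin> C \<longrightarrow> run E u x j = b)"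
    unfolding ctx_def by simp
  then show thesis using that by blast
qed

lemma ctx_run: "ctx E C L I m \<Longrightarrow> (x,y) \<in> I \<Longrightarrow> set w \<subseteq> L \<Longrightarrow> (run E w x, run E w y) \<in> I"
  by (induction w arbitrary: x y) (auto intro: ctx_upd)

text \<open>A lowering in the restricted net is caused by a false literal inside \<open>S\<close>,
  which is equally false in the full net. Before a raise the control word makes all literals from
  outside \<open>C\<close> true; it leaves \<open>S\<close> alone, and closedness excludes literals
  from the rest of \<open>C\<close>.\<close>

lemma lift_word:
  assumes ctx: "ctx E C L I m" and SC: "S \<subseteq> C" and cl: "closed_in E C S"
  shows "(x,x) \<in> I \<Longrightarrow> set w \<subseteq> S \<Longrightarrow> effective (restr E S) w z \<Longrightarrow> (\<And>a. a \<in> S \<Longrightarrow> z a = x a) \<Longrightarrow>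
    \<exists>w'. set w' \<subseteq> set w \<union> (L - C) \<and> length w' \<le> length w + m * ups (restr E S) w z
      \<and> (\<forall>a\<in>S. run E w' x a = run (restr E S) w z a)"
proof (induction w arbitrary: x z)
  case Nil
  then show ?case by (intro exI[of _ "[]"]) simp
next
  case (Cons a w)
  let ?F = "restr E S"
  have aS: "a \<in> S" and ne: "net ?F z a \<noteq> z a" and aL: "a \<in> L"
    using Cons.prems SC ctx_sub[OF ctx] by auto
  have next_step: ?case
    if u: "set u \<subseteq> L - C" "length u \<le> (if z a then 0 else m)"
      and eq: "net E (run E u x) a = net ?F z a" for u
  proof -
    have uS: "run E u x b = z b" if "b \<in> S" for b
      using that u SC Cons.prems(4) by (subst run_other) auto
    have I': "(upd E a (run E u x), upd E a (run E u x)) \<in> I"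
      using Cons.prems(1) u aL by (intro ctx_upd[OF ctx] ctx_run[OF ctx]) auto
    have "\<exists>w'. set w' \<subseteq> set w \<union> (L - C) \<and> length w' \<le> length w + m * ups ?F w (upd ?F a z)
      \<and> (\<forall>b\<in>S. run E w' (upd E a (run E u x)) b = run ?F w (upd ?F a z) b)"
    proof (rule Cons.IH[OF I'])
      show "set w \<subseteq> S" "effective ?F w (upd ?F a z)" using Cons.prems by auto
      show "upd ?F a z b = upd E a (run E u x) b" if "b \<in> S" for b
        using uS[OF that] eq by (simp add: upd_def)
    qed
    then obtain w' where w': "set w' \<subseteq> set w \<union> (L - C)" "length w' \<le> length w + m * ups ?F w (upd ?F a z)"
      "\<forall>b\<in>S. run E w' (upd E a (run E u x)) b = run ?F w (upd ?F a z) b" by blast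
    show ?thesis
      by (rule exI[of _ "u @ a # w'"]) (use w' u in \<open>auto split: if_splits\<close>)
  qed
  show ?case
  proof (cases "z a")
    case True
    then have "\<not> net ?F z a" using ne by simp
    then obtain j b where "(j,a,b) \<in> E" "j \<in> S" "z j \<noteq> b" by (auto simp: net_def)
    then have "\<not> net E x a" using Cons.prems(4)[of j] net_False[of j a b E x] by simp
    then show ?thesis using next_step[of "[]"] True \<open>\<not> net ?F z a\<close> by simp
  next
    case False
    then have nF: "net ?F z a" using ne by simp
    have "a \<in> C" using aS SC by blast
    from ctx_control[OF ctx Cons.prems(1) this] obtain u where
      u: "set u \<subseteq> L - C" "length u \<le> m" "\<And>j b. (j,a,b) \<in> E \<Longrightarrow> j \<notin> C \<Longrightarrow> run E u x j = b" by blast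
    have "run E u x j = b" if j: "(j,a,b) \<in> E" for j b
    proof (cases "j \<in> C")
      case True
      then have "j \<in> S" using cl aS j unfolding closed_in_def by blast
      then have "z j = b" using nF j by (simp add: net_def)
      then show ?thesis using u(1) True Cons.prems(4)[OF \<open>j \<in> S\<close>] by (subst run_other) auto
    qed (use u j in auto)
    then have "net E (run E u x) a" by (simp add: net_def)
    then show ?thesis using next_step[of u] u nF False by simp
  qed
qed

lemma drive_word:
  fixes E :: "('v::finite) bdigraph"
  assumes "negcyc E" "i \<notin> M" "aligned (restr E S) M i t x" "hom_in (restr E S) M i"
  obtains w where "set w \<subseteq> M" "effective (restr E S) w x"
    "length w + m * ups (restr E S) w x \<le> cost m (card M)"
    "\<And>v s. (v,i,s) \<in> E \<Longrightarrow> v \<in> S \<Longrightarrow> (run (restr E S) w x v = s) = t"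
proof -
  let ?F = "restr E S"
  have "negcyc ?F" using assms(1) restr_sub by (rule negcyc_mono)
  from drive_pure[OF this subset_refl closed_in_self assms(2-)] obtain w1 where
    w1: "set w1 \<subseteq> M" "length w1 \<le> drive_len (card M)" "aligned ?F {} i t (run ?F w1 x)" by auto
  obtain w where w: "set w \<subseteq> set w1" "length w \<le> length w1" "effective ?F w x" "run ?F w x = run ?F w1 x"
    using effective_ex[of w1 ?F x] by blast
  have "2 * ups ?F w x \<le> drive_len (card M) + card M"
    using effective_ups[of M ?F w x] w w1 by (simp add: subset_trans)
  then have "ups ?F w x \<le> raise_len (card M)" using drive_len_raise_len[of "card M"] by linarith
  then have "length w + m * ups ?F w x \<le> cost m (card M)"
    using w w1 by (auto simp: cost_def intro!: add_mono)
  moreover have "(run ?F w x v = s) = t" if "(v,i,s) \<in> E" "v \<in> S" for v s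
    using w1(3) w(4) that pth.arc[of v i s ?F "{}"] by (auto simp: aligned_def)
  ultimately show thesis using that w w1 by blast
qed

lemma drive:
  fixes E :: "('v::finite) bdigraph"
  assumes "negcyc E" and ctx: "ctx E C L I m" and S: "S \<subseteq> C" "closed_in E C S" and x: "(x,x) \<in> I"
    and "M \<subseteq> S" "i \<notin> M" "aligned (restr E S) M i t x" "hom_in (restr E S) M i"
  obtains w where "set w \<subseteq> M \<union> (L - C)" "length w \<le> cost m (card M)"
    "\<And>v s. (v,i,s) \<in> E \<Longrightarrow> v \<in> S \<Longrightarrow> (run E w x v = s) = t"
proof -
  obtain w where w: "set w \<subseteq> M" "effective (restr E S) w x"
    "length w + m * ups (restr E S) w x \<le> cost m (card M)"
    "\<And>v s. (v,i,s) \<in> E \<Longrightarrow> v \<in> S \<Longrightarrow> (run (restr E S) w x v = s) = t"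
    using drive_word[OF assms(1,7-9), of m] by blast
  have "set w \<subseteq> S" using w(1) assms(6) by simp
  from lift_word[OF ctx S x this w(2)] obtain w' where
    w': "set w' \<subseteq> set w \<union> (L - C)" "length w' \<le> length w + m * ups (restr E S) w x"
    "\<forall>a\<in>S. run E w' x a = run (restr E S) w x a" by blast
  show thesis
  proof (rule that)
    show "set w' \<subseteq> M \<union> (L - C)" using w' w by blast
    show "length w' \<le> cost m (card M)" using w'(2) w(3) by linarith
    show "\<And>v s. (v,i,s) \<in> E \<Longrightarrow> v \<in> S \<Longrightarrow> (run E w' x v = s) = t" using w' w by metis
  qed
qed

subsection \<open>Choosing a root\<close>

text \<open>That is, no proper part of \<open>C\<close> is closed under predecessors.\<close>
definition strong :: "'v bdigraph \<Rightarrow> 'v set \<Rightarrow> bool" where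
  "strong E C \<longleftrightarrow> minclo E C C"

definition consistent_arcs :: "'v bdigraph \<Rightarrow> ('v \<Rightarrow> bool) \<Rightarrow> ('v \<times> 'v) set" where
  "consistent_arcs E z = {(j,i). \<exists>b. (j,i,b) \<in> E \<and> z i = (z j = b)}"

text \<open>Being a least fixed point, the region contains no cycle that merely supports itself. Its
  vertices can be listed so that parents in \<open>C\<close> come before children, starting from
  \<open>v\<close>.\<close>

inductive_set dominated :: "'v bdigraph \<Rightarrow> 'v set \<Rightarrow> 'v \<Rightarrow> 'v set" for E C v where
  "u \<in> C \<Longrightarrow> u \<noteq> v \<Longrightarrow> (\<forall>j b. (j,u,b) \<in> E \<longrightarrow> j \<in> C \<longrightarrow> j = v \<or> j \<in> dominated E C v) \<Longrightarrow> u \<in> dominated E C v"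

text \<open>Stronger than being stable under updates: each single literal that a vertex of
  \<open>P\<close> reads from \<open>C\<close> has the value of that vertex, so these literals never
  disagree.\<close>

definition synced :: "'v bdigraph \<Rightarrow> 'v set \<Rightarrow> 'v set \<Rightarrow> ('v \<Rightarrow> bool) \<Rightarrow> bool" where
  "synced E C P x \<longleftrightarrow> (\<forall>j u b. (j,u,b) \<in> E \<longrightarrow> j \<in> C \<longrightarrow> u \<in> P \<longrightarrow> x u = (x j = b))"

text \<open>Isolates what the arguments take from \<open>dominated\<close>, so that they also apply
  to the partial regions that arise while a region is synchronized vertex by vertex.\<close>

definition rooted :: "'v bdigraph \<Rightarrow> 'v set \<Rightarrow> 'v \<Rightarrow> 'v set \<Rightarrow> bool" where
  "rooted E C v P \<longleftrightarrow> v \<in> C \<and> P \<subseteq> C \<and> v \<notin> P \<and>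
     (\<forall>j u b. (j,u,b) \<in> E \<longrightarrow> j \<in> C \<longrightarrow> u \<in> P \<longrightarrow> j \<in> insert v P)"

text \<open>The parents differ as vertices. Parallel arcs of opposite signs do not suffice, since
  changing one parent must leave the literal of the other untouched.\<close>

definition branching :: "'v bdigraph \<Rightarrow> 'v set \<Rightarrow> 'v set" where
  "branching E C = {v \<in> C. \<exists>p q b c. p \<in> C \<and> q \<in> C \<and> p \<noteq> q \<and> (p,v,b) \<in> E \<and> (q,v,c) \<in> E}"

text \<open>Going round a cycle of consistent arcs returns to the same value, so the cycle is
  positive.\<close>

lemma consistent_arcs_acyclic:
  fixes E :: "('v::finite) bdigraph"
  assumes nc: "negcyc E"
  shows "acyclic (consistent_arcs E z)"
proof (rule acyclicI, intro allI notI)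
  define F where "F = {(j,i,b) \<in> E. z i = (z j = b)}"
  fix i assume "(i,i) \<in> (consistent_arcs E z)\<^sup>+"
  then obtain w where w: "(i,w) \<in> (consistent_arcs E z)\<^sup>*" "(w,i) \<in> consistent_arcs E z" by (meson tranclD2)
  have "consistent_arcs E z = {(j,i). \<exists>b. (j,i,b) \<in> F \<and> i \<in> UNIV}" by (simp add: consistent_arcs_def F_def)
  then obtain s where s: "pth F (UNIV - {i,i}) i i s"
    using pth_reach[of i w F UNIV i] w by (auto simp: consistent_arcs_def F_def)
  have "z i = (z i = s)" using pth_consistent[OF s, of z] by (auto simp: F_def)
  then have s by blast
  moreover have "pth E (UNIV - {i}) i i s" using pth_mono_arcs[OF s, of E] by (auto simp: F_def)
  ultimately show False using nc by (auto simp: negcyc_def)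
qed

lemma strongE:
  assumes "strong E C" "A \<subseteq> C" "A \<noteq> {}" "A \<noteq> C"
  shows "\<exists>j k b. (j,k,b) \<in> E \<and> k \<in> A \<and> j \<in> C \<and> j \<notin> A"
proof -
  from assms minclo_strong[of E C C A] obtain j k b where "(j,k,b) \<in> E" "k \<in> A" "j \<in> C - A"
    unfolding strong_def by metis
  then show ?thesis by blast
qed

lemma minclo_imp_strong: "minclo E M C \<Longrightarrow> strong E C"
proof -
  assume m: "minclo E M C"
  have "closed_in E M A" if "closed_in E C A" "A \<subseteq> C" for A
    using m that unfolding minclo_def closed_in_def by (meson subsetD)
  then show ?thesis using m closed_in_self[of E C] unfolding strong_def minclo_def by simp
qed

text \<open>The vertices of \<open>N\<close> that do not reach \<open>v\<close> inside
  \<open>N\<close> have no arc out to the rest of \<open>C\<close>; their complement in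
  \<open>C\<close> would be closed.\<close>

lemma strong_reach:
  assumes st: "strong E C" and v: "v \<in> C" "v \<notin> N" "N \<subseteq> C"
    and ex: "\<And>j k b. (j,k,b) \<in> E \<Longrightarrow> j \<in> N \<Longrightarrow> k \<in> C \<Longrightarrow> k \<in> N \<or> k = v" and u: "u \<in> N"
  shows "\<exists>s. pth E (N - {u}) u v s"
proof -
  let ?r = "{(j,i). \<exists>b. (j,i,b) \<in> E \<and> i \<in> N}"
  define A where "A = {u \<in> N. \<exists>w b. (u,w) \<in> ?r\<^sup>* \<and> (w,v,b) \<in> E}"
  have "u \<in> A"
  proof (rule ccontr)
    assume "u \<notin> A"
    then have "C - (N - A) \<subseteq> C" "C - (N - A) \<noteq> {}" "C - (N - A) \<noteq> C"
      using u v by auto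
    from strongE[OF st this] obtain j k b where a: "(j,k,b) \<in> E" "k \<in> C - (N - A)" "j \<in> C" "j \<in> N" "j \<notin> A"
      by blast
    show False
    proof (cases "k = v")
      case True
      then have "j \<in> A" using a unfolding A_def by blast
      then show False using a by blast
    next
      case False
      then have k: "k \<in> N" "k \<in> A" using ex[OF a(1)] a by auto
      then obtain w c where "(k,w) \<in> ?r\<^sup>*" "(w,v,c) \<in> E" unfolding A_def by blast
      moreover have "(j,k) \<in> ?r" using a k by blast
      ultimately have "(j,w) \<in> ?r\<^sup>*" by (simp add: converse_rtrancl_into_rtrancl)
      then show False using a \<open>(w,v,c) \<in> E\<close> unfolding A_def by blast
    qed
  qed
  then obtain w b where "(u,w) \<in> ?r\<^sup>*" "(w,v,b) \<in> E" unfolding A_def by blast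
  from pth_reach[OF this] have "\<exists>s. pth E (N - {u,v}) u v s" .
  moreover have "N - {u,v} = N - {u}" using v by blast
  ultimately show ?thesis by simp
qed

lemma rooted_reach:
  assumes st: "strong E C" and r: "rooted E C v P" and p: "p \<in> insert v P"
  shows "(v,p) \<in> {(j,i). \<exists>b. (j,i,b) \<in> E \<and> j \<in> insert v P \<and> i \<in> P}\<^sup>*" (is "_ \<in> ?r\<^sup>*")
proof (rule ccontr)
  define B where "B = {p \<in> P. (v,p) \<notin> ?r\<^sup>*}"
  assume "(v,p) \<notin> ?r\<^sup>*"
  then have "B \<noteq> {}" using p unfolding B_def by blast
  moreover have "B \<subseteq> C" "B \<noteq> C" using r unfolding B_def rooted_def by auto
  ultimately obtain j k b where a: "(j,k,b) \<in> E" "k \<in> B" "j \<in> C" "j \<notin> B"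
    using strongE[OF st] by meson
  have kP: "k \<in> P" using a(2) by (simp add: B_def)
  have j: "j \<in> insert v P" using r a(1,3) kP unfolding rooted_def by blast
  then have "(v,j) \<in> ?r\<^sup>*" using a(4) unfolding B_def by blast
  moreover have "(j,k) \<in> ?r" using a j kP by blast
  ultimately have "(v,k) \<in> ?r\<^sup>*" by (rule rtrancl_into_rtrancl)
  then show False using a(2) by (simp add: B_def)
qed

text \<open>One path from \<open>v\<close> decides the value, because every arc into
  \<open>P\<close> is consistent with a synced state. The sign therefore does not depend on the
  state.\<close>

lemma rooted_value:
  assumes st: "strong E C" and r: "rooted E C v P" and p: "p \<in> insert v P"
  shows "\<exists>s. (p = v \<longrightarrow> s) \<and> (p \<noteq> v \<longrightarrow> pth E (P - {p}) v p s) \<and> (\<forall>x. synced E C P x \<longrightarrow> x p = (x v = s))"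
proof (cases "p = v")
  case True
  then show ?thesis by (intro exI[of _ True]) simp
next
  case False
  let ?F = "{(j,i,b). (j,i,b) \<in> E \<and> j \<in> insert v P \<and> i \<in> P}"
  have vP: "v \<notin> P" "insert v P \<subseteq> C" using r by (auto simp: rooted_def)
  from rooted_reach[OF st r p] False obtain w where
    w: "(v,w) \<in> {(j,i). \<exists>b. (j,i,b) \<in> E \<and> j \<in> insert v P \<and> i \<in> P}\<^sup>*" "\<exists>b. (w,p,b) \<in> E \<and> w \<in> insert v P"
    by (cases rule: rtranclE) auto
  then obtain b where b: "(w,p,b) \<in> ?F" using p False by blast
  have "{(j,i). \<exists>b. (j,i,b) \<in> E \<and> j \<in> insert v P \<and> i \<in> P} = {(j,i). \<exists>b. (j,i,b) \<in> ?F \<and> i \<in> P}" by auto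
  with w(1) have "(v,w) \<in> {(j,i). \<exists>b. (j,i,b) \<in> ?F \<and> i \<in> P}\<^sup>*" by simp
  from pth_reach[OF this b] obtain s where s: "pth ?F (P - {v,p}) v p s" ..
  have "P - {v,p} = P - {p}" using vP by blast
  then have "pth E (P - {p}) v p s" using pth_mono_arcs[OF s, of E] by auto
  moreover have "x p = (x v = s)" if "synced E C P x" for x
    by (rule pth_consistent[OF s]) (use that vP in \<open>unfold synced_def, blast\<close>)
  ultimately show ?thesis using False by blast
qed

lemma rooted_arc_value:
  assumes st: "strong E C" and r: "rooted E C v P" and p: "p \<in> insert v P" and a: "(p,k,b) \<in> E" and k: "k \<notin> P"
  shows "\<exists>s. pth E P v k s \<and> (\<forall>x. synced E C P x \<longrightarrow> (x p = b) = (x v = s))"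
proof -
  from rooted_value[OF st r p] obtain s where
    s: "p = v \<longrightarrow> s" "p \<noteq> v \<longrightarrow> pth E (P - {p}) v p s" "\<forall>x. synced E C P x \<longrightarrow> x p = (x v = s)"
    by (elim exE conjE) (rule that)
  have "pth E P v k (s = b)"
  proof (cases "p = v")
    case True
    then show ?thesis using s a by (auto intro: pth.arc)
  next
    case False
    then have "pth E (insert p (P - {p} \<union> {})) v k (s = b)"
      using s(2) by (intro pth_concat) (auto intro: pth.arc a)
    then show ?thesis by (rule pth_mono) (use p False in auto)
  qed
  moreover have "(x p = b) = (x v = (s = b))" if "synced E C P x" for x using s(3) that by blast
  ultimately show ?thesis by blast
qed

text \<open>All literals at a vertex below the root close cycles through the same exit path.\<close>
lemma rooted_literal:
  assumes nc: "negcyc E" and st: "strong E C" and r: "rooted E C v P"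
    and u: "u \<in> C" "u \<notin> P" "u \<noteq> v" and par: "\<And>j b. (j,u,b) \<in> E \<Longrightarrow> j \<in> C \<Longrightarrow> j \<in> insert v P"
  shows "\<exists>t. \<forall>x. synced E C P x \<longrightarrow> (\<forall>j b. (j,u,b) \<in> E \<longrightarrow> j \<in> C \<longrightarrow> (x j = b) = (x v = t))"
proof -
  define N where "N = C - P - {v}"
  have uN: "u \<in> N" using u by (simp add: N_def)
  have "\<exists>s. pth E (N - {u}) u v s"
    by (rule strong_reach[OF st _ _ _ _ uN]) (use r in \<open>auto simp: N_def rooted_def\<close>)
  then obtain s3 where s3: "pth E (N - {u}) u v s3" ..
  have "(x j = b) = (x v = (\<not> s3))" if x: "synced E C P x" and a: "(j,u,b) \<in> E" "j \<in> C" for x j b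
  proof -
    from rooted_arc_value[OF st r par[OF a] a(1) u(2)] x obtain s where
      s: "pth E P v u s" "(x j = b) = (x v = s)" by blast
    have "pth E (insert u (P \<union> (N - {u}))) v v (s = s3)"
      by (rule pth_concat[OF s(1) s3]) (use u in \<open>auto simp: N_def\<close>)
    then have "\<not> (s = s3)" by (rule negcyc_pth[OF nc]) (use u r in \<open>auto simp: N_def rooted_def\<close>)
    then show ?thesis using s(2) by blast
  qed
  then show ?thesis by (intro exI[of _ "\<not> s3"]) simp
qed

lemma dominated_sub: "dominated E C v \<subseteq> C - {v}"
  by (auto elim: dominated.cases)

lemma dominated_rooted: "v \<in> C \<Longrightarrow> rooted E C v (dominated E C v)"
  unfolding rooted_def using dominated_sub[of E C v] by (auto elim: dominated.cases)

lemma strong_parent: "strong E C \<Longrightarrow> a \<in> C \<Longrightarrow> C \<noteq> {a} \<Longrightarrow> \<exists>j b. (j,a,b) \<in> E \<and> j \<in> C \<and> j \<noteq> a"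
  using strongE[of E C "{a}"] by blast

text \<open>Passing from a common vertex to parents stays in both regions until one of the two roots
  is met.\<close>

lemma dominated_meet:
  assumes st: "strong E C" and two: "\<And>a. C \<noteq> {a}" and p: "p \<in> insert v (dominated E C v)" "p \<in> insert w (dominated E C w)"
  shows "v \<in> insert w (dominated E C w) \<or> w \<in> insert v (dominated E C v)"
proof (cases "p = v")
  case False
  then have "p \<in> dominated E C v" using p by blast
  then show ?thesis using p(2)
  proof (induction rule: dominated.induct)
    case (1 u)
    show ?case
    proof (cases "u = w")
      case True
      have "u \<in> dominated E C v" by (rule dominated.intros) (use 1 in blast)+
      then show ?thesis using True by blast
    next
      case False
      then have "u \<in> dominated E C w" using 1 by blast
      then have par: "\<And>j b. (j,u,b) \<in> E \<Longrightarrow> j \<in> C \<Longrightarrow> j \<in> insert w (dominated E C w)"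
        by (cases rule: dominated.cases) blast
      from strong_parent[OF st 1(1) two] obtain j b where j: "(j,u,b) \<in> E" "j \<in> C" by blast
      then show ?thesis using 1(3) par[OF j] by blast
    qed
  qed
qed (use p in blast)

lemma dominated_trans:
  assumes "w \<in> insert v (dominated E C v)"
  shows "insert w (dominated E C w) \<subseteq> insert v (dominated E C v)"
proof -
  have "u \<in> insert v (dominated E C v)" if "u \<in> dominated E C w" for u
    using that
  proof (induction rule: dominated.induct)
    case (1 u)
    show ?case
    proof (cases "u = v")
      case False
      have "u \<in> dominated E C v"
        by (rule dominated.intros) (use 1 False assms in blast)+
      then show ?thesis by blast
    qed simp
  qed
  then show ?thesis using assms by blast
qed

text \<open>Among the branching vertices whose dominated region is maximal, not all can have an
  outgoing arc that becomes consistent with everything set to false.\<close>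
lemma root_select:
  fixes E :: "('v::finite) bdigraph"
  assumes nc: "negcyc E" and st: "strong E C" and br: "branching E C \<noteq> {}"
  shows "\<exists>v\<in>branching E C. \<forall>p k b x. p \<in> insert v (dominated E C v) \<longrightarrow> k \<in> C - insert v (dominated E C v) \<longrightarrow>
     (p,k,b) \<in> E \<longrightarrow> synced E C (dominated E C v) x \<longrightarrow> (x p = b) = (\<not> x v)"
proof (rule ccontr)
  assume neg: "\<not> ?thesis"
  define R where "R v = insert v (dominated E C v)" for v
  define B where "B = branching E C"
  have BC: "v \<in> C" if "v \<in> B" for v using that by (simp add: B_def branching_def)
  have two: "C \<noteq> {a}" for a using br unfolding branching_def by blast
  have RC: "R v \<subseteq> C" if "v \<in> C" for v using that dominated_sub[of E C v] by (auto simp: R_def)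
  have vR: "v \<in> R v" for v by (simp add: R_def)
  have trans: "R w \<subseteq> R v" if "w \<in> R v" for v w using dominated_trans[of w v E C] that by (simp add: R_def)
  have meet: "v \<in> R w \<or> w \<in> R v" if "p \<in> R v" "p \<in> R w" for p v w
    using dominated_meet[OF st two] that by (simp add: R_def)
  \<comment> \<open>\<open>M1\<close> collects the roots with maximal regions, mutual domination
    allowed; \<open>M2\<close> those lying in no other region. Cardinality provides an element of
    \<open>M1\<close>, but \<open>M2\<close> is shown nonempty only through
    \<open>step\<close>.\<close>
  define M1 where "M1 = {v \<in> B. \<forall>w\<in>B. v \<in> R w \<longrightarrow> w \<in> R v}"
  define M2 where "M2 = {k \<in> B. \<forall>w\<in>B. k \<in> R w \<longrightarrow> w = k}"
  have M21: "M2 \<subseteq> M1" by (auto simp: M1_def M2_def vR)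
  obtain v0 where v0: "v0 \<in> B" "\<And>w. w \<in> B \<Longrightarrow> card (R w) \<le> card (R v0)"
  proof -
    have fin: "finite ((\<lambda>v. card (R v)) ` B)" "(\<lambda>v. card (R v)) ` B \<noteq> {}" using br by (auto simp: B_def)
    from Max_in[OF this] obtain v where "v \<in> B" "card (R v) = Max ((\<lambda>v. card (R v)) ` B)" by auto
    then show thesis using that Max_ge[OF fin(1)] by (metis imageI)
  qed
  have v0M: "v0 \<in> M1"
    unfolding M1_def
  proof (intro CollectI conjI ballI impI)
    fix w assume w: "w \<in> B" "v0 \<in> R w"
    then have "R v0 = R w" using trans[OF w(2)] v0(2)[OF w(1)] by (simp add: card_seteq)
    then show "w \<in> R v0" using vR by blast
  qed (rule v0(1))
  define s where "s v u = (SOME s. (u = v \<longrightarrow> s) \<and> (\<forall>x. synced E C (dominated E C v) x \<longrightarrow> x u = (x v = s)))" for v u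
  have s_prop: "(u = v \<longrightarrow> s v u) \<and> (\<forall>x. synced E C (dominated E C v) x \<longrightarrow> x u = (x v = s v u))"
    if "v \<in> C" "u \<in> R v" for v u
    unfolding s_def
    by (rule someI_ex) (use rooted_value[OF st dominated_rooted[OF that(1)], of u] that(2) in \<open>auto simp: R_def\<close>)
  then have s: "x u = (x v = s v u)" if "v \<in> C" "u \<in> R v" "synced E C (dominated E C v) x" for v u x
    using that by blast
  have sv: "s v v" if "v \<in> C" for v using s_prop[OF that vR] by simp
  have bad: "\<exists>p k b x. p \<in> R v \<and> k \<in> C - R v \<and> (p,k,b) \<in> E \<and> (s v p = b) \<and> synced E C (dominated E C v) x"
    if "v \<in> B" for v
  proof -
    have "\<not> (\<forall>p k b x. p \<in> insert v (dominated E C v) \<longrightarrow> k \<in> C - insert v (dominated E C v) \<longrightarrow>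
      (p,k,b) \<in> E \<longrightarrow> synced E C (dominated E C v) x \<longrightarrow> (x p = b) = (\<not> x v))"
      using neg that unfolding B_def by blast
    then obtain p k b x where *: "p \<in> R v" "k \<in> C - R v" "(p,k,b) \<in> E"
      "synced E C (dominated E C v) x" "(x p = b) \<noteq> (\<not> x v)" unfolding R_def by blast
    then have "s v p = b" using s[OF BC[OF that] *(1) *(4)] by blast
    then show ?thesis using * by blast
  qed
  \<comment> \<open>A vertex \<open>k\<close> reached from the region of \<open>v\<close> has a
    parent there and, not being dominated, another outside, so it branches. A region of
    \<open>w\<close> strictly above \<open>k\<close> would contain \<open>p\<close>, hence meet that
    of \<open>v\<close> and be absorbed by it together with \<open>k\<close>.\<close>
  have step: "k \<in> M2" if v: "v \<in> M1" and a: "p \<in> R v" "k \<in> C - R v" "(p,k,b) \<in> E" for v p k b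
  proof -
    have vB: "v \<in> B" and vm: "\<And>w. w \<in> B \<Longrightarrow> v \<in> R w \<Longrightarrow> w \<in> R v" using v by (auto simp: M1_def)
    have pC: "p \<in> C" using RC[OF BC[OF vB]] a by blast
    have "k \<notin> dominated E C v" "k \<noteq> v" using a(2) by (auto simp: R_def)
    then obtain q c where q: "(q,k,c) \<in> E" "q \<in> C" "q \<notin> R v"
      using dominated.intros[of k C v E] a(2) unfolding R_def by blast
    have kB: "k \<in> B" unfolding B_def branching_def using a q pC by blast
    have "w = k" if w: "w \<in> B" "k \<in> R w" for w
    proof (rule ccontr)
      assume "w \<noteq> k"
      then have "k \<in> dominated E C w" using w by (simp add: R_def)
      then have "p \<in> R w" using a(3) pC unfolding R_def by (cases rule: dominated.cases) blast
      then have "w \<in> R v" using meet[OF a(1)] vm[OF w(1)] by blast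
      then show False using trans a(2) w(2) by blast
    qed
    then show ?thesis using kB by (simp add: M2_def)
  qed
  have ne2: "M2 \<noteq> {}"
  proof -
    have "v0 \<in> B" using v0 by simp
    from bad[OF this] step[OF v0M] show ?thesis by blast
  qed
  define rt where "rt u = (THE v. v \<in> M2 \<and> u \<in> R v)" for u
  have rt: "rt u = v" if "v \<in> M2" "u \<in> R v" for u v
    unfolding rt_def
  proof (rule the_equality)
    fix w assume w: "w \<in> M2 \<and> u \<in> R w"
    have "v \<in> B" "w \<in> B" using that w by (auto simp: M2_def)
    moreover have "v \<in> R w \<or> w \<in> R v" using meet[of u v w] that w by blast
    ultimately show "w = v" using that w unfolding M2_def by blast
  qed (use that in blast)
  \<comment> \<open>All roots in \<open>M2\<close> are 0 and their regions carry the values this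
    determines; elsewhere \<open>z\<close> is arbitrary.\<close>
  define z where "z u = (\<not> s (rt u) u)" for u
  have zR: "z u = (\<not> s v u)" if "v \<in> M2" "u \<in> R v" for u v using rt[OF that] by (simp add: z_def)
  have ex: "\<exists>k\<in>M2. (v,k) \<in> (consistent_arcs E z)\<^sup>+" if v: "v \<in> M2" for v
  proof -
    have vB: "v \<in> B" using v by (simp add: M2_def)
    from bad[OF vB] obtain p k b x where *: "p \<in> R v" "k \<in> C - R v" "(p,k,b) \<in> E" "s v p = b"
      "synced E C (dominated E C v) x" by blast
    have k: "k \<in> M2" using step[OF _ *(1-3)] v M21 by blast
    have "{(j,i). \<exists>b. (j,i,b) \<in> E \<and> j \<in> insert v (dominated E C v) \<and> i \<in> dominated E C v} \<subseteq> consistent_arcs E z"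
    proof clarify
      fix j u c assume a: "(j,u,c) \<in> E" "j \<in> insert v (dominated E C v)" "u \<in> dominated E C v"
      then have jR: "j \<in> R v" "u \<in> R v" by (auto simp: R_def)
      have "x u = (x j = c)" using *(5) a(1,3) jR RC[OF BC[OF vB]] unfolding synced_def by blast
      then show "(j,u) \<in> consistent_arcs E z"
        using s[OF BC[OF vB] jR(1) *(5)] s[OF BC[OF vB] jR(2) *(5)] zR[OF v jR(1)] zR[OF v jR(2)] a(1)
        unfolding consistent_arcs_def by blast
    qed
    then have "(v,p) \<in> (consistent_arcs E z)\<^sup>*"
      using rooted_reach[OF st dominated_rooted[OF BC[OF vB]], of p] *(1) rtrancl_mono unfolding R_def by blast
    moreover have "\<not> z k" using zR[OF k vR] sv[of k] *(2) by simp
    \<comment> \<open>A bad exit has a false literal when its root is 0, which agrees with the value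
      0 of the next root \<open>k\<close>.\<close>
    then have "(p,k) \<in> consistent_arcs E z" using zR[OF v *(1)] *(3,4) unfolding consistent_arcs_def by blast
    ultimately show ?thesis using k by (meson rtrancl_into_trancl1)
  qed
  \<comment> \<open>Every root in \<open>M2\<close> leads along consistent arcs to another element
    of \<open>M2\<close>, which a finite acyclic relation cannot sustain.\<close>
  have "acyclic ((consistent_arcs E z)\<^sup>+)" using consistent_arcs_acyclic[OF nc, of z] by (simp add: acyclic_def)
  then have "wf (((consistent_arcs E z)\<^sup>+)\<inverse>)" by (simp add: finite_acyclic_wf_converse)
  then obtain v where "v \<in> M2" "\<And>k. (v,k) \<in> (consistent_arcs E z)\<^sup>+ \<Longrightarrow> k \<notin> M2"
    using wfE_min[of "((consistent_arcs E z)\<^sup>+)\<inverse>" _ M2] ne2 by (metis converse_iff ex_in_conv)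
  then show False using ex by blast
qed

subsection \<open>Merging two states on a strong component\<close>

lemma dominated_next:
  assumes P: "P \<subset> dominated E K v"
  shows "\<exists>u \<in> dominated E K v - P. \<forall>j b. (j,u,b) \<in> E \<longrightarrow> j \<in> K \<longrightarrow> j \<in> insert v P"
proof (rule ccontr)
  assume neg: "\<not> ?thesis"
  have "u \<in> P" if "u \<in> dominated E K v" for u
    using that
  proof (induction rule: dominated.induct)
    case (1 u)
    have "u \<in> dominated E K v" by (rule dominated.intros) (use 1 in blast)+
    then show ?case using neg 1 by blast
  qed
  then show False using P by blast
qed

text \<open>The region grows in an order where parents come first, and \<open>rooted_literal\<close>
  makes the literals from \<open>K\<close> at the next vertex equal. The control words are computed
  for \<open>x\<close> alone; they serve every related \<open>y\<close> because related states agree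
  on the arcs entering \<open>C\<close>. Literals from \<open>C - K\<close> are not controlled and
  have to be true from the start.\<close>

lemma sync_word_aux:
  fixes E :: "('v::finite) bdigraph"
  assumes nc: "negcyc E" and ctx: "ctx E C L I m" and K: "K \<subseteq> C" "strong E K" and v: "v \<in> K" and x: "(x,x) \<in> I"
  shows "n \<le> card (dominated E K v) \<Longrightarrow> \<exists>P w. P \<subseteq> dominated E K v \<and> card P = n \<and> rooted E K v P \<and> set w \<subseteq> P \<union> (L - C)
    \<and> length w \<le> n * (m + 1) \<and> (\<forall>y. (x,y) \<in> I \<longrightarrow>
        (\<forall>j u b. (j,u,b) \<in> E \<longrightarrow> u \<in> dominated E K v \<longrightarrow> j \<in> C - K \<longrightarrow> y j = b) \<longrightarrow> synced E K P (run E w y))"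
proof (induction n)
  case 0
  show ?case using v by (intro exI[of _ "{}"] exI[of _ "[]"]) (auto simp: rooted_def synced_def)
next
  case (Suc n)
  let ?D = "dominated E K v"
  from Suc obtain P w where P: "P \<subseteq> ?D" "card P = n" "rooted E K v P" "set w \<subseteq> P \<union> (L - C)" "length w \<le> n * (m + 1)"
    and sy: "\<And>y. (x,y) \<in> I \<Longrightarrow> \<forall>j u b. (j,u,b) \<in> E \<longrightarrow> u \<in> ?D \<longrightarrow> j \<in> C - K \<longrightarrow> y j = b \<Longrightarrow> synced E K P (run E w y)"
    by auto
  have "P \<subset> ?D" using P Suc.prems by auto
  from dominated_next[OF this] obtain u where u: "u \<in> ?D" "u \<notin> P" "\<And>j b. (j,u,b) \<in> E \<Longrightarrow> j \<in> K \<Longrightarrow> j \<in> insert v P" by auto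
  have DK: "?D \<subseteq> K - {v}" by (rule dominated_sub)
  have wL: "set w \<subseteq> L" using P(1,4) DK K ctx_sub[OF ctx] by blast
  have uK: "u \<in> K" "u \<noteq> v" "u \<in> C" using u DK K by auto
  from ctx_control[OF ctx ctx_run[OF ctx x wL] uK(3)] obtain c where
    c: "set c \<subseteq> L - C" "length c \<le> m" "\<And>j b. (j,u,b) \<in> E \<Longrightarrow> j \<notin> C \<Longrightarrow> run E c (run E w x) j = b" by blast
  from rooted_literal[OF nc K(2) P(3) uK(1) u(2) uK(2) u(3)] obtain t where
    t0: "\<forall>x. synced E K P x \<longrightarrow> (\<forall>j b. (j,u,b) \<in> E \<longrightarrow> j \<in> K \<longrightarrow> (x j = b) = (x v = t))" ..
  have t: "(z j = b) = (z v = t)" if "synced E K P z" "(j,u,b) \<in> E" "j \<in> K" for z j b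
    using t0 that by simp
  have "K \<noteq> {u}" using v uK by blast
  from strong_parent[OF K(2) uK(1) this] obtain q d where q: "(q,u,d) \<in> E" "q \<in> K" by blast
  have "synced E K (insert u P) (run E (w @ c @ [u]) y)"
    if y: "(x,y) \<in> I" and H: "\<forall>j u b. (j,u,b) \<in> E \<longrightarrow> u \<in> ?D \<longrightarrow> j \<in> C - K \<longrightarrow> y j = b" for y
  proof -
    let ?y = "run E c (run E w y)"
    have I2: "(run E c (run E w x), ?y) \<in> I"
      by (intro ctx_run[OF ctx]) (use y wL c in auto)
    have yC: "?y j = run E w y j" if "j \<in> C" for j using that c(1) by (intro run_other) auto
    have s2: "synced E K P ?y" using sy[OF y H] P(3) yC K unfolding synced_def rooted_def by (metis (no_types, lifting) subsetD)
    have "net E ?y u = (?y v = t)"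
    proof -
      have "(?y j = b) \<or> (?y v \<noteq> t)" if a: "(j,u,b) \<in> E" for j b
      proof (cases "j \<in> K")
        case True then show ?thesis using t[OF s2 a] by blast
      next
        case False
        show ?thesis
        proof (cases "j \<in> C")
          case True
          have "run E w y j = y j" using False True P(1,4) DK by (intro run_other) auto
          then show ?thesis using H a u(1) True False yC by simp
        next
          case False
          then show ?thesis using c(3)[OF a] ctx_ext[OF ctx I2 a uK(3)] by simp
        qed
      qed
      moreover have "(?y q = d) = (?y v = t)" by (rule t[OF s2 q])
      ultimately show ?thesis using q(1) unfolding net_def by blast
    qed
    then have un: "upd E u ?y u = (?y v = t)" by simp
    have "upd E u ?y a = (upd E u ?y j = b)" if a: "(j,a,b) \<in> E" "j \<in> K" "a \<in> insert u P" for j a b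
    proof -
      have "j \<in> insert v P" using a P(3) u(3) unfolding rooted_def by blast
      then have ju: "j \<noteq> u" using u uK by blast
      show ?thesis
      proof (cases "a = u")
        case True
        then show ?thesis using un t[OF s2 a(1)[unfolded True] a(2)] ju by simp
      next
        case False
        then show ?thesis using s2 a ju unfolding synced_def by simp
      qed
    qed
    then show ?thesis by (simp add: synced_def)
  qed
  moreover have "rooted E K v (insert u P)" using P(3) u(3) uK unfolding rooted_def by blast
  moreover have "card (insert u P) = Suc n" using P(2) u(2) by simp
  moreover have "length (w @ c @ [u]) \<le> Suc n * (m + 1)" using P(5) c(2) by simp
  moreover have "set (w @ c @ [u]) \<subseteq> insert u P \<union> (L - C)" using P(4) c(1) by auto
  moreover have "insert u P \<subseteq> ?D" using P(1) u(1) by blast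
  ultimately show ?case by blast
qed

lemma sync_word:
  fixes E :: "('v::finite) bdigraph"
  assumes nc: "negcyc E" and ctx: "ctx E C L I m" and K: "K \<subseteq> C" "strong E K" and v: "v \<in> K" and x: "(x,x) \<in> I"
  shows "\<exists>w. set w \<subseteq> dominated E K v \<union> (L - C) \<and> length w \<le> card (dominated E K v) * (m + 1) \<and> (\<forall>y. (x,y) \<in> I \<longrightarrow>
        (\<forall>j u b. (j,u,b) \<in> E \<longrightarrow> u \<in> dominated E K v \<longrightarrow> j \<in> C - K \<longrightarrow> y j = b) \<longrightarrow> synced E K (dominated E K v) (run E w y))"
proof -
  from sync_word_aux[OF assms, of "card (dominated E K v)"] obtain P w where
    P: "P \<subseteq> dominated E K v" "card P = card (dominated E K v)" and w: "set w \<subseteq> P \<union> (L - C)"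
    "length w \<le> card (dominated E K v) * (m + 1)" "\<forall>y. (x,y) \<in> I \<longrightarrow>
        (\<forall>j u b. (j,u,b) \<in> E \<longrightarrow> u \<in> dominated E K v \<longrightarrow> j \<in> C - K \<longrightarrow> y j = b) \<longrightarrow> synced E K P (run E w y)"
    by auto
  have "P = dominated E K v" using P by (simp add: card_subset_eq)
  then show ?thesis using w by blast
qed

lemma agree_word_aux:
  fixes E :: "('v::finite) bdigraph"
  assumes "n \<le> card (dominated E K e)"
  shows "\<exists>P w. P \<subseteq> dominated E K e \<and> card P = n \<and> set w \<subseteq> P \<and> length w = n \<and> (\<forall>x y.
      (\<forall>j u b. (j,u,b) \<in> E \<longrightarrow> u \<in> dominated E K e \<longrightarrow> j \<notin> K \<longrightarrow> x j = y j) \<longrightarrow> x e = y e \<longrightarrow>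
      (\<forall>u\<in>P. run E w x u = run E w y u))"
  using assms
proof (induction n)
  case 0
  show ?case by (intro exI[of _ "{}"] exI[of _ "[]"]) auto
next
  case (Suc n)
  let ?D = "dominated E K e"
  from Suc obtain P w where P: "P \<subseteq> ?D" "card P = n" "set w \<subseteq> P" "length w = n"
    and ag: "\<And>x y u. \<forall>j u b. (j,u,b) \<in> E \<longrightarrow> u \<in> ?D \<longrightarrow> j \<notin> K \<longrightarrow> x j = y j \<Longrightarrow> x e = y e \<Longrightarrow> u \<in> P \<Longrightarrow>
      run E w x u = run E w y u" by auto
  have "P \<subset> ?D" using P Suc.prems by auto
  from dominated_next[OF this] obtain u where u: "u \<in> ?D" "u \<notin> P" "\<And>j b. (j,u,b) \<in> E \<Longrightarrow> j \<in> K \<Longrightarrow> j \<in> insert e P" by auto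
  have DK: "?D \<subseteq> K - {e}" by (rule dominated_sub)
  have "run E (w @ [u]) x a = run E (w @ [u]) y a"
    if H: "\<forall>j u b. (j,u,b) \<in> E \<longrightarrow> u \<in> ?D \<longrightarrow> j \<notin> K \<longrightarrow> x j = y j" "x e = y e" and a: "a \<in> insert u P" for x y a
  proof -
    have "run E w x j = run E w y j" if j: "(j,u,b) \<in> E" for j b
    proof (cases "j \<in> P")
      case True then show ?thesis using ag[OF H] by blast
    next
      case False
      then have "j \<notin> set w" using P(3) by blast
      moreover have "x j = y j" using H u False j by blast
      ultimately show ?thesis by (simp add: run_other)
    qed
    then have "net E (run E w x) u = net E (run E w y) u" unfolding net_def by blast
    then show ?thesis using a ag[OF H, of a] by (cases "a = u") auto
  qed
  moreover have "card (insert u P) = Suc n" using P(2) u(2) by simp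
  moreover have "insert u P \<subseteq> ?D" "set (w @ [u]) \<subseteq> insert u P" "length (w @ [u]) = Suc n" using P u by auto
  ultimately show ?case by (intro exI[of _ "insert u P"] exI[of _ "w @ [u]"]) (simp only:, simp)
qed

lemma agree_word:
  fixes E :: "('v::finite) bdigraph"
  shows "\<exists>w. set w \<subseteq> dominated E K e \<and> length w = card (dominated E K e) \<and> (\<forall>x y.
      (\<forall>j u b. (j,u,b) \<in> E \<longrightarrow> u \<in> dominated E K e \<longrightarrow> j \<notin> K \<longrightarrow> x j = y j) \<longrightarrow> x e = y e \<longrightarrow>
      (\<forall>u\<in>dominated E K e. run E w x u = run E w y u))"
proof -
  from agree_word_aux[OF order_refl, of E K e] obtain P w where P: "P \<subseteq> dominated E K e" "card P = card (dominated E K e)"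
    and w: "set w \<subseteq> P" "length w = card (dominated E K e)" "\<forall>x y.
      (\<forall>j u b. (j,u,b) \<in> E \<longrightarrow> u \<in> dominated E K e \<longrightarrow> j \<notin> K \<longrightarrow> x j = y j) \<longrightarrow> x e = y e \<longrightarrow>
      (\<forall>u\<in>P. run E w x u = run E w y u)" by auto
  have "P = dominated E K e" using P by (simp add: card_subset_eq)
  then show ?thesis using w by blast
qed

text \<open>A vertex left over would have, by strength, a parent that is not left over and, not
  being dominated, a second one, so it would branch.\<close>

lemma dominated_cycle:
  assumes st: "strong E K" and nb: "branching E K = {}" and e: "e \<in> K"
  shows "dominated E K e = K - {e}"
proof (rule ccontr)
  define B where "B = K - {e} - dominated E K e"
  assume "dominated E K e \<noteq> K - {e}"
  then have "B \<noteq> {}" "B \<subseteq> K" "B \<noteq> K" using dominated_sub[of E K e] e by (auto simp: B_def)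
  from strongE[OF st this(2,1,3)] obtain j k b where a: "(j,k,b) \<in> E" "k \<in> B" "j \<in> K" "j \<notin> B" by blast
  have k: "k \<in> K" "k \<noteq> e" "k \<notin> dominated E K e" using a(2) by (auto simp: B_def)
  then obtain q c where q: "(q,k,c) \<in> E" "q \<in> K" "q \<noteq> e" "q \<notin> dominated E K e"
    using dominated.intros[of k K e E] by blast
  then have "q \<noteq> j" using a by (auto simp: B_def)
  then have "k \<in> branching E K" unfolding branching_def using a q k by blast
  then show False using nb by simp
qed

lemma pth_stay:
  "pth E M u v s \<Longrightarrow> u \<in> X \<Longrightarrow> (\<And>j k b. (j,k,b) \<in> E \<Longrightarrow> j \<in> X \<Longrightarrow> k \<in> M \<Longrightarrow> k \<in> X) \<Longrightarrow> pth E (M \<inter> X) u v s"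
proof (induction rule: pth.induct)
  case (step u w b M v s)
  have "w \<in> X" using step by blast
  moreover have "pth E ((M - {w}) \<inter> X) w v s" using step by blast
  moreover have "(M - {w}) \<inter> X = M \<inter> X - {w}" by blast
  ultimately show ?case using pth.step[of u w b E "M \<inter> X" v s] step by simp
qed (rule pth.arc)

text \<open>Drives one state, then updates the root; if the other state resists, driving it up to the first
  change of a parent of the root suffices, because the root has a second parent.\<close>
lemma agree_root:
  fixes E :: "('v::finite) bdigraph"
  assumes nc: "negcyc E" and ctx: "ctx E C L I m" and st: "strong E C" and v: "v \<in> branching E C"
    and F: "F \<subseteq> C - {v}" "\<And>e s. e \<in> F \<Longrightarrow> pth E (C - {v} - F) e v s \<Longrightarrow> s"
    and xy: "(x,y) \<in> I" and xv: "x v" and xF: "\<And>e. e \<in> F \<Longrightarrow> \<not> x e" "\<And>e. e \<in> F \<Longrightarrow> \<not> y e"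
  shows "\<exists>w. set w \<subseteq> (C - F) \<union> (L - C) \<and> length w \<le> 2 * cost m (card C - 1 - card F) + 2
     \<and> \<not> run E w x v \<and> \<not> run E w y v"
proof -
  define M where "M = C - {v} - F"
  let ?G = "restr E C"
  have vC: "v \<in> C" using v by (simp add: branching_def)
  have cM: "card M = card C - 1 - card F"
    using F(1) vC by (simp add: M_def card_Diff_subset finite_subset)
  have MC: "M \<subseteq> C" "v \<notin> M" "M \<subset> C" using vC by (auto simp: M_def)
  have CL: "C \<subseteq> L" by (rule ctx_sub[OF ctx])
  have hom: "hom_in ?G M v"
    by (rule minclo_hom_in[OF st[unfolded strong_def] MC(3)])
  \<comment> \<open>Within \<open>C\<close> only \<open>v\<close> and \<open>F\<close> lie outside
    \<open>M\<close>. The root is 1 and returns to itself negatively, each vertex of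
    \<open>F\<close> is 0 and its exits are positive: all deliver a false literal.\<close>
  have al: "aligned ?G M v False z" if z: "z v" "\<And>e. e \<in> F \<Longrightarrow> \<not> z e" for z
    unfolding aligned_def
  proof (intro allI impI)
    fix u s assume u: "u \<notin> M" "pth ?G M u v s"
    then have "u \<in> C" by (blast dest: pth_restr)
    have p: "pth E M u v s" using u(2) restr_sub by (rule pth_mono_arcs)
    show "(z u = s) = False"
    proof (cases "u = v")
      case True
      then have "\<not> s" using negcyc_pth[OF nc _ MC(2)] p by blast
      then show ?thesis using True z by simp
    next
      case False
      then have "u \<in> F" using u(1) \<open>u \<in> C\<close> by (simp add: M_def)
      then show ?thesis using F(2) p z(2) by (simp add: M_def)
    qed
  qed
  obtain p1 p2 b1 b2 where par: "p1 \<in> C" "p2 \<in> C" "p1 \<noteq> p2" "(p1,v,b1) \<in> E" "(p2,v,b2) \<in> E"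
    using v unfolding branching_def by blast
  obtain w1 where w1: "set w1 \<subseteq> M \<union> (L - C)" "length w1 \<le> cost m (card M)"
    "\<And>u s. (u,v,s) \<in> E \<Longrightarrow> u \<in> C \<Longrightarrow> (run E w1 x u = s) = False"
    using drive[OF nc ctx subset_refl closed_in_self ctx_refl[OF ctx xy] MC(1,2) al[of x, OF xv xF(1)] hom] by blast
  let ?x = "run E w1 x" and ?y = "run E w1 y"
  have w1L: "set w1 \<subseteq> L" using w1(1) MC CL by blast
  have I1: "(?x,?y) \<in> I" by (rule ctx_run[OF ctx xy w1L])
  have w1v: "v \<notin> set w1" "\<And>e. e \<in> F \<Longrightarrow> e \<notin> set w1" using w1(1) vC F(1) by (auto simp: M_def)
  have nx: "\<not> net E ?x v" using w1(3)[OF par(4,1)] par(4) net_False by metis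
  have sub: "set w1 \<subseteq> (C - F) \<union> (L - C)" using w1(1) by (auto simp: M_def)
  have vF: "v \<in> (C - F) \<union> (L - C)" using vC F(1) by blast
  show ?thesis
  proof (cases "net E ?y v")
    case False
    then show ?thesis using nx w1 sub vF by (intro exI[of _ "w1 @ [v]"]) (auto simp: cM)
  next
    case ny: True
    let ?x2 = "upd E v ?x" and ?y2 = "upd E v ?y"
    have x2: "\<not> ?x2 v" "?y2 v" using nx ny by simp_all
    show ?thesis
    \<comment> \<open>A loop is a negative cycle, so its literal turns false in the second state
      once \<open>v\<close> is 1 there; the first state still has a false literal at a parent other
      than \<open>v\<close>.\<close>
    proof (cases "\<exists>b. (v,v,b) \<in> E")
      case True
      then obtain b where b: "(v,v,b) \<in> E" by blast
      have "\<not> b" using negcyc_pth[OF nc pth.arc[OF b], of "{}"] by simp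
      then have "\<not> net E ?y2 v" using x2 net_False[OF b, of ?y2] by simp
      moreover obtain q c where q: "q \<noteq> v" "(q,v,c) \<in> E" "q \<in> C" using par by metis
      then have "\<not> net E ?x2 v" using w1(3)[OF q(2,3)] net_False[OF q(2), of ?x2] by simp
      ultimately show ?thesis using w1 sub vF by (intro exI[of _ "w1 @ [v,v]"]) (auto simp: cM)
    next
      case noloop: False
      have I2: "(?x2,?y2) \<in> I" using I1 vC CL by (intro ctx_upd[OF ctx]) auto
      have y2F: "\<not> ?y2 e" if "e \<in> F" for e
        using that xF(2) w1v(2) F(1) by (subst upd_other) (auto simp: run_other)
      obtain w where w: "set w \<subseteq> M" "effective ?G w ?y2" "length w + m * ups ?G w ?y2 \<le> cost m (card M)"
        "\<And>u s. (u,v,s) \<in> E \<Longrightarrow> u \<in> C \<Longrightarrow> (run ?G w ?y2 u = s) = False"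
        using drive_word[OF nc MC(2) al[of ?y2, OF x2(2) y2F] hom, of m] by blast
      have lit: "?y2 q = c" if "(q,v,c) \<in> E" for q c
        using ny noloop that by (cases "q = v") (auto simp: net_def)
      let ?par = "\<lambda>q. q \<in> C \<and> (\<exists>c. (q,v,c) \<in> E)"
      have "p1 \<in> set w"
      proof (rule ccontr)
        assume "p1 \<notin> set w"
        then have "run ?G w ?y2 p1 = ?y2 p1" by (rule run_other)
        then show False using w(4)[OF par(4,1)] lit[OF par(4)] by blast
      qed
      then have "\<exists>q\<in>set w. ?par q" using par by blast
      \<comment> \<open>All literals at \<open>v\<close> are true in \<open>?y2\<close>, so the
        drive must change parents of \<open>v\<close>. Cutting after the first such change falsifies
        one literal there and leaves another parent, false in the first state, untouched.\<close>
      from split_list_first_prop[OF this] obtain wa p wb where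
        sp: "w = wa @ p # wb" "?par p" "\<forall>q\<in>set wa. \<not> ?par q" by blast
      let ?w = "wa @ [p]"
      have ws: "w = ?w @ wb" using sp by simp
      have eff: "effective ?G ?w ?y2" using w(2) unfolding ws effective_append by blast
      have len: "length ?w + m * ups ?G ?w ?y2 \<le> cost m (card M)"
      proof -
        have "ups ?G ?w ?y2 \<le> ups ?G w ?y2" unfolding ws ups_append by simp
        then have "m * ups ?G ?w ?y2 \<le> m * ups ?G w ?y2" by simp
        moreover have "length ?w \<le> length w" unfolding ws by simp
        ultimately show ?thesis using w(3) by linarith
      qed
      have wC: "set ?w \<subseteq> C" "set ?w \<subseteq> M" using w(1) MC unfolding ws by auto
      from lift_word[OF ctx subset_refl closed_in_self ctx_refl2[OF ctx I2] wC(1) eff] obtain w2 where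
        w2: "set w2 \<subseteq> set ?w \<union> (L - C)" "length w2 \<le> length ?w + m * ups ?G ?w ?y2"
        "\<forall>a\<in>C. run E w2 ?y2 a = run ?G ?w ?y2 a" by blast
      have w2v: "v \<notin> set w2" using w2(1) wC(2) vC by (auto simp: M_def)
      obtain c where c: "p \<in> C" "(p,v,c) \<in> E" using sp(2) by blast
      have "run ?G wa ?y2 p = ?y2 p" using sp(2,3) by (intro run_other) blast
      moreover have "net ?G (run ?G wa ?y2) p \<noteq> run ?G wa ?y2 p" using eff by (simp add: effective_append)
      ultimately have "run E w2 ?y2 p \<noteq> c" using w2(3) c lit[OF c(2)] by simp
      then have n1: "\<not> net E (run E w2 ?y2) v" using c(2) net_False by metis
      obtain q d where q: "q \<noteq> p" "q \<in> C" "(q,v,d) \<in> E" using par by metis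
      have "q \<notin> set w2" using w2(1) sp(3) q by auto
      moreover have "q \<noteq> v" using noloop q by blast
      ultimately have "run E w2 ?x2 q = ?x q" by (simp add: run_other)
      then have n2: "\<not> net E (run E w2 ?x2) v" using w1(3)[OF q(3,2)] q(3) net_False by metis
      have "set w2 \<subseteq> (C - F) \<union> (L - C)" using w2(1) wC(2) by (auto simp: M_def)
      moreover have "length (w1 @ v # w2 @ [v]) \<le> 2 * cost m (card M) + 2" using w1(2) w2(2) len by simp
      ultimately show ?thesis using sub vF n1 n2 by (intro exI[of _ "w1 @ v # w2 @ [v]"]) (auto simp: cM)
    qed
  qed
qed

text \<open>The components of the remainder that cannot be merged on their own.\<close>
definition dead :: "'v bdigraph \<Rightarrow> 'v set \<Rightarrow> 'v set set" where
  "dead E N = {K. minclo E N K \<and> branching E K = {}}"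

text \<open>The second clause lets any closed, already merged part \<open>A\<close> be driven
  towards any later vertex, to make its literals true or false at will.\<close>

definition loopable :: "'v bdigraph \<Rightarrow> 'v set \<Rightarrow> bool" where
  "loopable E N \<longleftrightarrow> (\<forall>a\<in>N. \<exists>j\<in>N. \<exists>b. (j,a,b) \<in> E) \<and>
     (\<forall>A a. A \<subseteq> N \<longrightarrow> closed_in E N A \<longrightarrow> a \<in> N - A \<longrightarrow> hom_in (restr E A) A a)"

lemma minclo_disjoint: "minclo E N K \<Longrightarrow> minclo E N K' \<Longrightarrow> K \<noteq> K' \<Longrightarrow> K \<inter> K' = {}"
proof (rule ccontr)
  assume m: "minclo E N K" "minclo E N K'" "K \<noteq> K'" "K \<inter> K' \<noteq> {}"
  then have "closed_in E N (K \<inter> K')" unfolding minclo_def closed_in_def by (meson IntD1 IntD2 IntI)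
  then have "K \<inter> K' = K" "K \<inter> K' = K'" using m unfolding minclo_def by (metis Int_lower1, metis Int_lower2)
  then show False using m(3) by simp
qed

section \<open>A chosen root, its region and the remainder\<close>

locale stage =
  fixes E :: "('v::finite) bdigraph" and C L I m v
  assumes nc: "negcyc E" and ctx: "ctx E C L I m" and st: "strong E C" and vb: "v \<in> branching E C"
    and root: "\<And>p k b x. p \<in> insert v (dominated E C v) \<Longrightarrow> k \<in> C - insert v (dominated E C v) \<Longrightarrow>
       (p,k,b) \<in> E \<Longrightarrow> synced E C (dominated E C v) x \<Longrightarrow> (x p = b) = (\<not> x v)"
begin

abbreviation "D \<equiv> dominated E C v"
definition "N = C - insert v D"
text \<open>The pairs in which the root is settled at 0: every literal from the region into the
  remainder is then true in both states.\<close>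

definition "IN = {(x,y) \<in> I. \<not> x v \<and> \<not> y v \<and> synced E C D x \<and> synced E C D y}"

lemma vC: "v \<in> C" using vb by (simp add: branching_def)
lemma CL: "C \<subseteq> L" by (rule ctx_sub[OF ctx])
lemma DC: "D \<subseteq> C - {v}" by (rule dominated_sub)
lemma rt: "rooted E C v D" by (rule dominated_rooted[OF vC])
lemma two: "C \<noteq> {a}" using vb unfolding branching_def by blast
lemma NC: "N \<subseteq> C" "v \<notin> N" "D \<inter> N = {}" by (auto simp: N_def)
lemma C_split: "C = insert v D \<union> N" using vC DC by (auto simp: N_def)
lemma D_par: "(j,u,b) \<in> E \<Longrightarrow> u \<in> D \<Longrightarrow> j \<in> C \<Longrightarrow> j \<in> insert v D"
  using rt unfolding rooted_def by blast

lemma N_par: assumes "a \<in> N" shows "\<exists>j b. j \<in> N \<and> (j,a,b) \<in> E"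
proof (rule ccontr)
  assume "\<not> ?thesis"
  then have "a \<in> D" using assms by (intro dominated.intros) (auto simp: N_def)
  then show False using assms by (simp add: N_def)
qed

lemma synced_cong: "synced E C D x \<Longrightarrow> (\<And>u. u \<in> insert v D \<Longrightarrow> y u = x u) \<Longrightarrow> synced E C D y"
  unfolding synced_def using D_par by (metis insertI2)

lemma synced_agree: "synced E C D x \<Longrightarrow> synced E C D y \<Longrightarrow> x v = y v \<Longrightarrow> u \<in> insert v D \<Longrightarrow> x u = y u"
  using rooted_value[OF st rt, of u] by metis

lemma root_lit: "synced E C D x \<Longrightarrow> (p,k,b) \<in> E \<Longrightarrow> k \<in> N \<Longrightarrow> p \<in> C \<Longrightarrow> p \<notin> N \<Longrightarrow> (x p = b) = (\<not> x v)"
  by (rule root) (auto simp: N_def)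

lemma N_exit: "(j,k,b) \<in> E \<Longrightarrow> j \<in> N \<Longrightarrow> k \<in> C \<Longrightarrow> k \<in> N \<or> k = v"
  using D_par[of j k b] NC by (auto simp: N_def)

lemma closed_in_entry:
  assumes "closed_in E N K" "K \<noteq> {}" "K \<subseteq> N"
  shows "\<exists>p e b. (p,e,b) \<in> E \<and> e \<in> K \<and> p \<in> insert v D"
proof -
  have "K \<subseteq> C" "K \<noteq> C" using assms(3) NC vC by auto
  from strongE[OF st this(1) assms(2) this(2)] obtain p e b where
    a: "(p,e,b) \<in> E" "e \<in> K" "p \<in> C" "p \<notin> K" by blast
  then have "p \<notin> N" using assms(1) unfolding closed_in_def by blast
  then show ?thesis using a C_split by blast
qed

text \<open>The literal at the entry is the negation of \<open>v\<close>, so the path from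
  \<open>v\<close> to \<open>e\<close> is negative, and closing it to a negative cycle makes the
  exit positive. An entry at 0 thus acts at the root as a false literal, which is what
  \<open>agree_root\<close> asks of \<open>F\<close>.\<close>

lemma entry_exit:
  assumes sy: "synced E C D x" and a: "(p,e,b) \<in> E" "p \<in> insert v D" "e \<in> N"
    and p: "pth E M e v s" and M: "v \<notin> M" "e \<notin> M" "M \<subseteq> C"
  shows s
proof -
  have pC: "p \<in> C" "p \<notin> N" using a(2) vC DC by (auto simp: N_def)
  have eD: "e \<notin> D" using a(3) by (simp add: N_def)
  from rooted_arc_value[OF st rt a(2,1) eD] obtain s0 where
    s0: "pth E D v e s0" "\<forall>x. synced E C D x \<longrightarrow> (x p = b) = (x v = s0)" by blast
  then have "\<not> s0" using root_lit[OF sy a(1,3) pC] sy by blast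
  have "pth E (M \<inter> N) e v s"
    by (rule pth_stay[OF p a(3)]) (use N_exit M in blast)
  then have "pth E (insert e (D \<union> (M \<inter> N))) v v (s0 = s)"
    by (rule pth_concat[OF s0(1)]) (use NC M eD in auto)
  then have "\<not> (s0 = s)" by (rule negcyc_pth[OF nc]) (use NC DC a(3) in auto)
  then show s using \<open>\<not> s0\<close> by blast
qed

text \<open>Homogeneity of the remainder comes from cycles through the root: a path from
  \<open>k\<close> to \<open>a\<close> is completed by one fixed path from \<open>v\<close> to
  \<open>k\<close> and one fixed path from \<open>a\<close> to \<open>v\<close>, and the negative
  product determines its sign.\<close>

lemma stage_loopable: "loopable E N"
  unfolding loopable_def
proof (intro conjI allI impI ballI)
  fix a assume "a \<in> N" then show "\<exists>j\<in>N. \<exists>b. (j,a,b) \<in> E" using N_par by blast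
next
  fix A a assume A: "A \<subseteq> N" "closed_in E N A" and a: "a \<in> N - A"
  have "\<exists>s. pth E (N - A - {a}) a v s"
  proof (rule strong_reach[OF st vC])
    show "k \<in> N - A \<or> k = v" if "(j,k,b) \<in> E" "j \<in> N - A" "k \<in> C" for j k b
      using N_exit[OF that(1)] that A unfolding closed_in_def by blast
  qed (use a NC in auto)
  then obtain s3 where s3: "pth E (N - A - {a}) a v s3" ..
  show "hom_in (restr E A) A a"
    unfolding hom_in_def
  proof (intro allI impI)
    fix K assume K: "K \<noteq> {}" "K \<subseteq> A" "closed_in (restr E A) UNIV K"
    have cK: "closed_in E N K" unfolding closed_in_def
    proof (intro allI impI)
      fix j k b assume j: "(j,k,b) \<in> E" "k \<in> K" "j \<in> N"
      then have "j \<in> A" using A(2) K(2) unfolding closed_in_def by blast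
      then have "(j,k,b) \<in> restr E A" using j(1) by simp
      then show "j \<in> K" using K(3) j(2) unfolding closed_in_def by blast
    qed
    from closed_in_entry[OF cK K(1)] K(2) A(1) obtain p k b where
      a1: "(p,k,b) \<in> E" "k \<in> K" "p \<in> insert v D" by blast
    have kN: "k \<in> N" "k \<in> A" "k \<notin> D" using a1 K A NC by auto
    from rooted_arc_value[OF st rt a1(3,1) kN(3)] obtain s0 where s0: "pth E D v k s0" by blast
    have "s = (s0 \<noteq> s3)" if p: "pth (restr E A) (A - {k}) k a s" for s
    proof -
      have "pth E (A - {k}) k a s" using p restr_sub by (rule pth_mono_arcs)
      then have "pth E (insert k (D \<union> (A - {k}))) v a (s0 = s)"
        by (rule pth_concat[OF s0]) (use kN NC A in auto)
      then have "pth E (insert a (insert k (D \<union> (A - {k})) \<union> (N - A - {a}))) v v ((s0 = s) = s3)"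
        by (rule pth_concat[OF _ s3]) (use kN NC A a in auto)
      then have "\<not> ((s0 = s) = s3)" by (rule negcyc_pth[OF nc]) (use NC DC A kN a in auto)
      then show ?thesis by blast
    qed
    moreover obtain j c where j: "j \<in> N" "(j,k,c) \<in> E" using N_par[OF kN(1)] by blast
    moreover have "j \<in> K" using cK j a1(2) unfolding closed_in_def by blast
    moreover have "j \<in> A" using \<open>j \<in> K\<close> K(2) by blast
    ultimately show "uniform_exit (restr E A) A a K"
      using a1(2) in_restr by metis
  qed
qed

text \<open>The budget \<open>m\<close> does not grow, since the region supplies true literals for
  free; its vertices are excluded from the letters.\<close>

lemma stage_ctx: "ctx E N (L - C \<union> N) IN m"
  unfolding ctx_def
proof (intro conjI allI impI)
  show "N \<subseteq> L - C \<union> N" by blast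
next
  fix x y assume "(x,y) \<in> IN"
  then show "(y,x) \<in> IN" "(x,x) \<in> IN" using ctx_sym[OF ctx] ctx_refl[OF ctx] by (auto simp: IN_def)
next
  fix x y i assume xy: "(x,y) \<in> IN" and i: "i \<in> L - C \<union> N"
  have iR: "i \<notin> insert v D" "i \<in> L" using i C_split NC CL by auto
  have "synced E C D (upd E i z)" if "synced E C D z" for z
    by (rule synced_cong[OF that], rule upd_other) (use iR in auto)
  moreover have "(upd E i x, upd E i y) \<in> I" using xy iR ctx_upd[OF ctx] by (simp add: IN_def)
  moreover have "v \<noteq> i" using iR by blast
  ultimately show "(upd E i x, upd E i y) \<in> IN" using xy by (simp add: IN_def)
next
  fix x y j a b assume xy: "(x,y) \<in> IN" and a: "(j,a,b) \<in> E" "a \<in> N" "j \<notin> N"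
  show "x j = y j"
  proof (cases "j \<in> C")
    case True
    then show ?thesis using synced_agree[of x y j] xy a C_split by (auto simp: IN_def)
  next
    case False
    then show ?thesis using ctx_ext[OF ctx _ a(1)] xy a(2) NC by (auto simp: IN_def)
  qed
next
  fix x a assume x: "(x,x) \<in> IN" and a: "a \<in> N"
  then have "(x,x) \<in> I" "a \<in> C" using NC by (auto simp: IN_def)
  from ctx_control[OF ctx this] obtain u where u: "set u \<subseteq> L - C" "length u \<le> m"
    "\<And>j b. (j,a,b) \<in> E \<Longrightarrow> j \<notin> C \<Longrightarrow> run E u x j = b" by blast
  have "run E u x j = b" if j: "(j,a,b) \<in> E" "j \<notin> N" for j b
  proof (cases "j \<in> C")
    case True
    then have "run E u x j = x j" using u(1) by (intro run_other) auto
    moreover have "x j = b" using root_lit[OF _ j(1) a True j(2), of x] x by (simp add: IN_def)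
    ultimately show ?thesis by simp
  qed (use u j in auto)
  then show "\<exists>u. set u \<subseteq> L - C \<union> N - N \<and> length u \<le> m \<and> (\<forall>j b. (j,a,b) \<in> E \<longrightarrow> j \<notin> N \<longrightarrow> run E u x j = b)"
    using u NC by (intro exI[of _ u]) auto
qed

definition "ent K = (SOME e. e \<in> K \<and> (\<exists>p b. (p,e,b) \<in> E \<and> p \<in> insert v D))"

lemma dead_props:
  assumes "K \<in> dead E N"
  shows "K \<subseteq> N" "K \<noteq> {}" "closed_in E N K" "strong E K" "branching E K = {}"
proof -
  have m: "minclo E N K" "branching E K = {}" using assms by (auto simp: dead_def)
  show "K \<subseteq> N" "K \<noteq> {}" "closed_in E N K" using m(1) by (auto simp: minclo_def)
  show "strong E K" "branching E K = {}" using minclo_imp_strong[OF m(1)] m(2) by auto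
qed

lemma ent:
  assumes "K \<in> dead E N"
  shows "ent K \<in> K \<and> (\<exists>p b. (p,ent K,b) \<in> E \<and> p \<in> insert v D)"
  unfolding ent_def
  by (rule someI_ex) (use closed_in_entry[of K] dead_props[OF assms] in blast)

lemma dead_parent: "K \<in> dead E N \<Longrightarrow> (j,u,b) \<in> E \<Longrightarrow> u \<in> K \<Longrightarrow> j \<in> C \<Longrightarrow> j \<notin> K \<Longrightarrow> j \<in> insert v D \<and> j \<notin> N"
  using dead_props(3)[of K] C_split NC unfolding closed_in_def by blast

text \<open>As \<open>v\<close> is 1 in \<open>x\<close>, the entry literal is false there and stays
  so. If the entry rises in \<open>y\<close>, then \<open>v\<close> is 0 in \<open>y\<close> and the
  region lets the cycle run freely; carried once round the negative cycle, the value 1 comes back as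
  a false literal.\<close>

lemma kill_one:
  assumes K: "K \<in> dead E N" and xy: "(x,y) \<in> I" "x v" "synced E C D x" "synced E C D y"
  shows "\<exists>w. set w \<subseteq> K \<union> (L - C) \<and> length w \<le> (card K + 1) * (m + 1) \<and> \<not> run E w x (ent K) \<and> \<not> run E w y (ent K)"
proof -
  define e where "e = ent K"
  note dp = dead_props[OF K]
  have KC: "K \<subseteq> C" using dp NC by blast
  obtain p b where e: "e \<in> K" "(p,e,b) \<in> E" "p \<in> insert v D" using ent[OF K] unfolding e_def by blast
  have eN: "e \<in> N" "e \<in> C" "e \<noteq> v" "e \<in> L" using e dp(1) NC CL by auto
  have pN: "p \<in> C" "p \<notin> N" "p \<noteq> e" using e(3) C_split eN by (auto simp: N_def)
  have lit: "(z p = b) = (\<not> z v)" if "synced E C D z" for z by (rule root_lit[OF that e(2) eN(1) pN(1,2)])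
  have nx: "\<not> net E x e" using lit[OF xy(3)] xy(2) net_False[OF e(2)] by blast
  show ?thesis
  proof (cases "net E y e")
    case False
    then show ?thesis using nx e(1) by (intro exI[of _ "[e]"]) (auto simp: e_def[symmetric])
  next
    case True
    then have "y p = b" using e(2) by (simp add: net_def)
    then have yv: "\<not> y v" using lit[OF xy(4)] by blast
    let ?x = "upd E e x" and ?y = "upd E e y"
    have I1: "(?x,?y) \<in> I" by (rule ctx_upd[OF ctx xy(1) eN(4)])
    have yR: "?y j = y j" if "j \<in> insert v D" for j using that eN by (intro upd_other) (auto simp: N_def)
    have s1: "synced E C D ?y" by (rule synced_cong[OF xy(4) yR])
    have I2: "(?y,?x) \<in> I" by (rule ctx_sym[OF ctx I1])
    from sync_word[OF nc ctx KC dp(4) e(1) ctx_refl[OF ctx I2]] obtain w where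
      w: "set w \<subseteq> dominated E K e \<union> (L - C)" "length w \<le> card (dominated E K e) * (m + 1)"
      "\<forall>z. (?y,z) \<in> I \<longrightarrow> (\<forall>j u b. (j,u,b) \<in> E \<longrightarrow> u \<in> dominated E K e \<longrightarrow> j \<in> C - K \<longrightarrow> z j = b)
         \<longrightarrow> synced E K (dominated E K e) (run E w z)" by blast
    have dK: "dominated E K e = K - {e}" by (rule dominated_cycle[OF dp(4,5) e(1)])
    have "?y j = b" if "(j,u,b) \<in> E" "u \<in> dominated E K e" "j \<in> C - K" for j u b
      using root_lit[OF s1 that(1), of] dead_parent[OF K that(1)] that dK dp(1) yv yR[of v] by blast
    then have s2: "synced E K (dominated E K e) (run E w ?y)"
      using w(3)[rule_format, OF ctx_refl[OF ctx I2]] by blast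
    have ye: "run E w ?y e" using True w(1) dK eN by (subst run_other) auto
    have "\<not> net E (run E w ?y) e"
    proof -
      obtain j c where j: "j \<in> K" "(j,e,c) \<in> E"
        using N_par[OF eN(1)] dp(3) e(1) unfolding closed_in_def by blast
      have "rooted E K e (dominated E K e)" by (rule dominated_rooted[OF e(1)])
      from rooted_arc_value[OF dp(4) this, of j e c] j dK obtain s where
        s: "pth E (K - {e}) e e s" "(run E w ?y j = c) = (run E w ?y e = s)" using s2 by (metis DiffI Diff_iff empty_iff insertCI insertE)
      then have "\<not> s" using negcyc_pth[OF nc] by blast
      then show ?thesis using s(2) ye j(2) net_False by metis
    qed
    moreover have "\<not> net E (run E w ?x) e"
    proof -
      have "run E w ?x p = x p" using w(1) dK pN dp(1) by (subst run_other) auto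
      then have "run E w ?x p \<noteq> b" using lit[OF xy(3)] xy(2) by simp
      then show ?thesis using e(2) by (auto dest: net_False)
    qed
    moreover have "set (e # w @ [e]) \<subseteq> K \<union> (L - C)" using w(1) dK e(1) by auto
    moreover have "length (e # w @ [e]) \<le> (card K + 1) * (m + 1)"
    proof -
      obtain k where k: "card K = Suc k" using e(1) by (metis card_Suc_Diff1 finite)
      then have "card (dominated E K e) = k" using dK e(1) by simp
      then show ?thesis using w(2) k by (simp add: algebra_simps)
    qed
    ultimately show ?thesis by (intro exI[of _ "e # w @ [e]"]) (simp add: e_def[symmetric])
  qed
qed

lemma card_Union_insert:
  assumes "insert K S \<subseteq> dead E N" "K \<notin> S"
  shows "card (\<Union>(insert K S)) = card K + card (\<Union>S)" "K \<inter> \<Union>S = {}"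
proof -
  have "K \<inter> K' = {}" if "K' \<in> S" for K'
    using assms that minclo_disjoint[of E N K K'] unfolding dead_def by blast
  then show "K \<inter> \<Union>S = {}" by blast
  then show "card (\<Union>(insert K S)) = card K + card (\<Union>S)" by (simp add: card_Un_disjoint)
qed

lemma kill_all:
  assumes xy: "(x,y) \<in> I" "x v" "synced E C D x" "synced E C D y"
  shows "S \<subseteq> dead E N \<Longrightarrow> \<exists>w. set w \<subseteq> \<Union>S \<union> (L - C) \<and> length w \<le> (card (\<Union>S) + card S) * (m + 1) \<and>
    (\<forall>K\<in>S. \<not> run E w x (ent K) \<and> \<not> run E w y (ent K))"
proof (induction rule: finite_induct[OF finite[of S]])
  case 1
  show ?case by (intro exI[of _ "[]"]) simp
next
  case (2 K S)
  from 2 obtain w where w: "set w \<subseteq> \<Union>S \<union> (L - C)" "length w \<le> (card (\<Union>S) + card S) * (m + 1)"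
    "\<forall>K\<in>S. \<not> run E w x (ent K) \<and> \<not> run E w y (ent K)" by auto
  have SN: "\<Union>S \<subseteq> N" using 2(4) dead_props(1) by blast
  have wR: "run E w z j = z j" if "j \<in> insert v D" for j z
    using that w(1) SN C_split by (intro run_other) (auto simp: N_def)
  have "set w \<subseteq> L" using w(1) SN NC CL by blast
  then have I1: "(run E w x, run E w y) \<in> I" by (rule ctx_run[OF ctx xy(1)])
  have K: "K \<in> dead E N" using 2(4) by simp
  have "run E w x v" using wR xy(2) by simp
  moreover have "synced E C D (run E w x)" "synced E C D (run E w y)"
    using synced_cong[OF xy(3), of "run E w x"] synced_cong[OF xy(4), of "run E w y"] wR by blast+
  ultimately obtain w' where
    w': "set w' \<subseteq> K \<union> (L - C)" "length w' \<le> (card K + 1) * (m + 1)"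
    "\<not> run E w' (run E w x) (ent K)" "\<not> run E w' (run E w y) (ent K)" using kill_one[OF K I1] by blast
  have "\<not> run E w' (run E w x) (ent K') \<and> \<not> run E w' (run E w y) (ent K')" if K': "K' \<in> S" for K'
  proof -
    have "K' \<in> dead E N" using K' 2(4) by blast
    then have eK': "ent K' \<in> K'" "ent K' \<in> C" using ent dead_props(1) NC by blast+
    then have "ent K' \<notin> K" using card_Union_insert(2)[OF 2(4,2)] K' by blast
    then have "ent K' \<notin> set w'" using w'(1) eK'(2) by blast
    then show ?thesis using w(3) K' by (simp add: run_other)
  qed
  moreover have "length (w @ w') \<le> (card (\<Union>(insert K S)) + card (insert K S)) * (m + 1)"
    using w(2) w'(2) 2(1,2) unfolding card_Union_insert(1)[OF 2(4,2)] by (simp add: algebra_simps)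
  moreover have "set (w @ w') \<subseteq> \<Union>(insert K S) \<union> (L - C)" using w(1) w'(1) by auto
  ultimately show ?case using w'(3,4) by (intro exI[of _ "w @ w'"]) auto
qed

text \<open>Agreement at the entry travels round its cycle with one letter for each further
  vertex.\<close>

lemma spread:
  shows "S \<subseteq> dead E N \<Longrightarrow> \<exists>w. set w \<subseteq> \<Union>S \<and> length w + card S = card (\<Union>S) \<and>
    (\<forall>x y. (x,y) \<in> I \<longrightarrow> (\<forall>u\<in>insert v D. x u = y u) \<longrightarrow> (\<forall>K\<in>S. x (ent K) = y (ent K)) \<longrightarrow>
       (\<forall>u\<in>\<Union>S. run E w x u = run E w y u))"
proof (induction rule: finite_induct[OF finite[of S]])
  case 1
  show ?case by (intro exI[of _ "[]"]) simp
next
  case (2 K S)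
  have "S \<subseteq> dead E N" using 2(4) by simp
  from 2(3)[OF this] obtain w where w: "set w \<subseteq> \<Union>S" "length w + card S = card (\<Union>S)"
    and ag: "\<forall>x y. (x,y) \<in> I \<longrightarrow> (\<forall>u\<in>insert v D. x u = y u) \<longrightarrow> (\<forall>K\<in>S. x (ent K) = y (ent K)) \<longrightarrow>
       (\<forall>u\<in>\<Union>S. run E w x u = run E w y u)" by (elim exE conjE) (rule that)
  have SN: "\<Union>S \<subseteq> N" using 2(4) dead_props(1) by blast
  have K: "K \<in> dead E N" using 2(4) by simp
  note dp = dead_props[OF K]
  have eK: "ent K \<in> K" using ent[OF K] by blast
  have dK: "dominated E K (ent K) = K - {ent K}" by (rule dominated_cycle[OF dp(4,5) eK])
  have disj: "K \<inter> \<Union>S = {}" by (rule card_Union_insert(2)[OF 2(4,2)])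
  from agree_word[of E K "ent K"] obtain w' where w': "set w' \<subseteq> K - {ent K}" "length w' = card (K - {ent K})"
    and ag': "\<forall>x y. (\<forall>j u b. (j,u,b) \<in> E \<longrightarrow> u \<in> K - {ent K} \<longrightarrow> j \<notin> K \<longrightarrow> x j = y j) \<longrightarrow> x (ent K) = y (ent K) \<longrightarrow>
      (\<forall>u\<in>K - {ent K}. run E w' x u = run E w' y u)" unfolding dK by (elim exE conjE) (rule that)
  have "run E (w @ w') x u = run E (w @ w') y u"
    if xy: "(x,y) \<in> I" "\<forall>u\<in>insert v D. x u = y u" "\<forall>K\<in>insert K S. x (ent K) = y (ent K)" and u: "u \<in> \<Union>(insert K S)" for x y u
  proof -
    let ?x = "run E w x" and ?y = "run E w y"
    have "set w \<subseteq> L" using w(1) SN NC CL by blast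
    then have I1: "(?x,?y) \<in> I" by (rule ctx_run[OF ctx xy(1)])
    have wR: "run E w z j = z j" if "j \<in> insert v D" for j z
      using that w(1) SN by (intro run_other) (auto simp: N_def)
    have wK: "run E w z j = z j" if "j \<in> K" for j z
      using that w(1) disj by (intro run_other) blast
    have eq: "?x (ent K) = ?y (ent K)" using wK[OF eK] xy(3) by simp
    have "?x j = ?y j" if a: "(j,u,b) \<in> E" "u \<in> K - {ent K}" "j \<notin> K" for j u b
    proof (cases "j \<in> C")
      case True
      then have "j \<in> insert v D" using dead_parent[OF K a(1)] a by blast
      then show ?thesis using wR[of j] xy(2) by blast
    next
      case False
      then show ?thesis using ctx_ext[OF ctx I1 a(1)] a dp(1) NC by blast
    qed
    then have *: "\<forall>u\<in>K - {ent K}. run E w' ?x u = run E w' ?y u" using ag'[THEN spec, THEN spec, of ?x ?y] eq by blast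
    show ?thesis
    proof (cases "u \<in> K")
      case True
      have "ent K \<notin> set w'" using w'(1) by blast
      then have "run E w' z (ent K) = z (ent K)" for z by (rule run_other)
      then show ?thesis using * True eq by (cases "u = ent K") auto
    next
      case False
      then have "u \<notin> set w'" using w'(1) by blast
      then have "run E w' z u = z u" for z by (rule run_other)
      moreover have "u \<in> \<Union>S" using u False by blast
      moreover have "run E w x u = run E w y u"
        using ag[THEN spec, THEN spec, of x y] xy \<open>u \<in> \<Union>S\<close> by blast
      ultimately show ?thesis by simp
    qed
  qed
  moreover have "length (w @ w') + card (insert K S) = card (\<Union>(insert K S))"
  proof -
    obtain k where k: "card K = Suc k" using eK by (metis card_Suc_Diff1 finite)
    then show ?thesis using w(2) w'(2) eK 2(1,2) unfolding card_Union_insert(1)[OF 2(4,2)] by simp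
  qed
  moreover have "set (w @ w') \<subseteq> \<Union>(insert K S)" using w(1) w'(1) by auto
  ultimately show ?case by (intro exI[of _ "w @ w'"]) simp
qed

lemma sync_all:
  assumes "(x,x) \<in> I"
  shows "\<exists>w. set w \<subseteq> D \<union> (L - C) \<and> length w \<le> card D * (m + 1) \<and> (\<forall>y. (x,y) \<in> I \<longrightarrow> synced E C D (run E w y))"
proof -
  from sync_word[OF nc ctx subset_refl st vC assms] show ?thesis by auto
qed

lemma stage_final:
  assumes xy: "(x,y) \<in> I" "\<not> x v" "\<not> y v" "\<forall>K\<in>dead E N. x (ent K) = y (ent K)"
  shows "\<exists>w. set w \<subseteq> L \<and> length w + card (dead E N) \<le> card D * (m + 1) + card (\<Union>(dead E N)) \<and>
    (run E w x, run E w y) \<in> IN \<and> (\<forall>u\<in>insert v D \<union> \<Union>(dead E N). run E w x u = run E w y u)"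
proof -
  from sync_all[OF ctx_refl[OF ctx xy(1)]] obtain w1 where w1: "set w1 \<subseteq> D \<union> (L - C)"
    "length w1 \<le> card D * (m + 1)" "\<forall>z. (x,z) \<in> I \<longrightarrow> synced E C D (run E w1 z)" by blast
  let ?x = "run E w1 x" and ?y = "run E w1 y"
  have w1L: "set w1 \<subseteq> L" using w1(1) DC CL by blast
  have I1: "(?x,?y) \<in> I" by (rule ctx_run[OF ctx xy(1) w1L])
  have s1: "synced E C D ?x" "synced E C D ?y" using w1(3) xy(1) ctx_refl[OF ctx xy(1)] by blast+
  have w1o: "run E w1 z u = z u" if "u \<in> insert v N" for z u
    using that w1(1) NC vC DC by (intro run_other) auto
  have v1: "\<not> ?x v" "\<not> ?y v" using w1o xy by auto
  have agR: "\<forall>u\<in>insert v D. ?x u = ?y u" using synced_agree[OF s1] v1 by blast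
  have agE: "\<forall>K\<in>dead E N. ?x (ent K) = ?y (ent K)"
  proof
    fix K assume K: "K \<in> dead E N"
    then have "ent K \<in> insert v N" using ent dead_props(1) by blast
    then show "?x (ent K) = ?y (ent K)" using w1o xy(4) K by simp
  qed
  from spread[OF subset_refl] obtain w2 where w2: "set w2 \<subseteq> \<Union>(dead E N)"
    "length w2 + card (dead E N) = card (\<Union>(dead E N))"
    "\<forall>x y. (x,y) \<in> I \<longrightarrow> (\<forall>u\<in>insert v D. x u = y u) \<longrightarrow> (\<forall>K\<in>dead E N. x (ent K) = y (ent K)) \<longrightarrow>
       (\<forall>u\<in>\<Union>(dead E N). run E w2 x u = run E w2 y u)" by (elim exE conjE) (rule that)
  have ag: "\<forall>u\<in>\<Union>(dead E N). run E w2 ?x u = run E w2 ?y u"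
    using w2(3)[THEN spec, THEN spec, of ?x ?y] I1 agR agE by blast
  have w2N: "set w2 \<subseteq> N" using w2(1) dead_props(1) by blast
  have w2o: "run E w2 z u = z u" if "u \<in> insert v D" for z u
    using that w2N NC by (intro run_other) auto
  have "synced E C D (run E w2 ?x)" "synced E C D (run E w2 ?y)"
    using synced_cong[OF s1(1), of "run E w2 ?x"] synced_cong[OF s1(2), of "run E w2 ?y"] w2o by blast+
  moreover have "set w2 \<subseteq> L" using w2N NC CL by blast
  moreover from this have "(run E w2 ?x, run E w2 ?y) \<in> I" by (rule ctx_run[OF ctx I1])
  moreover have "\<not> run E w2 ?x v" "\<not> run E w2 ?y v" using w2o v1 by auto
  ultimately show ?thesis
    using w1L w1(2) w2(2) ag agR w2o by (intro exI[of _ "w1 @ w2"]) (auto simp: IN_def)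
qed

lemma agree_root_sym:
  assumes F: "F \<subseteq> C - {v}" "\<forall>e\<in>F. \<forall>s. pth E (C - {v} - F) e v s \<longrightarrow> s"
    and xy: "(x,y) \<in> I" and xv: "x v \<or> y v" and xF: "\<forall>e\<in>F. \<not> x e \<and> \<not> y e"
  shows "\<exists>w. set w \<subseteq> (C - F) \<union> (L - C) \<and> length w \<le> 2 * cost m (card C - 1 - card F) + 2
     \<and> \<not> run E w x v \<and> \<not> run E w y v"
proof (cases "x v")
  case True
  show ?thesis
    by (rule agree_root[OF nc ctx st vb F(1) _ xy True]) (use F(2) xF in blast)+
next
  case False
  then have yv: "y v" using xv by blast
  have "\<exists>w. set w \<subseteq> (C - F) \<union> (L - C) \<and> length w \<le> 2 * cost m (card C - 1 - card F) + 2
     \<and> \<not> run E w y v \<and> \<not> run E w x v"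
    by (rule agree_root[OF nc ctx st vb F(1) _ ctx_sym[OF ctx xy] yv]) (use F(2) xF in blast)+
  then show ?thesis by blast
qed

lemma stage_word0:
  assumes de: "dead E N = {}" and xy: "(x,y) \<in> I"
  shows "\<exists>w. set w \<subseteq> L \<and> length w \<le> 2 * cost m (card C - 1) + 2 + card D * (m + 1) \<and>
    (run E w x, run E w y) \<in> IN \<and> (\<forall>u\<in>insert v D \<union> \<Union>(dead E N). run E w x u = run E w y u)"
proof -
  have "\<exists>w. set w \<subseteq> C \<union> (L - C) \<and> length w \<le> 2 * cost m (card C - 1) + 2 \<and> \<not> run E w x v \<and> \<not> run E w y v"
  proof (cases "x v \<or> y v")
    case True
    from agree_root_sym[OF _ _ xy True, of "{}"] show ?thesis by simp
  next
    case False
    then show ?thesis by (intro exI[of _ "[]"]) simp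
  qed
  then obtain w1 where w1: "set w1 \<subseteq> L" "length w1 \<le> 2 * cost m (card C - 1) + 2"
    "\<not> run E w1 x v" "\<not> run E w1 y v" using CL by blast
  from stage_final[OF ctx_run[OF ctx xy w1(1)] w1(3,4)] de obtain w2 where
    "set w2 \<subseteq> L" "length w2 \<le> card D * (m + 1)" "(run E w2 (run E w1 x), run E w2 (run E w1 y)) \<in> IN"
    "\<forall>u\<in>insert v D \<union> \<Union>(dead E N). run E w2 (run E w1 x) u = run E w2 (run E w1 y) u" by auto
  then show ?thesis using w1 by (intro exI[of _ "w1 @ w2"]) auto
qed

text \<open>\<open>kill_all\<close> needs the root at 1 in one of the states. If it is 0 in
  \<open>x\<close>, negative cycles allow the rest of \<open>C\<close> to be driven so that all
  literals at the root become true.\<close>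

lemma raise_root:
  assumes xy: "(x,y) \<in> I"
  shows "\<exists>w. set w \<subseteq> L \<and> length w \<le> cost m (card C - 1) + (m + 1) \<and> (run E w x v \<or> run E w y v)"
proof (cases "x v \<or> y v")
  case True
  then show ?thesis by (intro exI[of _ "[]"]) simp
next
  case False
  define M where "M = C - {v}"
  have MC: "M \<subseteq> C" "v \<notin> M" "M \<subset> C" "C = insert v M" using vC by (auto simp: M_def)
  have cM: "card M = card C - 1" using vC by (simp add: M_def)
  have "hom_in (restr E C) M v" by (rule minclo_hom_in[OF st[unfolded strong_def] MC(3)])
  moreover have "aligned (restr E C) M v True x" using cycle_aligned[OF nc MC(4,2), of x] False by simp
  ultimately obtain w1 where w1: "set w1 \<subseteq> M \<union> (L - C)" "length w1 \<le> cost m (card M)"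
    "\<And>u s. (u,v,s) \<in> E \<Longrightarrow> u \<in> C \<Longrightarrow> (run E w1 x u = s) = True"
    using drive[OF nc ctx subset_refl closed_in_self ctx_refl[OF ctx xy] MC(1,2), of True] by blast
  have w1L: "set w1 \<subseteq> L" using w1(1) MC CL by blast
  from ctx_control[OF ctx ctx_run[OF ctx ctx_refl[OF ctx xy] w1L] vC] obtain u where
    u: "set u \<subseteq> L - C" "length u \<le> m" "\<And>j b. (j,v,b) \<in> E \<Longrightarrow> j \<notin> C \<Longrightarrow> run E u (run E w1 x) j = b" by blast
  have "run E u (run E w1 x) j = b" if "(j,v,b) \<in> E" for j b
  proof (cases "j \<in> C")
    case True
    then have "run E u (run E w1 x) j = run E w1 x j" using u(1) by (intro run_other) auto
    then show ?thesis using w1(3)[OF that True] by simp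
  qed (use u that in auto)
  then have "net E (run E u (run E w1 x)) v" by (simp add: net_def)
  then show ?thesis using w1L w1(2) u vC CL cM by (intro exI[of _ "w1 @ u @ [v]"]) auto
qed

text \<open>Dead cycles cost an extra drive to raise the root and the reset of their entries. In
  return the entries are kept at 0 and drop out of the two drives that lower the root.\<close>

lemma stage_word1:
  assumes xy: "(x,y) \<in> I"
  shows "\<exists>w. set w \<subseteq> L \<and> length w + card (dead E N) \<le> cost m (card C - 1) + (m + 1) + card D * (m + 1)
      + (card (\<Union>(dead E N)) + card (dead E N)) * (m + 1) + (2 * cost m (card C - 1 - card (dead E N)) + 2)
      + (card D * (m + 1) + card (\<Union>(dead E N))) \<and>
    (run E w x, run E w y) \<in> IN \<and> (\<forall>u\<in>insert v D \<union> \<Union>(dead E N). run E w x u = run E w y u)"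
proof -
  let ?K = "dead E N"
  from raise_root[OF xy] obtain w1 where w1: "set w1 \<subseteq> L" "length w1 \<le> cost m (card C - 1) + (m + 1)"
    "run E w1 x v \<or> run E w1 y v" by blast
  define x1 y1 where "x1 = run E w1 x" and "y1 = run E w1 y"
  have I1: "(x1,y1) \<in> I" unfolding x1_def y1_def by (rule ctx_run[OF ctx xy w1(1)])
  from sync_all[OF ctx_refl[OF ctx I1]] obtain w2 where w2: "set w2 \<subseteq> D \<union> (L - C)"
    "length w2 \<le> card D * (m + 1)" "\<forall>z. (x1,z) \<in> I \<longrightarrow> synced E C D (run E w2 z)" by blast
  define x2 y2 where "x2 = run E w2 x1" and "y2 = run E w2 y1"
  have w2L: "set w2 \<subseteq> L" using w2(1) DC CL by blast
  have I2: "(x2,y2) \<in> I" unfolding x2_def y2_def by (rule ctx_run[OF ctx I1 w2L])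
  have s2: "synced E C D x2" "synced E C D y2"
    using w2(3) I1 ctx_refl[OF ctx I1] unfolding x2_def y2_def by blast+
  have "v \<notin> set w2" using w2(1) vC DC by auto
  then have v2: "x2 v \<or> y2 v" using w1(3) unfolding x2_def y2_def x1_def y1_def by (simp add: run_other)
  have "\<exists>w. set w \<subseteq> \<Union>?K \<union> (L - C) \<and> length w \<le> (card (\<Union>?K) + card ?K) * (m + 1) \<and>
    (\<forall>K\<in>?K. \<not> run E w x2 (ent K) \<and> \<not> run E w y2 (ent K))"
  proof (cases "x2 v")
    case True
    then show ?thesis using kill_all[OF I2 _ s2 subset_refl] by blast
  next
    case False
    then show ?thesis using v2 kill_all[OF ctx_sym[OF ctx I2] _ s2(2,1) subset_refl] by blast
  qed
  then obtain w3 where w3: "set w3 \<subseteq> \<Union>?K \<union> (L - C)" "length w3 \<le> (card (\<Union>?K) + card ?K) * (m + 1)"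
    "\<forall>K\<in>?K. \<not> run E w3 x2 (ent K) \<and> \<not> run E w3 y2 (ent K)" by blast
  define x3 y3 where "x3 = run E w3 x2" and "y3 = run E w3 y2"
  have KN: "\<Union>?K \<subseteq> N" using dead_props(1) by blast
  have w3L: "set w3 \<subseteq> L" using w3(1) KN NC CL by blast
  have I3: "(x3,y3) \<in> I" unfolding x3_def y3_def by (rule ctx_run[OF ctx I2 w3L])
  have w3R: "run E w3 z j = z j" if "j \<in> insert v D" for j z
    using that w3(1) KN NC vC DC by (intro run_other) blast
  have v3: "x3 v \<or> y3 v" using v2 w3R unfolding x3_def y3_def by simp
  have s3: "synced E C D x3" using synced_cong[OF s2(1), of x3] w3R unfolding x3_def by blast
  define F where "F = ent ` ?K"
  have inj: "inj_on ent ?K"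
  proof (rule inj_onI)
    fix K K' assume K: "K \<in> ?K" "K' \<in> ?K" "ent K = ent K'"
    then have "ent K \<in> K \<inter> K'" using ent by (metis IntI)
    then show "K = K'" using minclo_disjoint[of E N K K'] K unfolding dead_def by blast
  qed
  have cF: "card F = card ?K" unfolding F_def by (rule card_image[OF inj])
  have FN: "F \<subseteq> N" using ent dead_props(1) unfolding F_def by blast
  have F1: "F \<subseteq> C - {v}" using FN NC by blast
  have F2: "\<forall>e\<in>F. \<forall>s. pth E (C - {v} - F) e v s \<longrightarrow> s"
  proof (intro ballI allI impI)
    fix e s assume e: "e \<in> F" and p: "pth E (C - {v} - F) e v s"
    obtain K where K: "K \<in> ?K" "e = ent K" using e unfolding F_def by blast
    obtain p b where a: "(p,e,b) \<in> E" "p \<in> insert v D" using ent[OF K(1)] K(2) by blast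
    have eN: "e \<in> N" using e FN by blast
    show s by (rule entry_exit[OF s3 a eN p]) (use e in auto)
  qed
  have F3: "\<forall>e\<in>F. \<not> x3 e \<and> \<not> y3 e" using w3(3) unfolding F_def x3_def y3_def by blast
  from agree_root_sym[OF F1 F2 I3 v3 F3] obtain w4 where
    w4: "set w4 \<subseteq> (C - F) \<union> (L - C)" "length w4 \<le> 2 * cost m (card C - 1 - card ?K) + 2"
    "\<not> run E w4 x3 v" "\<not> run E w4 y3 v" unfolding cF by blast
  define x4 y4 where "x4 = run E w4 x3" and "y4 = run E w4 y3"
  have w4L: "set w4 \<subseteq> L" using w4(1) CL by blast
  have I4: "(x4,y4) \<in> I" unfolding x4_def y4_def by (rule ctx_run[OF ctx I3 w4L])
  have "x4 (ent K) = y4 (ent K)" if "K \<in> ?K" for K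
  proof -
    have "ent K \<in> F" using that by (simp add: F_def)
    then have "ent K \<notin> set w4" using w4(1) F1 by blast
    then show ?thesis using F3 \<open>ent K \<in> F\<close> unfolding x4_def y4_def by (simp add: run_other)
  qed
  then have "\<forall>K\<in>?K. x4 (ent K) = y4 (ent K)" by blast
  from stage_final[OF I4 _ _ this] w4(3,4) obtain w5 where w5: "set w5 \<subseteq> L"
    "length w5 + card ?K \<le> card D * (m + 1) + card (\<Union>?K)" "(run E w5 x4, run E w5 y4) \<in> IN"
    "\<forall>u\<in>insert v D \<union> \<Union>?K. run E w5 x4 u = run E w5 y4 u" unfolding x4_def y4_def by blast
  let ?w = "w1 @ w2 @ w3 @ w4 @ w5"
  have "run E ?w x = run E w5 x4" "run E ?w y = run E w5 y4"
    by (simp_all add: x4_def y4_def x3_def y3_def x2_def y2_def x1_def y1_def)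
  moreover have "set ?w \<subseteq> L" using w1(1) w2L w3L w4L w5(1) by simp
  moreover have "length ?w + card ?K \<le> cost m (card C - 1) + (m + 1) + card D * (m + 1)
      + (card (\<Union>?K) + card ?K) * (m + 1) + (2 * cost m (card C - 1 - card ?K) + 2)
      + (card D * (m + 1) + card (\<Union>?K))" using w1(2) w2(2) w3(2) w4(2) w5(2) by (simp only: length_append)
  ultimately show ?thesis using w5(3,4) by metis
qed

end

section \<open>Merging component by component\<close>

lemma ctx_agree_run:
  assumes ctx: "ctx E C L I m"
  shows "(x,y) \<in> I \<Longrightarrow> set w \<subseteq> L \<Longrightarrow> \<forall>a\<in>C. x a = y a \<Longrightarrow> \<forall>a\<in>C. run E w x a = run E w y a"
proof (induction w arbitrary: x y)
  case (Cons i w)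
  have I': "(upd E i x, upd E i y) \<in> I" using Cons.prems by (intro ctx_upd[OF ctx]) auto
  have "upd E i x a = upd E i y a" if a: "a \<in> C" for a
  proof (cases "a = i")
    case True
    have "x j = y j" if "(j,i,b) \<in> E" for j b
      using Cons.prems(3) ctx_ext[OF ctx Cons.prems(1) that] a True by blast
    then have "net E x i = net E y i" unfolding net_def by blast
    then show ?thesis using True by simp
  qed (use a Cons.prems in auto)
  then show ?case using Cons.IH[OF I'] Cons.prems(2) by simp
qed simp

text \<open>Components are synchronized in topological order; the agreed part \<open>A\<close> then serves to control
  (\<open>sub_ctx\<close>) or to veto the literals entering the next component.\<close>
lemma sub_ctx:
  fixes E :: "('v::finite) bdigraph"
  assumes nc: "negcyc E" and ctx: "ctx E N L I m" and lp: "loopable E N"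
    and A: "A \<subseteq> N" "closed_in E N A" and C: "minclo E (N - A) C"
  shows "ctx E C (L - N \<union> A \<union> C) {(x,y) \<in> I. \<forall>a\<in>A. x a = y a} (m + cost m (card A))"
proof -
  have CN: "C \<subseteq> N - A" "closed_in E (N - A) C" using C by (auto simp: minclo_def)
  have NL: "N \<subseteq> L" by (rule ctx_sub[OF ctx])
  have par: "j \<in> A \<or> j \<notin> N" if "(j,a,b) \<in> E" "a \<in> C" "j \<notin> C" for j a b
    using CN(2) that unfolding closed_in_def by blast
  show ?thesis
    unfolding ctx_def
  proof (intro conjI allI impI)
    show "C \<subseteq> L - N \<union> A \<union> C" by blast
  next
    fix x y assume "(x,y) \<in> {(x,y) \<in> I. \<forall>a\<in>A. x a = y a}"
    then show "(y,x) \<in> {(x,y) \<in> I. \<forall>a\<in>A. x a = y a}" "(x,x) \<in> {(x,y) \<in> I. \<forall>a\<in>A. x a = y a}"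
      using ctx_sym[OF ctx] ctx_refl[OF ctx] by auto
  next
    fix x y i assume xy: "(x,y) \<in> {(x,y) \<in> I. \<forall>a\<in>A. x a = y a}" and i: "i \<in> L - N \<union> A \<union> C"
    have iL: "i \<in> L" using i A CN NL by blast
    have "upd E i x a = upd E i y a" if a: "a \<in> A" for a
    proof (cases "a = i")
      case True
      have "x j = y j" if "(j,i,b) \<in> E" for j b
      proof (cases "j \<in> N")
        case True
        then have "j \<in> A" using A(2) a that \<open>a = i\<close> unfolding closed_in_def by blast
        then show ?thesis using xy by blast
      next
        case False
        then show ?thesis using ctx_ext[OF ctx _ that] xy a A True by blast
      qed
      then have "net E x i = net E y i" unfolding net_def by blast
      then show ?thesis using True by simp
    qed (use a xy in auto)
    then show "(upd E i x, upd E i y) \<in> {(x,y) \<in> I. \<forall>a\<in>A. x a = y a}"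
      using ctx_upd[OF ctx _ iL] xy by blast
  next
    fix x y j a b assume "(x,y) \<in> {(x,y) \<in> I. \<forall>a\<in>A. x a = y a}" "(j,a,b) \<in> E" "a \<in> C" "j \<notin> C"
    then show "x j = y j" using par[of j a b] ctx_ext[OF ctx, of x y j a b] CN by blast
  next
    fix x a assume x: "(x,x) \<in> {(x,y) \<in> I. \<forall>a\<in>A. x a = y a}" and a: "a \<in> C"
    have aN: "a \<in> N - A" "a \<in> N" "a \<notin> A" using a CN by auto
    have xI: "(x,x) \<in> I" using x by blast
    have "aligned (restr E A) A a True x" unfolding aligned_def by (blast dest: pth_restr)
    moreover have "hom_in (restr E A) A a" using lp A aN unfolding loopable_def by blast
    ultimately obtain w where w: "set w \<subseteq> A \<union> (L - N)" "length w \<le> cost m (card A)"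
      "\<And>v s. (v,a,s) \<in> E \<Longrightarrow> v \<in> A \<Longrightarrow> (run E w x v = s) = True"
      using drive[OF nc ctx A xI subset_refl aN(3), of True] by blast
    have "set w \<subseteq> L" using w(1) A NL by blast
    from ctx_control[OF ctx ctx_run[OF ctx xI this] aN(2)] obtain u where
      u: "set u \<subseteq> L - N" "length u \<le> m" "\<And>j b. (j,a,b) \<in> E \<Longrightarrow> j \<notin> N \<Longrightarrow> run E u (run E w x) j = b" by blast
    have "run E (w @ u) x j = b" if j: "(j,a,b) \<in> E" "j \<notin> C" for j b
    proof (cases "j \<in> A")
      case True
      then have "run E u (run E w x) j = run E w x j" using u(1) A(1) by (intro run_other) blast
      then show ?thesis using w(3)[OF j(1) True] by simp
    next
      case False
      then show ?thesis using par[OF j(1) a j(2)] u(3)[OF j(1)] by simp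
    qed
    moreover have "set (w @ u) \<subseteq> L - N \<union> A \<union> C - C" using w(1) u(1) CN A by auto
    moreover have "length (w @ u) \<le> m + cost m (card A)" using w(2) u(2) by simp
    ultimately show "\<exists>u. set u \<subseteq> L - N \<union> A \<union> C - C \<and> length u \<le> m + cost m (card A) \<and>
      (\<forall>j b. (j,a,b) \<in> E \<longrightarrow> j \<notin> C \<longrightarrow> run E u x j = b)" by blast
  qed
qed

text \<open>The drive of \<open>A\<close> is computed for one state but falsifies the entering
  literal in all of them, because they agree on \<open>A\<close> and continue to. So
  \<open>a\<close> becomes 0 everywhere, and agreement spreads along the cycle.\<close>

lemma veto_cycle:
  fixes E :: "('v::finite) bdigraph"
  assumes nc: "negcyc E" and ctx: "ctx E N L I m" and lp: "loopable E N"
    and A: "A \<subseteq> N" "closed_in E N A" and C: "minclo E (N - A) C" and nb: "branching E C = {}"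
    and arc: "(j,a,b) \<in> E" "j \<in> A" "a \<in> C" and X: "\<forall>x\<in>X. \<forall>y\<in>X. (x,y) \<in> I \<and> (\<forall>a\<in>A. x a = y a)"
  shows "\<exists>w. set w \<subseteq> L - N \<union> A \<union> C \<and> length w \<le> cost m (card A) + card C \<and>
    (merges E w X C)"
proof (cases "X = {}")
  case True
  then show ?thesis by (intro exI[of _ "[]"]) simp
next
  case False
  then obtain x0 where x0: "x0 \<in> X" by blast
  let ?I = "{(x,y) \<in> I. \<forall>a\<in>A. x a = y a}" and ?L = "L - N \<union> A \<union> C"
  note sc = sub_ctx[OF nc ctx lp A C]
  have CN: "C \<subseteq> N - A" "closed_in E (N - A) C" using C by (auto simp: minclo_def)
  have NL: "N \<subseteq> L" by (rule ctx_sub[OF ctx])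
  have aN: "a \<in> N - A" "a \<notin> A" using arc(3) CN by auto
  have "aligned (restr E A) A a False x0" unfolding aligned_def by (blast dest: pth_restr)
  moreover have "hom_in (restr E A) A a" using lp A aN unfolding loopable_def by blast
  moreover have "(x0,x0) \<in> I" using X x0 by blast
  ultimately obtain w where w: "set w \<subseteq> A \<union> (L - N)" "length w \<le> cost m (card A)"
    "\<And>v s. (v,a,s) \<in> E \<Longrightarrow> v \<in> A \<Longrightarrow> (run E w x0 v = s) = False"
    using drive[OF nc ctx A _ subset_refl aN(2), of x0 False] by blast
  have dC: "dominated E C a = C - {a}" by (rule dominated_cycle[OF minclo_imp_strong[OF C] nb arc(3)])
  from agree_word[of E C a] obtain w' where w': "set w' \<subseteq> C - {a}" "length w' = card (C - {a})"
    and ag: "\<forall>x y. (\<forall>j u b. (j,u,b) \<in> E \<longrightarrow> u \<in> C - {a} \<longrightarrow> j \<notin> C \<longrightarrow> x j = y j) \<longrightarrow> x a = y a \<longrightarrow>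
      (\<forall>u\<in>C - {a}. run E w' x u = run E w' y u)" unfolding dC by (elim exE conjE) (rule that)
  have wL: "set (w @ [a]) \<subseteq> ?L" using w(1) arc(3) by auto
  have "run E (w @ a # w') x c = run E (w @ a # w') y c" if xy: "x \<in> X" "y \<in> X" and c: "c \<in> C" for x y c
  proof -
    let ?x = "run E (w @ [a]) x" and ?y = "run E (w @ [a]) y"
    have F: "\<not> run E (w @ [a]) z a" if z: "z \<in> X" for z
    proof -
      have "(run E w x0, run E w z) \<in> ?I"
        by (rule ctx_run[OF sc]) (use X x0 z wL in auto)
      then have "run E w z j = run E w x0 j" using arc(2) by simp
      then have "\<not> net E (run E w z) a" using w(3)[OF arc(1,2)] net_False[OF arc(1), of "run E w z"] by simp
      then show ?thesis by simp
    qed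
    have I1: "(?x,?y) \<in> ?I" by (rule ctx_run[OF sc _ wL]) (use X xy in auto)
    have "?x i = ?y i" if "(i,u,d) \<in> E" "u \<in> C - {a}" "i \<notin> C" for i u d
      using ctx_ext[OF sc I1 that(1)] that by blast
    moreover have eq: "?x a = ?y a" using F xy by blast
    ultimately have *: "\<forall>u\<in>C - {a}. run E w' ?x u = run E w' ?y u" using ag[THEN spec, THEN spec, of ?x ?y] by blast
    have "run E w' z a = z a" for z using w'(1) by (intro run_other) blast
    then show ?thesis using * eq c by (cases "c = a") auto
  qed
  moreover have "set (w @ a # w') \<subseteq> ?L" using wL w'(1) by auto
  moreover have "length (w @ a # w') \<le> cost m (card A) + card C"
  proof -
    have "card C = Suc (card (C - {a}))" using arc(3) by (metis card_Suc_Diff1 finite)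
    then show ?thesis using w(2) w'(2) by simp
  qed
  ultimately show ?thesis by (intro exI[of _ "w @ a # w'"]) blast
qed

text \<open>\<open>h\<close> is a potential: a component of size \<open>c\<close> merged after
  \<open>z\<close> vertices is charged \<open>h (z + c) - h z\<close>, so the charges telescope.
  \<open>Q\<close> describes the sets of states that \<open>merge\<close> handles: pairs inside a
  stage, arbitrary sets at the top.\<close>

lemma component_loop:
  fixes E :: "('v::finite) bdigraph" and h :: "nat \<Rightarrow> real" and Mg :: "nat \<Rightarrow> nat \<Rightarrow> real"
  assumes nc: "negcyc E" and ctx: "ctx E N L I m" and lp: "loopable E N"
    and Q: "\<And>w X. Q X \<Longrightarrow> Q (run E w ` X)"
    and merge: "\<And>C L' I' m' X. C \<subseteq> N \<Longrightarrow> strong E C \<Longrightarrow> branching E C \<noteq> {} \<Longrightarrow> ctx E C L' I' m' \<Longrightarrow> Q X \<Longrightarrow>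
      \<forall>x\<in>X. \<forall>y\<in>X. (x,y) \<in> I' \<Longrightarrow> \<exists>w. set w \<subseteq> L' \<and> real (length w) \<le> Mg (card C) m' \<and>
        (merges E w X C)"
    and h1: "\<And>z c. 2 \<le> c \<Longrightarrow> Mg c (m + cost m z) \<le> h (z + c) - h z"
    and h2: "\<And>z c. 1 \<le> c \<Longrightarrow> real (cost m z + c) \<le> h (z + c) - h z"
  shows "A \<subseteq> N \<Longrightarrow> closed_in E N A \<Longrightarrow> \<forall>K\<in>dead E N. K \<subseteq> A \<Longrightarrow> Q X \<Longrightarrow>
    \<forall>x\<in>X. \<forall>y\<in>X. (x,y) \<in> I \<and> (\<forall>a\<in>A. x a = y a) \<Longrightarrow>
    \<exists>w. set w \<subseteq> L \<and> real (length w) \<le> h (card N) - h (card A) \<and>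
      (merges E w X N)"
proof (induction "card (N - A)" arbitrary: A X rule: less_induct)
  case less
  note A = less.prems(1,2) and dA = less.prems(3) and QX = less.prems(4) and X = less.prems(5)
  show ?case
  proof (cases "N - A = {}")
    case True
    then have "A = N" using A by blast
    then show ?thesis using X by (intro exI[of _ "[]"]) auto
  next
    case False
    obtain C where C: "minclo E (N - A) C" using minclo_ex[OF False subset_refl closed_in_self] .
    have CN: "C \<subseteq> N - A" "C \<noteq> {}" "closed_in E (N - A) C" using C by (auto simp: minclo_def)
    have stC: "strong E C" by (rule minclo_imp_strong[OF C])
    have NL: "N \<subseteq> L" by (rule ctx_sub[OF ctx])
    have LL: "L - N \<union> A \<union> C \<subseteq> L" using NL A CN by blast
    note sc = sub_ctx[OF nc ctx lp A C]
    have "\<exists>w. set w \<subseteq> L - N \<union> A \<union> C \<and> real (length w) \<le> h (card A + card C) - h (card A) \<and>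
      (merges E w X C)"
    proof (cases "branching E C = {}")
      case True
      \<comment> \<open>A cycle without an arc from \<open>A\<close> is already minimal closed in
        \<open>N\<close>, hence dead and part of \<open>A\<close>.\<close>
      have "\<exists>j a b. (j,a,b) \<in> E \<and> j \<in> A \<and> a \<in> C"
      proof (rule ccontr)
        assume no: "\<not> ?thesis"
        have cl: "closed_in E N C" using CN(3) no unfolding closed_in_def by blast
        have "B = C" if B: "B \<subseteq> C" "B \<noteq> {}" "closed_in E N B" for B
        proof -
          have "closed_in E (N - A) B" using B(3) unfolding closed_in_def by blast
          then show ?thesis using C B unfolding minclo_def by blast
        qed
        then have "minclo E N C" using CN cl unfolding minclo_def by blast
        then have "C \<in> dead E N" using True by (simp add: dead_def)
        then show False using dA CN by blast
      qed
      then obtain j a b where "(j,a,b) \<in> E" "j \<in> A" "a \<in> C" by blast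
      from veto_cycle[OF nc ctx lp A C True this X] obtain w where
        w: "set w \<subseteq> L - N \<union> A \<union> C" "length w \<le> cost m (card A) + card C"
        "merges E w X C" by blast
      have "1 \<le> card C" using CN(2) by (simp add: Suc_leI card_gt_0_iff)
      have "real (length w) \<le> real (cost m (card A) + card C)" using w(2) by (simp only: of_nat_le_iff)
      also have "\<dots> \<le> h (card A + card C) - h (card A)" by (rule h2) fact
      finally show ?thesis using w(1,3) by (intro exI[of _ w] conjI)
    next
      case False
      have "C \<subseteq> N" using CN by blast
      moreover have "\<forall>x\<in>X. \<forall>y\<in>X. (x,y) \<in> {(x,y) \<in> I. \<forall>a\<in>A. x a = y a}" using X by blast
      ultimately obtain w where
        w: "set w \<subseteq> L - N \<union> A \<union> C" "real (length w) \<le> Mg (card C) (m + cost m (card A))"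
        "merges E w X C"
        by (rule merge[OF _ stC False sc QX, THEN exE]) blast
      from False obtain p q where pq: "p \<in> C" "q \<in> C" "p \<noteq> q" unfolding branching_def by blast
      then have "card {p,q} \<le> card C" by (intro card_mono) auto
      then have "2 \<le> card C" using pq by simp
      from h1[OF this, of "card A"] have "real (length w) \<le> h (card A + card C) - h (card A)" using w(2) by linarith
      then show ?thesis using w(1,3) by (intro exI[of _ w] conjI)
    qed
    then obtain w where w: "set w \<subseteq> L - N \<union> A \<union> C" "real (length w) \<le> h (card A + card C) - h (card A)"
      "merges E w X C" by blast
    have c: "card (A \<union> C) = card A + card C" using CN(1) by (intro card_Un_disjoint) auto
    have "\<exists>w'. set w' \<subseteq> L \<and> real (length w') \<le> h (card N) - h (card (A \<union> C)) \<and>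
      (merges E w' (run E w ` X) N)"
    proof (rule less.hyps)
      show "card (N - (A \<union> C)) < card (N - A)" by (rule psubset_card_mono) (use CN in auto)
      show "A \<union> C \<subseteq> N" using A CN by blast
      show "closed_in E N (A \<union> C)" using A(2) CN(3) unfolding closed_in_def by blast
      show "\<forall>K\<in>dead E N. K \<subseteq> A \<union> C" using dA by blast
      show "Q (run E w ` X)" by (rule Q[OF QX])
      show "\<forall>x\<in>run E w ` X. \<forall>y\<in>run E w ` X. (x,y) \<in> I \<and> (\<forall>a\<in>A \<union> C. x a = y a)"
      proof (intro ballI)
        fix x' y' assume "x' \<in> run E w ` X" "y' \<in> run E w ` X"
        then obtain x y where xy: "x \<in> X" "y \<in> X" "x' = run E w x" "y' = run E w y" by blast
        have "(x',y') \<in> {(x,y) \<in> I. \<forall>a\<in>A. x a = y a}"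
          unfolding xy(3,4) by (rule ctx_run[OF sc]) (use X xy w in auto)
        then show "(x',y') \<in> I \<and> (\<forall>a\<in>A \<union> C. x' a = y' a)" using w(3) xy by blast
      qed
    qed
    then obtain w' where w': "set w' \<subseteq> L" "real (length w') \<le> h (card N) - h (card (A \<union> C))"
      "merges E w' (run E w ` X) N" by blast
    show ?thesis
    proof (intro exI[of _ "w @ w'"] conjI)
      show "set (w @ w') \<subseteq> L" using subset_trans[OF w(1) LL] w'(1) by simp
      show "real (length (w @ w')) \<le> h (card N) - h (card A)" using w(2) w'(2) c by simp
      show "merges E (w @ w') X N"
      proof (intro ballI)
        fix x y a assume "x \<in> X" "y \<in> X" "a \<in> N"
        then show "run E (w @ w') x a = run E (w @ w') y a"
          using w'(3)[rule_format, of "run E w x" "run E w y" a] by simp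
      qed
    qed
  qed
qed

section \<open>Numerical bounds for the merge of two states\<close>

lemma pow_ge: "1 + real s * (phi - 1) \<le> phi ^ s"
proof -
  have "1 + real s * (phi - 1) \<le> (1 + (phi - 1)) ^ s"
    using phi_bounds(1) by (intro Bernoulli_inequality) simp
  then show ?thesis by simp
qed

lemma phi_ge1: "1 \<le> phi ^ n"
  using phi_bounds(1) by (simp add: one_le_power)

text \<open>\<open>4 * sqrt 5 = (5 + sqrt 5) * (sqrt 5 - 1)\<close> makes the costs of the components telescope.\<close>
lemma merge_bound_step:
  "(5 + sqrt 5) * (real (m + cost m z) + phi) * (phi ^ c - 1)
    \<le> 4 * sqrt 5 * (m + phi) * phi ^ (z + c) - 4 * sqrt 5 * (m + phi) * phi ^ z"
proof -
  have "(5 + sqrt 5) * (real (m + cost m z) + phi) \<le> (5 + sqrt 5) * ((m + phi) * (sqrt 5 - 1) * phi ^ z)"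
    by (intro mult_left_mono cost_shift) simp
  also have "\<dots> = 4 * sqrt 5 * (m + phi) * phi ^ z" by (simp add: algebra_simps)
  finally have "(5 + sqrt 5) * (real (m + cost m z) + phi) * (phi ^ c - 1) \<le> 4 * sqrt 5 * (m + phi) * phi ^ z * (phi ^ c - 1)"
    using phi_ge1[of c] by (intro mult_right_mono) auto
  then show ?thesis by (simp add: algebra_simps power_add)
qed

lemma veto_bound:
  "real (cost m z + c) \<le> 4 * sqrt 5 * (m + phi) * phi ^ (z + c) - 4 * sqrt 5 * (m + phi) * phi ^ z" if "1 \<le> c"
proof -
  let ?P = "(m + phi) * phi ^ z"
  have r: "2 < sqrt 5" "sqrt 5 < 12/5" using phi_bounds unfolding phi_def by auto
  have p1: "1 \<le> ?P" using phi_ge1[of z] phi_bounds(1) mult_mono[of 1 "m + phi" 1 "phi ^ z"] by simp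
  have "cost m z \<le> 2 * ?P"
  proof -
    have "real (cost m z) \<le> (m + phi) * ((sqrt 5 - 1) * phi ^ z - 1)" using cost_le[of m z] by (simp add: drive_bound_def)
    also have "\<dots> \<le> (m + phi) * (2 * phi ^ z)"
    proof (rule mult_left_mono)
      have "(sqrt 5 - 1) * phi ^ z \<le> 2 * phi ^ z" using r phi_ge1[of z] by (intro mult_right_mono) auto
      then show "(sqrt 5 - 1) * phi ^ z - 1 \<le> 2 * phi ^ z" by simp
    qed (use phi_bounds in simp)
    finally show ?thesis by simp
  qed
  moreover have "real c \<le> real c * ?P" using p1 mult_left_mono[of 1 ?P "real c"] by simp
  moreover have "8 * (real c * (1/2)) * ?P \<le> 4 * sqrt 5 * (phi ^ c - 1) * ?P"
  proof (intro mult_right_mono mult_mono)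
    have "real c * (1/2) \<le> real c * (phi - 1)" using phi_bounds(1) by (intro mult_left_mono) auto
    then show "real c * (1/2) \<le> phi ^ c - 1" using pow_ge[of c] by linarith
  qed (use r p1 in auto)
  moreover have "2 * ?P \<le> 2 * real c * ?P" using that p1 by (intro mult_right_mono) auto
  ultimately have "real (cost m z + c) \<le> 4 * sqrt 5 * (phi ^ c - 1) * ?P" using p1 by (simp add: algebra_simps)
  then show ?thesis by (simp add: algebra_simps power_add)
qed

lemma scaled_bound:
  fixes u :: real
  assumes "0 \<le> u" "L \<le> u * R" "R \<le> B" shows "L \<le> u * B"
  using assms mult_left_mono[of R B u] by linarith

text \<open>The origin of \<open>5 + sqrt 5\<close>. In units of
  \<open>(m + phi) * phi ^ (c - 1)\<close>, raising the root costs \<open>sqrt 5 - 1\<close>. The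
  two later drives, shortened by at least one entry, cost
  \<open>2 * (sqrt 5 - 1) / phi = 6 - 2 * sqrt 5\<close>. With merge constant \<open>K\<close> the
  remainder costs up to \<open>K * (sqrt 5 - 1)\<close>. Equating the sum with
  \<open>K * phi\<close> gives \<open>K = 5 + sqrt 5\<close>.\<close>

lemma stage_bound1:
  assumes q: "1 \<le> q" "q \<le> k" "k \<le> n" and c: "c = Suc (s + n)"
  shows "real (cost m (c - 1)) + (m + 1) + s * (m + 1) + (k + q) * (m + 1) + (2 * real (cost m (c - 1 - q)) + 2)
      + (s * (m + 1) + real k) - real q + 4 * sqrt 5 * (m + phi) * (phi ^ n - phi ^ k)
    \<le> (5 + sqrt 5) * (m + phi) * (phi ^ c - 1)"
proof -
  define r where "r = sqrt 5"
  define u where "u = real m + phi"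
  define A where "A = phi ^ n"
  define S where "S = phi ^ s"
  define B where "B = phi ^ k"
  have r: "2 < r" "r < 12/5" "phi = (1 + r) / 2" "r * r = 5" using phi_bounds unfolding phi_def r_def by auto
  have u: "phi \<le> u" "0 \<le> u" "real m + 1 \<le> u" using phi_bounds(1) by (auto simp: u_def)
  have X: "phi ^ (c - 1) = A * S" "phi ^ c = phi * (A * S)" using c by (auto simp: A_def S_def power_add)
  have "cost m (c - 1) \<le> u * ((r - 1) * (A * S) - 1)"
    using cost_le[of m "c - 1"] unfolding drive_bound_def X u_def r_def .
  moreover have "cost m (c - 1 - q) \<le> u * ((r - 1) * ((A * S) * (phi - 1)) - 1)"
  proof -
    have p1: "phi * (phi - 1) = 1" using phi_sq by (simp add: algebra_simps)
    have "phi ^ (c - 1 - q) \<le> A * S * (phi - 1)"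
    proof -
      have "phi ^ Suc (c - 1 - q) \<le> phi ^ (c - 1)" using q c phi_bounds(1) by (intro power_increasing) auto
      then have "phi ^ (c - 1 - q) * phi * (phi - 1) \<le> A * S * (phi - 1)"
        using phi_bounds(1) unfolding X by (intro mult_right_mono) (auto simp: mult.commute)
      then show ?thesis using p1 by (simp add: mult.assoc)
    qed
    then have "(r - 1) * phi ^ (c - 1 - q) \<le> (r - 1) * (A * S * (phi - 1))" using r by (intro mult_left_mono) auto
    then have "u * ((r - 1) * phi ^ (c - 1 - q) - 1) \<le> u * ((r - 1) * (A * S * (phi - 1)) - 1)"
      using u by (intro mult_left_mono) auto
    then show ?thesis using cost_le[of m "c - 1 - q"] by (simp add: drive_bound_def u_def r_def)
  qed
  moreover have "(1 + 2 * real s + real k + real q) * (real m + 1) \<le> u * (1 + 2 * real s + real k + real q)"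
    using u(3) mult_left_mono[of "real m + 1" u "1 + 2 * real s + real k + real q"] by (simp add: mult.commute)
  moreover have "2 \<le> u * (r - 1)"
  proof -
    have "phi * (r - 1) \<le> u * (r - 1)" using r(1) u(1) by (intro mult_right_mono) auto
    moreover have "phi * (r - 1) = 2" using phi_bounds(4) unfolding r_def by (simp only: mult.commute)
    ultimately show ?thesis by simp
  qed
  moreover have "real k - real q \<le> u * ((real k - real q) * (phi - 1))"
  proof -
    have "1 \<le> u * (phi - 1)" using mult_right_mono[of phi u "phi - 1"] u phi_bounds(1) phi_sq by (simp add: algebra_simps)
    then show ?thesis using mult_right_mono[of 1 "u * (phi - 1)" "real k - real q"] q by (simp add: mult_ac)
  qed
  ultimately have "real (cost m (c - 1)) + (m + 1) + s * (m + 1) + (k + q) * (m + 1) + (2 * real (cost m (c - 1 - q)) + 2)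
      + (s * (m + 1) + real k) - real q + 4 * r * u * (A - B)
    \<le> u * (((r - 1) * (A * S) - 1) + 2 * ((r - 1) * ((A * S) * (phi - 1)) - 1)
        + (1 + 2 * real s + real k + real q) + (r - 1) + (real k - real q) * (phi - 1) + 4 * r * (A - B))"
    by (simp add: algebra_simps)
  moreover have "((r - 1) * (A * S) - 1) + 2 * ((r - 1) * ((A * S) * (phi - 1)) - 1)
        + (1 + 2 * real s + real k + real q) + (r - 1) + (real k - real q) * (phi - 1) + 4 * r * (A - B)
    \<le> (5 + r) * (phi * (A * S) - 1)"
  proof -
    have e1: "2 * ((r - 1) * ((A * S) * (phi - 1))) = (6 - 2 * r) * (A * S)"
    proof -
      have "phi - 1 = (r - 1) / 2" using r(3) by simp
      moreover have "(r - 1) * (r - 1) = 6 - 2 * r" using r(4) by (simp add: algebra_simps)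
      ultimately show ?thesis by (metis (no_types, lifting) mult.assoc mult.commute nonzero_mult_div_cancel_left times_divide_eq_right zero_neq_numeral)
    qed
    have e2: "(5 + r) * (phi * (A * S)) = (5 + 3 * r) * (A * S)"
      unfolding r(3) using r(4) by (simp add: algebra_simps)
    have e3: "(real k - real q) * (phi - 1) \<le> real k - real q"
      using mult_left_mono[of "phi - 1" 1 "real k - real q"] q phi_bounds(2) by simp
    have S1: "1 + real s * (1/2) \<le> S" "1 + real k * (1/2) \<le> B"
      using pow_ge[of s] pow_ge[of k] phi_bounds(1) mult_left_mono[of "1/2" "phi - 1" "real s"]
        mult_left_mono[of "1/2" "phi - 1" "real k"] by (auto simp: S_def B_def)
    have "S - 1 \<le> A * (S - 1)" using mult_right_mono[of 1 A "S - 1"] phi_ge1[of n] S1(1) by (simp add: A_def)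
    then have "1 + real s * (1/2) + real k * (1/2) \<le> A * S - A + B" using S1 by (simp add: algebra_simps)
    then have "r * (1 + real s * (1/2) + real k * (1/2)) \<le> r * (A * S - A + B)"
      using r by (intro mult_left_mono) auto
    moreover have "2 * (1 + real s * (1/2) + real k * (1/2)) \<le> r * (1 + real s * (1/2) + real k * (1/2))"
      using r by (intro mult_right_mono) auto
    ultimately have "2 * (1 + real s * (1/2) + real k * (1/2)) \<le> r * (A * S - A + B)" by (rule order_trans[rotated])
    moreover have "2 * real s + 2 * real k + 2 * r + 2 \<le> 4 * (2 * (1 + real s * (1/2) + real k * (1/2)))"
      using r(2) by simp
    ultimately have "2 * real s + 2 * real k + 2 * r + 2 \<le> 4 * (r * (A * S - A + B))" by linarith
    then show ?thesis using e1 e2 e3 by (simp add: algebra_simps)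
  qed
  ultimately have "real (cost m (c - 1)) + (m + 1) + s * (m + 1) + (k + q) * (m + 1) + (2 * real (cost m (c - 1 - q)) + 2)
      + (s * (m + 1) + real k) - real q + 4 * r * u * (A - B) \<le> u * ((5 + r) * (phi * (A * S) - 1))"
    by (rule scaled_bound[OF u(2)])
  then show ?thesis by (simp add: X(2) u_def r_def A_def B_def algebra_simps)
qed

text \<open>Two drives of full size. For an empty region the leading coefficients are
  \<open>6 * sqrt 5 - 2\<close> and \<open>5 + 3 * sqrt 5\<close>, so the estimate needs
  \<open>sqrt 5 <= 7/3\<close>, sharper than the \<open>12/5\<close> used elsewhere.\<close>

lemma stage_bound0:
  assumes c: "c = Suc (s + n)"
  shows "2 * real (cost m (c - 1)) + 2 + s * (m + 1) + 4 * sqrt 5 * (m + phi) * (phi ^ n - 1)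
    \<le> (5 + sqrt 5) * (m + phi) * (phi ^ c - 1)"
proof -
  define r where "r = sqrt 5"
  define u where "u = real m + phi"
  define A where "A = phi ^ n"
  define S where "S = phi ^ s"
  have r: "2 < r" "r < 7/3" "phi = (1 + r) / 2" "r * r = 5"
  proof -
    have "sqrt 5 < 7/3" by (rule real_less_lsqrt) (auto simp: power2_eq_square)
    then show "2 < r" "r < 7/3" "phi = (1 + r) / 2" "r * r = 5"
      using phi_bounds unfolding phi_def r_def by auto
  qed
  have u: "phi \<le> u" "0 \<le> u" "real m + 1 \<le> u" using phi_bounds(1) by (auto simp: u_def)
  have X: "phi ^ (c - 1) = A * S" "phi ^ c = phi * (A * S)" using c by (auto simp: A_def S_def power_add)
  have "cost m (c - 1) \<le> u * ((r - 1) * (A * S) - 1)"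
    using cost_le[of m "c - 1"] unfolding drive_bound_def X u_def r_def .
  moreover have "real s * (real m + 1) \<le> u * real s"
    using u(3) mult_left_mono[of "real m + 1" u "real s"] by (simp add: mult.commute)
  moreover have "2 \<le> u * (r - 1)"
  proof -
    have "phi * (r - 1) \<le> u * (r - 1)" using r(1) u(1) by (intro mult_right_mono) auto
    moreover have "phi * (r - 1) = 2" using phi_bounds(4) unfolding r_def by (simp only: mult.commute)
    ultimately show ?thesis by simp
  qed
  ultimately have "2 * real (cost m (c - 1)) + 2 + s * (m + 1) + 4 * r * u * (A - 1)
    \<le> u * (2 * ((r - 1) * (A * S) - 1) + (r - 1) + real s + 4 * r * (A - 1))"
    by (simp add: algebra_simps)
  moreover have "2 * ((r - 1) * (A * S) - 1) + (r - 1) + real s + 4 * r * (A - 1) \<le> (5 + r) * (phi * (A * S) - 1)"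
  proof -
    have e2: "(5 + r) * (phi * (A * S)) = (5 + 3 * r) * (A * S)"
      unfolding r(3) using r(4) by (simp add: algebra_simps)
    have S1: "1 + real s * (1/2) \<le> S"
      using pow_ge[of s] phi_bounds(1) mult_left_mono[of "1/2" "phi - 1" "real s"] by (auto simp: S_def)
    have A1: "1 \<le> A" using phi_ge1 by (simp add: A_def)
    have "S - 1 \<le> A * (S - 1)" using mult_right_mono[of 1 A "S - 1"] A1 S1(1) by simp
    then have "real s * (1/2) \<le> A * S - A" using S1 by (simp add: algebra_simps)
    moreover define Y where "Y = A * S - A"
    ultimately have Y: "real s * (1/2) \<le> Y" by simp
    have Y0: "0 \<le> Y" by (rule order_trans[OF _ Y]) simp
    have "9 * Y \<le> (7 + r) * Y" using r(1) Y0 by (intro mult_right_mono) auto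
    moreover have "real s \<le> 9 * Y" using Y Y0 by linarith
    ultimately have "real s \<le> (7 + r) * (A * S - A)" unfolding Y_def by linarith
    moreover have "0 \<le> (7 - 3 * r) * A" using r A1 by (intro mult_nonneg_nonneg) auto
    ultimately have "4 * r * A + real s + 2 - 2 * r \<le> (7 + r) * (A * S)" using r by (simp add: algebra_simps)
    then show ?thesis using e2 by (simp add: algebra_simps)
  qed
  ultimately have "2 * real (cost m (c - 1)) + 2 + s * (m + 1) + 4 * r * u * (A - 1) \<le> u * ((5 + r) * (phi * (A * S) - 1))"
    by (rule scaled_bound[OF u(2)])
  then show ?thesis by (simp add: X(2) u_def r_def A_def algebra_simps)
qed

text \<open>The context varies in the induction: a component of the remainder misses the root, hence
  is smaller than \<open>C\<close>, and it is merged with the finished part of the remainder as an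
  additional controller.\<close>

theorem strong_merge:
  fixes E :: "('v::finite) bdigraph"
  assumes nc: "negcyc E"
  shows "ctx E C L I m \<Longrightarrow> strong E C \<Longrightarrow> branching E C \<noteq> {} \<Longrightarrow> (x,y) \<in> I \<Longrightarrow>
    \<exists>w. set w \<subseteq> L \<and> real (length w) \<le> (5 + sqrt 5) * (m + phi) * (phi ^ card C - 1) \<and>
      (\<forall>a\<in>C. run E w x a = run E w y a)"
proof (induction "card C" arbitrary: C L I m x y rule: less_induct)
  case less
  note ctx = less.prems(1) and st = less.prems(2) and br = less.prems(3) and xy = less.prems(4)
  from root_select[OF nc st br] obtain v where v: "v \<in> branching E C"
    "\<forall>p k b x. p \<in> insert v (dominated E C v) \<longrightarrow> k \<in> C - insert v (dominated E C v) \<longrightarrow>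
     (p,k,b) \<in> E \<longrightarrow> synced E C (dominated E C v) x \<longrightarrow> (x p = b) = (\<not> x v)" by blast
  interpret stage E C L I m v
    by (unfold_locales; (rule nc ctx st v(1))?) (use v(2) in blast)
  let ?A = "\<Union>(dead E N)"
  let ?Q = "\<lambda>X. \<exists>x y. X = {x,y}"
  let ?Mg = "\<lambda>c m. (5 + sqrt 5) * (real m + phi) * (phi ^ c - 1)"
  let ?h = "\<lambda>z. 4 * sqrt 5 * (real m + phi) * phi ^ z"
  have cC: "card C = Suc (card D + card N)"
  proof -
    have "card C = card (insert v D \<union> N)" using C_split by simp
    also have "\<dots> = card (insert v D) + card N" using NC by (intro card_Un_disjoint) auto
    also have "card (insert v D) = Suc (card D)" using DC by (subst card_insert_disjoint) auto
    finally show ?thesis by simp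
  qed
  have AN: "?A \<subseteq> N" using dead_props(1) by blast
  have clA: "closed_in E N ?A" using dead_props(3) unfolding closed_in_def by blast
  have loop: "\<exists>w. set w \<subseteq> L - C \<union> N \<and> real (length w) \<le> ?h (card N) - ?h (card ?A) \<and>
      (merges E w X N)"
    if X: "?Q X" "\<forall>x\<in>X. \<forall>y\<in>X. (x,y) \<in> IN \<and> (\<forall>a\<in>?A. x a = y a)" for X
  proof (rule component_loop[where Q = ?Q and Mg = ?Mg and h = ?h, OF nc stage_ctx stage_loopable _ _ _ _ AN clA _ X])
    show "?Q (run E w ` X)" if "?Q X" for w X using that by auto
    show "?Mg c (m + cost m z) \<le> ?h (z + c) - ?h z" for c z by (rule merge_bound_step)
    show "real (cost m z + c) \<le> ?h (z + c) - ?h z" if "1 \<le> c" for c z using veto_bound[OF that] .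
    show "\<forall>K\<in>dead E N. K \<subseteq> ?A" by blast
    fix C' L' I' m' X'
    assume C': "C' \<subseteq> N" "strong E C'" "branching E C' \<noteq> {}" "ctx E C' L' I' m'" and Q: "?Q X'"
      and I': "\<forall>x\<in>X'. \<forall>y\<in>X'. (x,y) \<in> I'"
    from Q obtain x' y' where X': "X' = {x',y'}" by blast
    have "C' \<subset> C" using C'(1) NC vC by blast
    then have "card C' < card C" by (simp add: psubset_card_mono)
    from less.hyps[OF this C'(4,2,3), of x' y'] I' X' obtain w where
      "set w \<subseteq> L'" "real (length w) \<le> ?Mg (card C') m'" "\<forall>a\<in>C'. run E w x' a = run E w y' a" by auto
    then show "\<exists>w. set w \<subseteq> L' \<and> real (length w) \<le> ?Mg (card C') m' \<and>
        (merges E w X' C')"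
      using X' by (intro exI[of _ w]) auto
  qed
  have fin: ?case if w1: "set w1 \<subseteq> L" "(run E w1 x, run E w1 y) \<in> IN"
      "\<forall>u\<in>insert v D \<union> ?A. run E w1 x u = run E w1 y u"
    and b: "real (length w1) + (?h (card N) - ?h (card ?A)) \<le> ?Mg (card C) m" for w1
  proof -
    let ?X = "{run E w1 x, run E w1 y}"
    have "\<forall>x\<in>?X. \<forall>y\<in>?X. (x,y) \<in> IN \<and> (\<forall>a\<in>?A. x a = y a)"
      using w1(2,3) ctx_sym[OF stage_ctx w1(2)] ctx_refl[OF stage_ctx w1(2)] ctx_refl2[OF stage_ctx w1(2)] by auto
    from loop[OF _ this] obtain w where w: "set w \<subseteq> L - C \<union> N" "real (length w) \<le> ?h (card N) - ?h (card ?A)"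
      "merges E w ?X N" by blast
    have "run E w (run E w1 x) a = run E w (run E w1 y) a" if a: "a \<in> C" for a
    proof (cases "a \<in> N")
      case True then show ?thesis using w(3) by blast
    next
      case False
      then have "a \<in> insert v D" using a C_split by blast
      moreover from this have "a \<notin> set w" using w(1) NC vC DC False by blast
      moreover have "run E w1 x a = run E w1 y a" using w1(3) \<open>a \<in> insert v D\<close> by blast
      ultimately show ?thesis by (simp add: run_other)
    qed
    moreover have "set (w1 @ w) \<subseteq> L" using w1(1) w(1) NC CL by auto
    moreover have "real (length (w1 @ w)) \<le> ?Mg (card C) m" using b w(2) by simp
    ultimately show ?thesis by (intro exI[of _ "w1 @ w"]) simp
  qed
  show ?case
  proof (cases "dead E N = {}")
    case True
    from stage_word0[OF True xy] obtain w1 where w1: "set w1 \<subseteq> L"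
      "length w1 \<le> 2 * cost m (card C - 1) + 2 + card D * (m + 1)" "(run E w1 x, run E w1 y) \<in> IN"
      "\<forall>u\<in>insert v D \<union> ?A. run E w1 x u = run E w1 y u" by blast
    have "real (length w1) \<le> real (2 * cost m (card C - 1) + 2 + card D * (m + 1))" using w1(2) by (simp only: of_nat_le_iff)
    then show ?thesis using fin[OF w1(1,3,4)] stage_bound0[OF cC, of m] True by (simp add: algebra_simps)
  next
    case False
    from stage_word1[OF xy] obtain w1 where w1: "set w1 \<subseteq> L"
      "length w1 + card (dead E N) \<le> cost m (card C - 1) + (m + 1) + card D * (m + 1)
      + (card ?A + card (dead E N)) * (m + 1) + (2 * cost m (card C - 1 - card (dead E N)) + 2)
      + (card D * (m + 1) + card ?A)" "(run E w1 x, run E w1 y) \<in> IN"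
      "\<forall>u\<in>insert v D \<union> ?A. run E w1 x u = run E w1 y u" by blast
    have q: "1 \<le> card (dead E N)" using False by (simp add: Suc_leI card_gt_0_iff)
    have qk: "card (dead E N) \<le> card ?A"
      using spread[OF subset_refl] by auto
    have "real (length w1 + card (dead E N)) \<le> real (cost m (card C - 1) + (m + 1) + card D * (m + 1)
      + (card ?A + card (dead E N)) * (m + 1) + (2 * cost m (card C - 1 - card (dead E N)) + 2)
      + (card D * (m + 1) + card ?A))" using w1(2) by (simp only: of_nat_le_iff)
    then show ?thesis using fin[OF w1(1,3,4)] stage_bound1[OF q qk card_mono[OF finite AN] cC, of m] by (simp add: algebra_simps)
  qed
qed

subsection \<open>Merging all states\<close>

text \<open>Counts the patterns that the states leave on \<open>C\<close>. Related states with equal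
  patterns keep equal patterns, so a word acts on patterns, and each pair merge identifies at least
  two of them.\<close>

lemma set_merge:
  fixes E :: "('v::finite) bdigraph"
  assumes ctx: "ctx E C L I m" and B: "0 \<le> B"
    and pair: "\<And>x y. (x,y) \<in> I \<Longrightarrow> \<exists>w. set w \<subseteq> L \<and> real (length w) \<le> B \<and> (\<forall>a\<in>C. run E w x a = run E w y a)"
  shows "card ((\<lambda>x. {a \<in> C. x a}) ` X) \<le> n \<Longrightarrow> \<forall>x\<in>X. \<forall>y\<in>X. (x,y) \<in> I \<Longrightarrow>
    \<exists>w. set w \<subseteq> L \<and> real (length w) \<le> n * B \<and> (merges E w X C)"
proof (induction n arbitrary: X)
  case 0
  then have "X = {}" by simp
  then show ?case by (intro exI[of _ "[]"]) simp
next
  case (Suc n)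
  let ?p = "\<lambda>x. {a \<in> C. x a}"
  have B1: "0 \<le> real (Suc n) * B" using B by simp
  show ?case
  proof (cases "\<forall>x\<in>X. \<forall>y\<in>X. \<forall>a\<in>C. x a = y a")
    case True
    then show ?thesis using B1 by (intro exI[of _ "[]"]) simp
  next
    case False
    then obtain x y where xy: "x \<in> X" "y \<in> X" "?p x \<noteq> ?p y" by blast
    then have "(x,y) \<in> I" using Suc.prems(2) by blast
    from pair[OF this] obtain w where w: "set w \<subseteq> L" "real (length w) \<le> B"
      "\<forall>a\<in>C. run E w x a = run E w y a" by blast
    \<comment> \<open>The induced action on patterns; the representative picked by
      \<open>SOME\<close> does not matter, by \<open>ctx_agree_run\<close>.\<close>
    define G where "G S = ?p (run E w (SOME z. z \<in> X \<and> ?p z = S))" for S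
    have G: "?p (run E w z) = G (?p z)" if z: "z \<in> X" for z
    proof -
      define z' where "z' = (SOME z'. z' \<in> X \<and> ?p z' = ?p z)"
      have z': "z' \<in> X \<and> ?p z' = ?p z" unfolding z'_def by (rule someI[of _ z]) (use z in simp)
      then have "\<forall>a\<in>C. z a = z' a" by blast
      moreover have "(z,z') \<in> I" using z z' Suc.prems(2) by blast
      ultimately have "\<forall>a\<in>C. run E w z a = run E w z' a" using ctx_agree_run[OF ctx _ w(1)] by blast
      then show ?thesis unfolding G_def z'_def[symmetric] by auto
    qed
    have Gxy: "G (?p x) = G (?p y)" using G[OF xy(1)] G[OF xy(2)] w(3) by auto
    have "?p ` (run E w ` X) \<subseteq> G ` (?p ` X - {?p y})"
    proof
      fix S assume "S \<in> ?p ` (run E w ` X)"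
      then obtain z where z: "z \<in> X" "S = G (?p z)" using G by auto
      show "S \<in> G ` (?p ` X - {?p y})"
      proof (cases "?p z = ?p y")
        case True
        then have "S = G (?p x)" using z(2) Gxy by simp
        then show ?thesis using xy by (intro image_eqI[of _ _ "?p x"]) auto
      next
        case False
        then show ?thesis using z by (intro image_eqI[of _ _ "?p z"]) auto
      qed
    qed
    then have "card (?p ` (run E w ` X)) \<le> card (G ` (?p ` X - {?p y}))" by (intro card_mono) auto
    also have "\<dots> \<le> card (?p ` X - {?p y})" by (rule card_image_le) simp
    also have "\<dots> = card (?p ` X) - 1" using xy(2) by (intro card_Diff_singleton) blast
    also have "\<dots> \<le> n" using Suc.prems(1) by simp
    finally have c: "card (?p ` (run E w ` X)) \<le> n" .
    have "\<forall>x\<in>run E w ` X. \<forall>y\<in>run E w ` X. (x,y) \<in> I"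
      using Suc.prems(2) ctx_run[OF ctx _ w(1)] by blast
    from Suc.IH[OF c this] obtain w' where w': "set w' \<subseteq> L" "real (length w') \<le> n * B"
      "merges E w' (run E w ` X) C" by blast
    show ?thesis
    proof (intro exI[of _ "w @ w'"] conjI)
      show "set (w @ w') \<subseteq> L" using w(1) w'(1) by simp
      show "real (length (w @ w')) \<le> Suc n * B" using w(2) w'(2) by (simp add: algebra_simps)
      show "merges E (w @ w') X C"
      proof (intro ballI)
        fix x y a assume "x \<in> X" "y \<in> X" "a \<in> C"
        then show "run E (w @ w') x a = run E (w @ w') y a"
          using w'(3)[rule_format, of "run E w x" "run E w y" a] by simp
      qed
    qed
  qed
qed

text \<open>The excluded sets contain \<open>u\<close> and falsify the literal of \<open>p\<close>,
  with free choice on the other \<open>card C - 2\<close> vertices: a quarter of all.\<close>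

lemma card_implication_sets:
  assumes "finite C" "u \<in> C" "p \<in> C" "u \<noteq> p"
  shows "4 * card {S \<in> Pow C. u \<in> S \<longrightarrow> (p \<in> S) = b} \<le> 3 * 2 ^ card C"
proof -
  let ?G = "{S \<in> Pow C. u \<in> S \<longrightarrow> (p \<in> S) = b}" and ?H = "{S \<in> Pow C. u \<in> S \<and> (p \<in> S) \<noteq> b}"
  let ?f = "\<lambda>S. insert u (if b then S else insert p S)"
  have "?f ` Pow (C - {u,p}) \<subseteq> ?H" using assms by (auto split: if_splits)
  then have "card (?f ` Pow (C - {u,p})) \<le> card ?H" using assms(1) by (intro card_mono) auto
  moreover have "inj_on ?f (Pow (C - {u,p}))" by (rule inj_onI) (auto split: if_splits)
  ultimately have "2 ^ card (C - {u,p}) \<le> card ?H" using assms(1) by (simp add: card_image card_Pow)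
  moreover have "card C = card (C - {u,p}) + 2"
    using assms card_Diff_subset[of "{u,p}" C] card_mono[of C "{u,p}"] by simp
  moreover have "card ?G + card ?H = 2 ^ card C"
  proof -
    have "?G \<union> ?H = Pow C" "?G \<inter> ?H = {}" by auto
    then show ?thesis using assms(1) card_Un_disjoint[of ?G ?H] by (simp add: card_Pow)
  qed
  ultimately show ?thesis by simp
qed

text \<open>One update of a vertex already excludes a quarter of the states.\<close>
lemma top_merge:
  fixes E :: "('v::finite) bdigraph"
  assumes nc: "negcyc E" and ctx: "ctx E C L I m" and st: "strong E C" and br: "branching E C \<noteq> {}"
    and X: "\<forall>x\<in>X. \<forall>y\<in>X. (x,y) \<in> I"
  shows "\<exists>w. set w \<subseteq> L \<and> real (length w) \<le> 1 + 3/4 * 2 ^ card C * ((5 + sqrt 5) * (m + phi) * (phi ^ card C - 1)) \<and>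
    (merges E w X C)"
proof -
  define B where "B = (5 + sqrt 5) * (m + phi) * (phi ^ card C - 1)"
  have B: "0 \<le> B" using phi_bounds(1) phi_ge1[of "card C"] by (simp add: B_def)
  obtain u p b where u: "u \<in> C" "p \<in> C" "u \<noteq> p" "(p,u,b) \<in> E" using br unfolding branching_def by blast
  have uL: "u \<in> L" using u(1) ctx_sub[OF ctx] by blast
  let ?X = "upd E u ` X" and ?p = "\<lambda>x. {a \<in> C. x a}"
  have "?p ` ?X \<subseteq> {S \<in> Pow C. u \<in> S \<longrightarrow> (p \<in> S) = b}"
    using u by (auto simp: net_def)
  then have "card (?p ` ?X) \<le> card {S \<in> Pow C. u \<in> S \<longrightarrow> (p \<in> S) = b}" by (intro card_mono) auto
  then have c: "4 * card (?p ` ?X) \<le> 3 * 2 ^ card C"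
    using card_implication_sets[OF finite u(1-3), of b] by linarith
  have I: "\<forall>x\<in>?X. \<forall>y\<in>?X. (x,y) \<in> I" using X ctx_upd[OF ctx _ uL] by blast
  have "\<exists>w. set w \<subseteq> L \<and> real (length w) \<le> B \<and> (\<forall>a\<in>C. run E w x a = run E w y a)" if "(x,y) \<in> I" for x y
    using strong_merge[OF nc ctx st br that] unfolding B_def .
  from set_merge[OF ctx B this order_refl I] obtain w where
    w: "set w \<subseteq> L" "real (length w) \<le> card (?p ` ?X) * B"
    "merges E w ?X C" by blast
  have "4 * real (card (?p ` ?X)) \<le> 3 * 2 ^ card C"
    using c by (metis (mono_tags, lifting) of_nat_le_iff of_nat_mult of_nat_numeral of_nat_power)
  then have "real (card (?p ` ?X)) * B \<le> 3/4 * 2 ^ card C * B" using B by (intro mult_right_mono) auto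
  then have "real (length (u # w)) \<le> 1 + 3/4 * 2 ^ card C * B" using w(2) by simp
  moreover have "merges E (u # w) X C"
  proof (intro ballI)
    fix x y a assume "x \<in> X" "y \<in> X" "a \<in> C"
    then show "run E (u # w) x a = run E (u # w) y a"
      using w(3)[rule_format, of "upd E u x" "upd E u y" a] by simp
  qed
  moreover have "set (u # w) \<subseteq> L" using w(1) uL by simp
  ultimately show ?thesis unfolding B_def by (intro exI[of _ "u # w"] conjI)
qed

text \<open>For \<open>z = 0\<close> the saved quarter is essential:
  \<open>(5 + sqrt 5) * phi\<close> is about 11.7, but three quarters of it are below 9. For
  \<open>z > 0\<close> the controllers multiply by at most \<open>2 * phi ^ z\<close>, while the
  factor \<open>2 ^ z >= 2\<close> of the potential leaves room.\<close>

lemma top_merge_bound: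
  assumes "2 \<le> c"
  shows "1 + 3/4 * 2 ^ c * ((5 + sqrt 5) * (real (0 + cost 0 z) + phi) * (phi ^ c - 1))
    \<le> 10 * (2 * phi) ^ (z + c) - 10 * (2 * phi) ^ z"
proof -
  have r: "sqrt 5 < 7/3" by (rule real_less_lsqrt) (auto simp: power2_eq_square)
  define T where "T = (2::real) ^ c"
  define F where "F = phi ^ c"
  have T: "4 \<le> T" using power_increasing[OF assms, of "2::real"] by (simp add: T_def)
  have F: "1 \<le> F" using phi_ge1 by (simp add: F_def)
  show ?thesis
  proof (cases z)
    case 0
    have "(5 + sqrt 5) * phi = 5 + 3 * sqrt 5" by (simp add: phi_def algebra_simps)
    then have "3/4 * ((5 + sqrt 5) * phi) \<le> 9" using r by simp
    then have "3/4 * ((5 + sqrt 5) * phi) * (T * (F - 1)) \<le> 9 * (T * (F - 1))"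
      using T F by (intro mult_right_mono) auto
    moreover have "T * 1 \<le> T * F" using T F by (intro mult_left_mono) auto
    moreover have "9 * (T * (F - 1)) = 9 * (T * F) - 9 * T" by (simp add: algebra_simps)
    ultimately have "1 + 3/4 * ((5 + sqrt 5) * phi) * (T * (F - 1)) \<le> 10 * (T * F) - 10" using T by linarith
    moreover have "3/4 * 2 ^ c * ((5 + sqrt 5) * (real (0 + cost 0 z) + phi) * (phi ^ c - 1))
        = 3/4 * ((5 + sqrt 5) * phi) * (T * (F - 1))"
      using 0 by (simp add: cost_def T_def F_def)
    moreover have "10 * (2 * phi) ^ (z + c) - 10 * (2 * phi) ^ z = 10 * (T * F) - 10"
      using 0 by (simp add: T_def F_def power_mult_distrib)
    ultimately show ?thesis by linarith
  next
    case (Suc y)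
    define P where "P = phi ^ z"
    define Z where "Z = (2::real) ^ z"
    have P: "1 \<le> P" using phi_ge1 by (simp add: P_def)
    have Z: "2 \<le> Z" using Suc one_le_power[of "2::real" y] by (simp add: Z_def)
    have "real (0 + cost 0 z) + phi \<le> (0 + phi) * (sqrt 5 - 1) * phi ^ z" using cost_shift[of 0 z] by simp
    then have "real (0 + cost 0 z) + phi \<le> 2 * P" using phi_bounds(4) by (simp add: P_def mult.commute)
    then have "(5 + sqrt 5) * (real (0 + cost 0 z) + phi) \<le> 22/3 * (2 * P)"
      using r phi_bounds(1) by (intro mult_mono) auto
    then have "3/4 * T * ((5 + sqrt 5) * (real (0 + cost 0 z) + phi) * (F - 1)) \<le> 3/4 * T * (22/3 * (2 * P) * (F - 1))"
      using T F by (intro mult_left_mono mult_right_mono) auto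
    also have "\<dots> = 11 * (T * (F - 1)) * P" by simp
    also have "\<dots> + 1 \<le> 20 * (T * F - 1) * P"
    proof -
      have "0 \<le> T * F" using T F by simp
      then have "11 * (T * (F - 1)) + 1 \<le> 20 * (T * F - 1)" using T by (simp add: algebra_simps)
      then have "(11 * (T * (F - 1)) + 1) * P \<le> 20 * (T * F - 1) * P" using P by (intro mult_right_mono) auto
      then show ?thesis using P by (simp add: algebra_simps)
    qed
    also have "\<dots> \<le> 10 * Z * (T * F - 1) * P"
    proof (intro mult_right_mono)
      have "1 * 1 \<le> T * F" using T F by (intro mult_mono) auto
      then show "0 \<le> T * F - 1" by simp
    qed (use Z P in auto)
    finally have "3/4 * T * ((5 + sqrt 5) * (real (0 + cost 0 z) + phi) * (F - 1)) + 1 \<le> 10 * Z * (T * F - 1) * P" by simp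
    moreover have "10 * (2 * phi) ^ (z + c) - 10 * (2 * phi) ^ z = 10 * Z * (T * F - 1) * P"
      by (simp add: Z_def T_def F_def P_def power_add power_mult_distrib algebra_simps)
    ultimately show ?thesis by (simp add: T_def F_def)
  qed
qed

lemma top_veto_bound:
  assumes "1 \<le> c"
  shows "real (cost 0 z + c) \<le> 10 * (2 * phi) ^ (z + c) - 10 * (2 * phi) ^ z"
proof -
  define P where "P = (2 * phi) ^ z"
  have P: "phi ^ z \<le> P" unfolding P_def using phi_bounds(1) by (intro power_mono) auto
  have P1: "1 \<le> P" unfolding P_def using phi_bounds(1) by (intro one_le_power) simp
  have "real (0 + cost 0 z) + phi \<le> (0 + phi) * (sqrt 5 - 1) * phi ^ z" using cost_shift[of 0 z] by simp
  then have "real (0 + cost 0 z) + phi \<le> 2 * phi ^ z" using phi_bounds(4) by (simp add: mult.commute)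
  then have w: "real (cost 0 z) \<le> 2 * P" using P phi_bounds(1) by simp
  have "1 + real c * 2 \<le> (1 + 2) ^ c" by (rule Bernoulli_inequality) simp
  also have "(1 + 2) ^ c \<le> (2 * phi) ^ c" using phi_bounds(1) by (intro power_mono) auto
  finally have "real c * 2 \<le> (2 * phi) ^ c - 1" by simp
  then have "10 * P * (real c * 2) \<le> 10 * P * ((2 * phi) ^ c - 1)" using P1 by (intro mult_left_mono) auto
  moreover have "2 * P * 1 \<le> 2 * P * real c" "1 * real c \<le> P * real c"
    using assms P1 by (auto intro!: mult_left_mono mult_right_mono)
  ultimately have "real (cost 0 z + c) \<le> 10 * P * ((2 * phi) ^ c - 1)" using w by (simp add: algebra_simps)
  then show ?thesis by (simp add: P_def power_add algebra_simps)
qed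

theorem and_net_synchronizing:
  fixes E :: "('v::finite) bdigraph"
  assumes nc: "negcyc E" and lp: "loopable E UNIV" and nd: "dead E UNIV = {}"
  shows "\<exists>w. (\<forall>x y. run E w x = run E w y) \<and> real (length w) \<le> 10 * (sqrt 5 + 1) ^ card (UNIV :: 'v set)"
proof -
  let ?I = "UNIV :: (('v \<Rightarrow> bool) \<times> ('v \<Rightarrow> bool)) set"
  let ?Mg = "\<lambda>c m. 1 + 3/4 * 2 ^ c * ((5 + sqrt 5) * (real m + phi) * (phi ^ c - 1))"
  let ?h = "\<lambda>z. 10 * (2 * phi) ^ z"
  \<comment> \<open>Nothing lies outside, so the empty word controls and the budget is 0.\<close>
  have ctx: "ctx E UNIV UNIV ?I 0" unfolding ctx_def by (auto intro: exI[of _ "[]"])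
  have "\<exists>w. set w \<subseteq> UNIV \<and> real (length w) \<le> ?h (card (UNIV :: 'v set)) - ?h (card ({} :: 'v set)) \<and>
      (merges E w UNIV UNIV)"
  proof (rule component_loop[where Q = "\<lambda>_. True" and Mg = ?Mg and h = ?h, OF nc ctx lp])
    show "\<And>c z. 2 \<le> c \<Longrightarrow> ?Mg c (0 + cost 0 z) \<le> ?h (z + c) - ?h z" by (rule top_merge_bound)
    show "\<And>c z. 1 \<le> c \<Longrightarrow> real (cost 0 z + c) \<le> ?h (z + c) - ?h z" by (rule top_veto_bound)
    show "\<forall>K\<in>dead E UNIV. K \<subseteq> {}" using nd by simp
    show "closed_in E UNIV {}" by (simp add: closed_in_def)
    show "\<exists>w. set w \<subseteq> L' \<and> real (length w) \<le> ?Mg (card C) m' \<and>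
        (merges E w X C)"
      if "strong E C" "branching E C \<noteq> {}" "ctx E C L' I' m'" "\<forall>x\<in>X. \<forall>y\<in>X. (x,y) \<in> I'"
      for C L' I' m' X using top_merge[OF nc that(3,1,2,4)] .
  qed auto
  then obtain w where w: "real (length w) \<le> ?h (card (UNIV :: 'v set)) - ?h (card ({} :: 'v set))"
      "\<forall>x y a. run E w x a = run E w y a" by auto
  have "2 * phi = sqrt 5 + 1" by (simp add: phi_def)
  then have "real (length w) \<le> 10 * (sqrt 5 + 1) ^ card (UNIV :: 'v set)" using w(1) by simp
  then show ?thesis using w(2) by (intro exI[of _ w]) (auto simp: fun_eq_iff)
qed

subsection \<open>From and-or-nets to and-nets\<close>

text \<open>\<open>d\<close> marks the complemented (disjunctive) vertices.\<close>
definition barcs :: "('v \<Rightarrow> bool) \<Rightarrow> 'v sdigraph \<Rightarrow> 'v bdigraph" where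
  "barcs d E = {(j,i,b). \<exists>s. (j,i,s) \<in> E \<and> b = ((s = 1) = (d j = d i))}"

lemma in_barcs: "(j,i,b) \<in> barcs d E \<longleftrightarrow> (\<exists>s. (j,i,s) \<in> E \<and> b = ((s = 1) = (d j = d i)))"
  by (simp add: barcs_def)

text \<open>De Morgan: in the coordinates \<open>x j \<noteq> d j\<close> a disjunction becomes a
  conjunction, and an arc changes sign exactly when one of its two ends is complemented.\<close>

lemma net_barcs:
  assumes sg: "signed_digraph E" and f: "is_conj E f i \<and> \<not> d i \<or> is_disj E f i \<and> d i"
  shows "net (barcs d E) (\<lambda>j. x j \<noteq> d j) i = (f x i \<noteq> d i)"
proof -
  have s: "s = 1 \<or> s = -1" if "(j,i,s) \<in> E" for j s using sg that unfolding signed_digraph_def by auto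
  have "net (barcs d E) (\<lambda>j. x j \<noteq> d j) i \<longleftrightarrow>
      (\<forall>j s. (j,i,s) \<in> E \<longrightarrow> (x j \<noteq> d j) = ((s = 1) = (d j = d i)))"
    unfolding net_def in_barcs by blast
  also have "\<dots> \<longleftrightarrow> (\<forall>j. ((j,i,1) \<in> E \<longrightarrow> x j \<noteq> d i) \<and> ((j,i,-1) \<in> E \<longrightarrow> x j = d i))"
  proof (rule iff_allI)
    fix j
    show "(\<forall>s. (j,i,s) \<in> E \<longrightarrow> (x j \<noteq> d j) = ((s = 1) = (d j = d i))) \<longleftrightarrow>
      ((j,i,1) \<in> E \<longrightarrow> x j \<noteq> d i) \<and> ((j,i,-1) \<in> E \<longrightarrow> x j = d i)" (is "?l = ?r")
    proof
      assume ?l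
      from this[THEN spec, of 1] this[THEN spec, of "-1"] show ?r by auto
    next
      assume ?r
      then show ?l using s by (metis (full_types) one_neq_neg_one)
    qed
  qed
  also have "\<dots> \<longleftrightarrow> (f x i \<noteq> d i)"
    using f
  proof
    assume "is_conj E f i \<and> \<not> d i"
    then show ?thesis unfolding is_conj_def by simp
  next
    assume "is_disj E f i \<and> d i"
    then show ?thesis unfolding is_disj_def by simp
  qed
  finally show ?thesis .
qed

lemma run_barcs:
  assumes sg: "signed_digraph E" and f: "\<And>i. is_conj E f i \<and> \<not> d i \<or> is_disj E f i \<and> d i"
  shows "run (barcs d E) w (\<lambda>j. x j \<noteq> d j) = (\<lambda>j. update_word f w x j \<noteq> d j)"
proof (induction w arbitrary: x)
  case Nil
  then show ?case by (simp add: update_word_def)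
next
  case (Cons i w)
  have "upd (barcs d E) i (\<lambda>j. x j \<noteq> d j) = (\<lambda>j. (x(i := f x i)) j \<noteq> d j)"
    unfolding upd_def net_barcs[OF sg f] by (rule ext) simp
  moreover have "update_word f (i # w) x = update_word f w (x(i := f x i))"
    by (simp add: update_word_def)
  ultimately show ?case using Cons[of "x(i := f x i)"] by (simp only: run.simps)
qed

lemma chained_Cons: "es \<noteq> [] \<Longrightarrow> chained (a # es) \<longleftrightarrow> arc_tgt a = arc_src (hd es) \<and> chained es"
  by (cases es) auto

lemma chained_tgt: "chained es \<Longrightarrow> es \<noteq> [] \<Longrightarrow> map arc_tgt es = map arc_src (tl es) @ [arc_tgt (last es)]"
proof (induction es rule: chained.induct)
  case (3 a b es)
  then show ?case by auto
qed auto

text \<open>Complementation changes the sign of a path by a factor that depends only on its ends.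
  Cycles keep their sign, and two paths with common ends have equal signs before iff they do
  after.\<close>

lemma pth_arcs:
  assumes sg: "signed_digraph E" and p: "pth (barcs d E) M v i s"
  shows "\<exists>es. es \<noteq> [] \<and> set es \<subseteq> E \<and> chained es \<and> arc_src (hd es) = v \<and> arc_tgt (last es) = i \<and>
    distinct (map arc_src (tl es)) \<and> set (map arc_src (tl es)) \<subseteq> M \<and> walk_sign es \<in> {-1,1} \<and>
    (walk_sign es = 1) = (s = (d v = d i))"
  using p
proof (induction rule: pth.induct)
  case (arc u v b M)
  then obtain s where "(u,v,s) \<in> E" "b = ((s = 1) = (d u = d v))" by (auto simp: in_barcs)
  moreover from this have "s = 1 \<or> s = -1" using sg unfolding signed_digraph_def by auto
  ultimately show ?case by (intro exI[of _ "[(u,v,s)]"]) (auto simp: walk_sign_def)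
next
  case (step u w b M v t)
  from step.IH obtain es where es: "es \<noteq> []" "set es \<subseteq> E" "chained es" "arc_src (hd es) = w" "arc_tgt (last es) = v"
    "distinct (map arc_src (tl es))" "set (map arc_src (tl es)) \<subseteq> M - {w}" "walk_sign es \<in> {-1,1}"
    "(walk_sign es = 1) = (t = (d w = d v))" by blast
  from step(1) obtain s where s: "(u,w,s) \<in> E" "b = ((s = 1) = (d u = d w))" by (auto simp: in_barcs)
  then have s1: "s = 1 \<or> s = -1" using sg unfolding signed_digraph_def by auto
  have m: "map arc_src es = w # map arc_src (tl es)" using es(1,4) by (cases es) auto
  have ws: "walk_sign ((u,w,s) # es) = s * walk_sign es" by (simp add: walk_sign_def)
  have "distinct (map arc_src es)" "set (map arc_src es) \<subseteq> M" unfolding m using es(6,7) step(2) by auto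
  moreover have "walk_sign ((u,w,s) # es) \<in> {-1,1}" "(walk_sign ((u,w,s) # es) = 1) = ((b = t) = (d u = d v))"
    unfolding ws using es(8,9) s1 s(2) by auto
  ultimately show ?case using es s(1)
    by (intro exI[of _ "(u,w,s) # es"]) (simp add: chained_Cons)
qed

lemma pth_cycle:
  assumes "signed_digraph E" "pth (barcs d E) M i i s" "i \<notin> M"
  shows "\<exists>es. is_cycle E es \<and> arc_src (hd es) = i \<and> set (map arc_src es) \<subseteq> insert i M \<and> (walk_sign es = 1) = s"
proof -
  from pth_arcs[OF assms(1,2)] obtain es where es: "es \<noteq> []" "set es \<subseteq> E" "chained es" "arc_src (hd es) = i"
    "arc_tgt (last es) = i" "distinct (map arc_src (tl es))" "set (map arc_src (tl es)) \<subseteq> M" "(walk_sign es = 1) = s"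
    by auto
  have m: "map arc_src es = i # map arc_src (tl es)" using es(1,4) by (cases es) auto
  have "distinct (map arc_src es)" "set (map arc_src es) \<subseteq> insert i M" unfolding m using es(6,7) assms(3) by auto
  then show ?thesis using es by (intro exI[of _ es]) (simp add: is_cycle_def)
qed

lemma negcyc_barcs: "signed_digraph E \<Longrightarrow> \<not> has_positive_cycle E \<Longrightarrow> negcyc (barcs d E)"
  unfolding negcyc_def has_positive_cycle_def by (metis DiffD2 pth_cycle singletonI)

lemma arc_rel_barcs: "(j,i) \<in> arc_rel E \<longleftrightarrow> (\<exists>b. (j,i,b) \<in> barcs d E)"
  by (auto simp: arc_rel_def in_barcs)

lemma closed_in_arc_rel: "(b,a) \<in> (arc_rel E)\<^sup>* \<Longrightarrow> a \<in> K \<Longrightarrow> closed_in (barcs d E) UNIV K \<Longrightarrow> b \<in> K"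
proof (induction rule: converse_rtrancl_induct)
  case (step y z)
  then show ?case using arc_rel_barcs[of y z E d] unfolding closed_in_def by blast
qed

lemma minclo_initial:
  assumes K: "minclo (barcs d E) UNIV K"
  shows "initial_component E K"
proof -
  have ne: "K \<noteq> {}" and cl: "closed_in (barcs d E) UNIV K" using K by (auto simp: minclo_def)
  have st: "strong (barcs d E) K" by (rule minclo_imp_strong[OF K])
  have "(a,b) \<in> (arc_rel E)\<^sup>*" if ab: "a \<in> K" "b \<in> K" for a b
  proof (rule ccontr)
    define B where "B = {x \<in> K. (x,b) \<in> (arc_rel E)\<^sup>*}"
    assume "(a,b) \<notin> (arc_rel E)\<^sup>*"
    then have "B \<subseteq> K" "B \<noteq> {}" "B \<noteq> K" using ab by (auto simp: B_def)
    from strongE[OF st this] obtain j k c where j: "(j,k,c) \<in> barcs d E" "k \<in> B" "j \<in> K" "j \<notin> B" by blast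
    then have "(j,k) \<in> arc_rel E" using arc_rel_barcs[of j k E d] by blast
    then have "(j,b) \<in> (arc_rel E)\<^sup>*" using j(2) unfolding B_def by (simp add: converse_rtrancl_into_rtrancl)
    then show False using j(3,4) by (simp add: B_def)
  qed
  moreover have "b \<in> K" if "a \<in> K" "(b,a) \<in> (arc_rel E)\<^sup>*" for a b using closed_in_arc_rel[OF that(2,1) cl] .
  ultimately have "strong_component E K" using ne unfolding strong_component_def by blast
  moreover have "j \<in> K" if "(j,i,s) \<in> E" "i \<in> K" for j i s
    using cl that in_barcs[of j i _ d E] unfolding closed_in_def by blast
  ultimately show ?thesis unfolding initial_component_def by blast
qed

text \<open>A closed set contains an initial strong component, where homogeneity for
  \<open>a\<close> supplies \<open>k\<close>. A path through the closed set \<open>A\<close> to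
  \<open>a\<close> outside it ends with an arc that leaves \<open>A\<close> for good, so it is a
  forward path; the parent of \<open>k\<close> exists because there are no sources.\<close>

lemma loopable_barcs:
  fixes E :: "('v::finite) sdigraph"
  assumes sg: "signed_digraph E" and hg: "homogenous E" and ns: "\<forall>i. \<not> is_source E i"
  shows "loopable (barcs d E) UNIV"
  unfolding loopable_def
proof (intro conjI allI impI ballI)
  have par: "\<exists>j b. (j,a,b) \<in> barcs d E" for a using ns in_barcs[of _ a _ d E] unfolding is_source_def by blast
  show "\<exists>j\<in>UNIV. \<exists>b. (j,a,b) \<in> barcs d E" for a using par by blast
  fix A a assume A: "closed_in (barcs d E) UNIV A" and a: "a \<in> UNIV - A"
  show "hom_in (restr (barcs d E) A) A a"
    unfolding hom_in_def
  proof (intro allI impI)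
    fix C assume C: "C \<noteq> {}" "C \<subseteq> A" "closed_in (restr (barcs d E) A) UNIV C"
    have "closed_in (barcs d E) UNIV C" unfolding closed_in_def
    proof (intro allI impI)
      fix j k b assume j: "(j,k,b) \<in> barcs d E" "k \<in> C"
      then have "j \<in> A" using A C(2) unfolding closed_in_def by blast
      then have "(j,k,b) \<in> restr (barcs d E) A" using j(1) by simp
      then show "j \<in> C" using C(3) j(2) unfolding closed_in_def by blast
    qed
    from minclo_ex[OF C(1) subset_UNIV this] obtain K where K: "minclo (barcs d E) UNIV K" "K \<subseteq> C" .
    have sc: "strong_component E K" and clK: "closed_in (barcs d E) UNIV K"
      using minclo_initial[OF K(1)] K(1) unfolding initial_component_def minclo_def by auto
    from hg sc obtain k where k: "k \<in> K"
      "\<forall>p q. forward_path E k a p \<and> forward_path E k a q \<longrightarrow> walk_sign p = walk_sign q"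
      unfolding homogenous_def i_homogenous_def by blast
    have kA: "k \<in> A" using k(1) K(2) C(2) by blast
    obtain j b where j: "(j,k,b) \<in> barcs d E" using par by blast
    then have jK: "j \<in> K" using clK k(1) unfolding closed_in_def by blast
    have fw: "\<exists>p. forward_path E k a p \<and> (walk_sign p = 1) = (s = (d k = d a))"
      if p: "pth (restr (barcs d E) A) (A - {k}) k a s" for s
    proof -
      have "pth (barcs d E) (A - {k}) k a s" using p restr_sub by (rule pth_mono_arcs)
      from pth_arcs[OF sg this] obtain es where es: "es \<noteq> []" "set es \<subseteq> E" "chained es" "arc_src (hd es) = k"
        "arc_tgt (last es) = a" "distinct (map arc_src (tl es))" "set (map arc_src (tl es)) \<subseteq> A - {k}"
        "(walk_sign es = 1) = (s = (d k = d a))" by blast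
      have m: "map arc_src es = k # map arc_src (tl es)" using es(1,4) by (cases es) auto
      have sA: "set (map arc_src es) \<subseteq> A" unfolding m using es(7) kA by auto
      have "distinct (map arc_src es)" unfolding m using es(6,7) by auto
      then have "is_path E k a es" using es sA a unfolding is_path_def by auto
      moreover have "\<not> same_component E (arc_src (last es)) (arc_tgt (last es))"
      proof
        assume "same_component E (arc_src (last es)) (arc_tgt (last es))"
        then have "(a, arc_src (last es)) \<in> (arc_rel E)\<^sup>*" using es(5) by (simp add: same_component_def)
        moreover have "arc_src (last es) \<in> A" using sA es(1) by auto
        ultimately show False using closed_in_arc_rel[OF _ _ A] a by blast
      qed
      ultimately show ?thesis using es(1,8) unfolding forward_path_def by blast
    qed
    have "\<exists>t. \<forall>s. pth (restr (barcs d E) A) (A - {k}) k a s \<longrightarrow> s = t"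
    proof (cases "\<exists>t. pth (restr (barcs d E) A) (A - {k}) k a t")
      case True
      then obtain t where t: "pth (restr (barcs d E) A) (A - {k}) k a t" ..
      from fw[OF t] obtain p where p: "forward_path E k a p" "(walk_sign p = 1) = (t = (d k = d a))" by blast
      have "s = t" if s: "pth (restr (barcs d E) A) (A - {k}) k a s" for s
      proof -
        from fw[OF s] obtain q where q: "forward_path E k a q" "(walk_sign q = 1) = (s = (d k = d a))" by blast
        then have "walk_sign p = walk_sign q" using k(2) p(1) by blast
        then show ?thesis using p(2) q(2) by auto
      qed
      then show ?thesis by blast
    qed blast
    moreover have "j \<in> C" "k \<in> C" "j \<in> A" using jK k(1) K(2) C(2) by auto
    ultimately show "uniform_exit (restr (barcs d E) A) A a C"
      using j in_restr by metis
  qed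
qed

text \<open>Parallel arcs would close the same path to two cycles of opposite signs. This is what
  makes a component without branching a genuine cycle, as \<open>branching\<close> counts parents
  and not arcs.\<close>

lemma cycle_sign_unique:
  assumes nc: "negcyc E" and st: "strong E K" and nb: "branching E K = {}"
    and a: "(j,k,b) \<in> E" "(j,k,c) \<in> E" "j \<in> K" "k \<in> K"
  shows "b = c"
proof -
  have dK: "dominated E K k = K - {k}" by (rule dominated_cycle[OF st nb a(4)])
  have r: "rooted E K k (K - {k})" using dominated_rooted[OF a(4), of E] unfolding dK .
  have "j \<in> insert k (K - {k})" using a(3) by blast
  from rooted_value[OF st r this] obtain s where s: "j = k \<longrightarrow> s" "j \<noteq> k \<longrightarrow> pth E (K - {k} - {j}) k j s"
    by (elim exE conjE) (rule that)
  have "\<not> (s = e)" if e: "(j,k,e) \<in> E" for e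
  proof (cases "j = k")
    case True
    then have "pth E {} k k e" using e by (intro pth.arc) simp
    from negcyc_pth[OF nc this] show ?thesis using s True by simp
  next
    case False
    then have "pth E (insert j (K - {k} - {j} \<union> {})) k k (s = e)"
      using s(2) by (intro pth_concat) (auto intro: pth.arc e)
    from negcyc_pth[OF nc this] show ?thesis using False by simp
  qed
  from this[OF a(1)] this[OF a(2)] show ?thesis by blast
qed

text \<open>In a dead component each vertex has a single entering arc. A cycle in it is therefore
  closed under predecessors, so by minimality it exhausts the component, arcs included.\<close>

lemma dead_barcs:
  fixes E :: "('v::finite) sdigraph"
  assumes sg: "signed_digraph E" and np: "\<not> has_positive_cycle E" and ni: "\<not> has_initial_cycle E"
    and ns: "\<forall>i. \<not> is_source E i"
  shows "dead (barcs d E) UNIV = {}"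
proof (rule ccontr)
  let ?E = "barcs d E"
  assume "\<not> ?thesis"
  then obtain K where K: "minclo ?E UNIV K" "branching ?E K = {}" by (auto simp: dead_def)
  have nc: "negcyc ?E" by (rule negcyc_barcs[OF sg np])
  have st: "strong ?E K" by (rule minclo_imp_strong[OF K(1)])
  have ne: "K \<noteq> {}" and cl: "closed_in ?E UNIV K" using K by (auto simp: minclo_def)
  obtain e where e: "e \<in> K" using ne by blast
  have dK: "dominated ?E K e = K - {e}" by (rule dominated_cycle[OF st K(2) e])
  have r: "rooted ?E K e (K - {e})" using dominated_rooted[OF e, of ?E] unfolding dK .
  obtain j s where "(j,e,s) \<in> E" using ns unfolding is_source_def by blast
  then obtain b where j: "(j,e,b) \<in> ?E" using in_barcs[of j e _ d E] by blast
  then have "j \<in> K" using cl e unfolding closed_in_def by blast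
  then obtain t where "pth ?E (K - {e}) e e t" using rooted_arc_value[OF st r _ j] by blast
  from pth_cycle[OF sg this] obtain es where es: "is_cycle E es" "arc_src (hd es) = e"
    "set (map arc_src es) \<subseteq> insert e (K - {e})" by blast
  have es': "es \<noteq> []" "set es \<subseteq> E" "chained es" "arc_tgt (last es) = e" using es(1,2) by (auto simp: is_cycle_def)
  define Z where "Z = set (map arc_src es)"
  have ZK: "Z \<subseteq> K" using es(3) e by (auto simp: Z_def)
  have "set (map arc_tgt es) = Z"
  proof -
    have "map arc_src es = e # map arc_src (tl es)" using es'(1) es(2) by (cases es) auto
    then show ?thesis using chained_tgt[OF es'(3,1)] es'(4) by (simp add: Z_def)
  qed
  then have into: "\<exists>j s. (j,k,s) \<in> set es \<and> j \<in> Z" if "k \<in> Z" for k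
  proof -
    have "k \<in> arc_tgt ` set es" using that \<open>set (map arc_tgt es) = Z\<close> by (simp only: set_map)
    then obtain x where x: "x \<in> set es" "k = arc_tgt x" by (rule imageE)
    obtain j i s where "x = (j,i,s)" by (rule prod_cases3)
    then show ?thesis using x by (intro exI[of _ j] exI[of _ s]) (force simp: Z_def)
  qed
  have uniq: "j = j' \<and> s = s'" if "(j,k,s) \<in> E" "(j',k,s') \<in> E" "j \<in> K" "j' \<in> K" "k \<in> K" for j j' k s s'
  proof -
    let ?b = "\<lambda>j s. (s = 1) = (d j = d k)"
    have a: "(j,k,?b j s) \<in> ?E" "(j',k,?b j' s') \<in> ?E" using that by (auto simp: in_barcs)
    have jj: "j = j'"
    proof (rule ccontr)
      assume "j \<noteq> j'"
      then have "k \<in> branching ?E K" unfolding branching_def using a that(3-5) by blast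
      then show False using K(2) by simp
    qed
    then have "?b j s = ?b j s'" using cycle_sign_unique[OF nc st K(2) a(1)] a(2) that by blast
    moreover have "s = 1 \<or> s = -1" "s' = 1 \<or> s' = -1" using sg that(1,2) unfolding signed_digraph_def by auto
    ultimately show ?thesis using jj by auto
  qed
  have "closed_in ?E UNIV Z"
    unfolding closed_in_def
  proof (intro allI impI)
    fix j k b assume j: "(j,k,b) \<in> ?E" "k \<in> Z"
    then obtain s where s: "(j,k,s) \<in> E" by (auto simp: in_barcs)
    have "k \<in> K" "j \<in> K" using j ZK cl unfolding closed_in_def by blast+
    moreover obtain j' s' where "(j',k,s') \<in> set es" "j' \<in> Z" using into[OF j(2)] by blast
    ultimately show "j \<in> Z" using uniq[OF s, of j' s'] es'(2) ZK by blast
  qed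
  moreover have "Z \<noteq> {}" using es'(1) by (simp add: Z_def)
  ultimately have ZeqK: "Z = K" using K(1) ZK unfolding minclo_def by blast
  have "{a \<in> E. arc_src a \<in> K \<and> arc_tgt a \<in> K} = set es"
  proof (intro equalityI subsetI)
    fix a assume "a \<in> {a \<in> E. arc_src a \<in> K \<and> arc_tgt a \<in> K}"
    then obtain j k s where a: "a = (j,k,s)" "(j,k,s) \<in> E" "j \<in> K" "k \<in> K" by (cases a) auto
    obtain j' s' where "(j',k,s') \<in> set es" "j' \<in> Z" using into a(4) ZeqK by blast
    then show "a \<in> set es" using uniq[OF a(2), of j' s'] es'(2) ZK a by blast
  next
    fix a assume a: "a \<in> set es"
    then have "arc_src a \<in> Z" "arc_tgt a \<in> Z" using \<open>set (map arc_tgt es) = Z\<close> by (auto simp: Z_def)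
    then show "a \<in> {a \<in> E. arc_src a \<in> K \<and> arc_tgt a \<in> K}" using a es'(2) ZeqK by blast
  qed
  then have "has_initial_cycle E"
    unfolding has_initial_cycle_def using minclo_initial[OF K(1)] es(1) ZeqK unfolding Z_def by blast
  then show False using ni by simp
qed

theorem theorem4:
  fixes E :: "('v::finite) sdigraph" and f :: "'v BN"
  assumes "signed_digraph E"
    and "homogenous E"
    and "\<not> has_positive_cycle E"
    and "\<forall>i. \<not> is_source E i"
    and "\<not> has_initial_cycle E"
    and "and_or_net E f"
  shows "\<exists>w. synchronizing f w \<and> real (length w) \<le> 10 * (sqrt 5 + 1) ^ card (UNIV :: 'v set)"
proof -
  \<comment> \<open>A vertex with a single in-arc is both a conjunction and a disjunction; it is
    left uncomplemented.\<close>
  define d where "d i \<longleftrightarrow> \<not> is_conj E f i" for i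
  have f: "is_conj E f i \<and> \<not> d i \<or> is_disj E f i \<and> d i" for i
    using assms(6) unfolding and_or_net_def d_def by blast
  from and_net_synchronizing[OF negcyc_barcs[OF assms(1,3)] loopable_barcs[OF assms(1,2,4)] dead_barcs[OF assms(1,3,5,4)], of d]
  obtain w where w: "\<forall>x y. run (barcs d E) w x = run (barcs d E) w y"
    "real (length w) \<le> 10 * (sqrt 5 + 1) ^ card (UNIV :: 'v set)" by blast
  have "update_word f w x = update_word f w y" for x y
  proof -
    have "(\<lambda>j. update_word f w x j \<noteq> d j) = (\<lambda>j. update_word f w y j \<noteq> d j)"
      unfolding run_barcs[OF assms(1) f, symmetric] using w(1) by blast
    then show ?thesis by (auto simp: fun_eq_iff)
  qed
  then have "synchronizing f w" unfolding synchronizing_def by blast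
  then show ?thesis using w(2) by blast
qed

end
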